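(* Let $\mathcal{D}$ be a set. The Hopf algebras $(\mathit{CP}(\mathcal{D}),\cdot,\Delta)$ and $\mathcal{H}_{CK}^{\mathcal{D}}$ are isomorphic to shuffle algebras: each of them is isomorphic, as a Hopf algebra, to $(T(V),\mathbin{\sqcup\!\sqcup},\Delta)$ for some vector space $V$.
   Context: $\mathbb{K}$ is a field of characteristic zero. For a vector space $V$, $(T(V),\mathbin{\sqcup\!\sqcup},\Delta)$ is the shuffle Hopf algebra: $T(V)$ with the shuffle product and the deconcatenation coproduct. A partitioned forest is a (finite) rooted forest $F$ with vertex set $V(F)$, edges oriented from the roots to the leaves, together with a partition of $V(F)$ into blocks such that two vertices in the same block are either both roots or have the same parent. It is a partitioned tree if all its roots lie in one block; the empty forest $\emptyset$ is a partitioned tree. $\mathit{CP}(\mathcal{D})$ is the vector space with basis the isomorphism classes of partitioned trees (including $\emptyset$) with vertices decorated by $\mathcal{D}$. $T\cdot T'$ is the disjoint union of $T$ and $T'$ with their two blocks of roots merged into one block. The coproduct is $\Delta(T)=\sum_I R^I(T)\otimes P^I(T)$, summed over all ideals $I$ of $T$, i.e. subsets $I\subseteq V(T)$ such that if $v\in I$ and there is an edge from $v$ to $w$ then $w\in I$; $R^I(T)$ is the restriction of $T$ to $V(T)\setminus I$ (blocks intersected with $V(T)\setminus I$), and $P^I(T)$ is the restriction of $T$ to $I$ (blocks intersected with $I$) with, in addition, all its roots put in a single block. $\mathcal{H}_{CK}^{\mathcal{D}}$ is the Connes-Kreimer Hopf algebra of rooted trees decorated by $\mathcal{D}$: basis the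 decorated rooted forests, product the disjoint union, coproduct the unique algebra morphism with $\Delta(B_d(F))=\emptyset\otimes B_d(F)+(B_d\otimes\mathrm{Id})\circ\Delta(F)$ for all $d\in\mathcal{D}$ and forests $F$, where $B_d(F)$ is obtained by grafting the trees of $F$ on a common root decorated by $d$. *)

theory Defs
  imports
    Complex_Main
    "HOL-Library.Poly_Mapping"
    "HOL-Library.Multiset"
    "HOL-Library.Disjoint_Sets"
    "HOL-Library.Nat_Bijection"
    "HOL-Library.Product_Plus"
begin

section \<open>Bialgebras inside free vector spaces\<close>

text \<open>
  The vector space with basis \<open>X\<close> is the type of finitely supported functions on \<open>X\<close>;
  \<open>Poly_Mapping.single x 1\<close> is the basis vector \<open>x\<close>.
\<close>

definition pm_scale :: "'k::field \<Rightarrow> ('x \<Rightarrow>\<^sub>0 'k) \<Rightarrow> ('x \<Rightarrow>\<^sub>0 'k)" where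
  "pm_scale c p = Poly_Mapping.map ((*) c) p"

lemma lookup_pm_scale [simp]: "Poly_Mapping.lookup (pm_scale c p) x = c * Poly_Mapping.lookup p x"
  by (simp add: pm_scale_def Poly_Mapping.map.rep_eq when_def)

lemma vector_space_pm_scale: "vector_space (pm_scale :: 'k::field \<Rightarrow> ('x \<Rightarrow>\<^sub>0 'k) \<Rightarrow> _)"
  by standard (auto intro!: poly_mapping_eqI simp: Poly_Mapping.lookup_add algebra_simps)

definition lin_ext :: "('x \<Rightarrow> ('y \<Rightarrow>\<^sub>0 'k::field)) \<Rightarrow> ('x \<Rightarrow>\<^sub>0 'k) \<Rightarrow> ('y \<Rightarrow>\<^sub>0 'k)" where
  "lin_ext g p = (\<Sum>x\<in>Poly_Mapping.keys p. pm_scale (Poly_Mapping.lookup p x) (g x))"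

definition bilin_ext ::
    "('x \<Rightarrow> 'y \<Rightarrow> ('z \<Rightarrow>\<^sub>0 'k::field)) \<Rightarrow> ('x \<Rightarrow>\<^sub>0 'k) \<Rightarrow> ('y \<Rightarrow>\<^sub>0 'k) \<Rightarrow> ('z \<Rightarrow>\<^sub>0 'k)" where
  "bilin_ext g p q = lin_ext (\<lambda>x. lin_ext (\<lambda>y. g x y) q) p"

text \<open>
  The tensor product of the spaces with bases \<open>X\<close> and \<open>Y\<close> is the space with basis \<open>X \<times> Y\<close>.
\<close>

definition tensor :: "('x \<Rightarrow>\<^sub>0 'k::field) \<Rightarrow> ('y \<Rightarrow>\<^sub>0 'k) \<Rightarrow> ('x \<times> 'y \<Rightarrow>\<^sub>0 'k)" where
  "tensor = bilin_ext (\<lambda>x y. Poly_Mapping.single (x, y) 1)"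

definition tensor_map ::
    "(('x \<Rightarrow>\<^sub>0 'k::field) \<Rightarrow> ('u \<Rightarrow>\<^sub>0 'k)) \<Rightarrow> (('y \<Rightarrow>\<^sub>0 'k) \<Rightarrow> ('w \<Rightarrow>\<^sub>0 'k)) \<Rightarrow>
     ('x \<times> 'y \<Rightarrow>\<^sub>0 'k) \<Rightarrow> ('u \<times> 'w \<Rightarrow>\<^sub>0 'k)" where
  "tensor_map f g = lin_ext (\<lambda>(x, y). tensor (f (Poly_Mapping.single x 1)) (g (Poly_Mapping.single y 1)))"

text \<open>
  The underlying space \<open>hspace A\<close> is a subspace of a free vector space, and only the restrictions
  of the structure maps to it are meaningful; the coproduct takes \<open>hspace A\<close> into
  \<open>hspace A \<otimes> hspace A\<close>, that is, into the span of the \<open>tensor a b\<close> with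
  \<open>a, b \<in> hspace A\<close>.
\<close>

record (overloaded) ('x, 'k::zero) bialg =
  hspace :: "('x \<Rightarrow>\<^sub>0 'k) set"
  hmult :: "('x \<Rightarrow>\<^sub>0 'k) \<Rightarrow> ('x \<Rightarrow>\<^sub>0 'k) \<Rightarrow> ('x \<Rightarrow>\<^sub>0 'k)"
  hone :: "'x \<Rightarrow>\<^sub>0 'k"
  hcomult :: "('x \<Rightarrow>\<^sub>0 'k) \<Rightarrow> ('x \<times> 'x \<Rightarrow>\<^sub>0 'k)"
  hcounit :: "('x \<Rightarrow>\<^sub>0 'k) \<Rightarrow> 'k"

text \<open>
  Every linear map on a subspace extends to the ambient space, and the restriction of
  \<open>tensor_map \<phi> \<phi>\<close> to \<open>hspace A \<otimes> hspace A\<close> depends only on the restriction of \<open>\<phi>\<close> to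
  \<open>hspace A\<close>; so there is no loss in taking \<open>\<phi>\<close> linear on the ambient space. Isomorphisms of
  bialgebras automatically commute with antipodes.
\<close>

definition hopf_iso ::
    "('x, 'k::field) bialg \<Rightarrow> ('y, 'k) bialg \<Rightarrow> (('x \<Rightarrow>\<^sub>0 'k) \<Rightarrow> ('y \<Rightarrow>\<^sub>0 'k)) \<Rightarrow> bool" where
  "hopf_iso A B \<phi> \<longleftrightarrow>
     Vector_Spaces.linear pm_scale pm_scale \<phi> \<and>
     bij_betw \<phi> (hspace A) (hspace B) \<and>
     (\<forall>a\<in>hspace A. \<forall>b\<in>hspace A. \<phi> (hmult A a b) = hmult B (\<phi> a) (\<phi> b)) \<and>
     \<phi> (hone A) = hone B \<and>
     (\<forall>a\<in>hspace A. hcomult B (\<phi> a) = tensor_map \<phi> \<phi> (hcomult A a)) \<and>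
     (\<forall>a\<in>hspace A. hcounit B (\<phi> a) = hcounit A a)"

definition hopf_isomorphic :: "('x, 'k::field) bialg \<Rightarrow> ('y, 'k) bialg \<Rightarrow> bool" where
  "hopf_isomorphic A B \<longleftrightarrow> (\<exists>\<phi>. hopf_iso A B \<phi>)"


section \<open>The shuffle Hopf algebra of a vector space\<close>

text \<open>
  A vector space \<open>V\<close> is given as a subspace of a free vector space \<open>U\<close> with basis \<open>B\<close>. The words
  in \<open>B\<close> are the basis of \<open>T(U)\<close> consisting of the tensors \<open>b\<^sub>1 \<otimes> \<dots> \<otimes> b\<^sub>n\<close>, and \<open>T(V)\<close> is the
  subspace of \<open>T(U)\<close> spanned by the tensors \<open>v\<^sub>1 \<otimes> \<dots> \<otimes> v\<^sub>n\<close> with all \<open>v\<^sub>i \<in> V\<close>. The shuffle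
  product and the deconcatenation coproduct are multilinear in the letters, hence determined on
  \<open>T(V)\<close> by their values on words in \<open>B\<close>.
\<close>

fun pure_tensor :: "('b \<Rightarrow>\<^sub>0 'k::field) list \<Rightarrow> ('b list \<Rightarrow>\<^sub>0 'k)" where
  "pure_tensor [] = Poly_Mapping.single [] 1"
| "pure_tensor (v # vs) = bilin_ext (\<lambda>b w. Poly_Mapping.single (b # w) 1) v (pure_tensor vs)"

definition tensor_space :: "('b \<Rightarrow>\<^sub>0 'k::field) set \<Rightarrow> ('b list \<Rightarrow>\<^sub>0 'k) set" where
  "tensor_space V = module.span pm_scale (pure_tensor ` lists V)"

text \<open>The library's \<open>shuffles\<close> is a set and forgets multiplicities.\<close>

fun shuffle_words :: "'b list \<Rightarrow> 'b list \<Rightarrow> 'b list multiset" where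
  "shuffle_words [] w = {#w#}"
| "shuffle_words u [] = {#u#}"
| "shuffle_words (a # u) (b # w) =
     image_mset ((#) a) (shuffle_words u (b # w)) + image_mset ((#) b) (shuffle_words (a # u) w)"

definition shuffle_prod :: "('b list \<Rightarrow>\<^sub>0 'k::field) \<Rightarrow> ('b list \<Rightarrow>\<^sub>0 'k) \<Rightarrow> ('b list \<Rightarrow>\<^sub>0 'k)" where
  "shuffle_prod = bilin_ext (\<lambda>u w. \<Sum>x\<in>#shuffle_words u w. Poly_Mapping.single x 1)"

definition deconcatenation :: "('b list \<Rightarrow>\<^sub>0 'k::field) \<Rightarrow> ('b list \<times> 'b list \<Rightarrow>\<^sub>0 'k)" where
  "deconcatenation = lin_ext (\<lambda>w. \<Sum>i\<le>length w. Poly_Mapping.single (take i w, drop i w) 1)"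

definition shuffle_algebra :: "('b \<Rightarrow>\<^sub>0 'k::field) set \<Rightarrow> ('b list, 'k) bialg" where
  "shuffle_algebra V =
     \<lparr>hspace = tensor_space V,
      hmult = shuffle_prod,
      hone = Poly_Mapping.single [] 1,
      hcomult = deconcatenation,
      hcounit = (\<lambda>p. Poly_Mapping.lookup p [])\<rparr>"


section \<open>Partitioned forests and trees\<close>

record ('v, 'd) pforest =
  verts :: "'v set"
  edges :: "('v \<times> 'v) set"
  blocks :: "'v set set"
  deco :: "'v \<Rightarrow> 'd"

definition roots :: "('v, 'd) pforest \<Rightarrow> 'v set" where
  "roots F = {v \<in> verts F. \<forall>u. (u, v) \<notin> edges F}"

definition partitioned_forest :: "('v, 'd) pforest \<Rightarrow> bool" where
  "partitioned_forest F \<longleftrightarrow>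
     finite (verts F) \<and> edges F \<subseteq> verts F \<times> verts F \<and> acyclic (edges F) \<and>
     (\<forall>u u' v. (u, v) \<in> edges F \<longrightarrow> (u', v) \<in> edges F \<longrightarrow> u = u') \<and>
     partition_on (verts F) (blocks F) \<and>
     (\<forall>B\<in>blocks F. \<forall>v\<in>B. \<forall>w\<in>B.
        (v \<in> roots F \<and> w \<in> roots F) \<or> (\<exists>u. (u, v) \<in> edges F \<and> (u, w) \<in> edges F))"

definition partitioned_tree :: "('v, 'd) pforest \<Rightarrow> bool" where
  "partitioned_tree F \<longleftrightarrow>
     partitioned_forest F \<and> (verts F = {} \<or> (\<exists>B\<in>blocks F. roots F \<subseteq> B))"

text \<open>Only the decorations of actual vertices matter.\<close>

definition pforest_iso_by ::
    "('v \<Rightarrow> 'w) \<Rightarrow> ('v, 'd) pforest \<Rightarrow> ('w, 'd) pforest \<Rightarrow> bool" where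
  "pforest_iso_by f F G \<longleftrightarrow>
     bij_betw f (verts F) (verts G) \<and>
     (\<forall>u\<in>verts F. \<forall>v\<in>verts F. (u, v) \<in> edges F \<longleftrightarrow> (f u, f v) \<in> edges G) \<and>
     (`) f ` blocks F = blocks G \<and>
     (\<forall>v\<in>verts F. deco G (f v) = deco F v)"

definition pforest_iso :: "('v, 'd) pforest \<Rightarrow> ('w, 'd) pforest \<Rightarrow> bool" where
  "pforest_iso F G \<longleftrightarrow> (\<exists>f. pforest_iso_by f F G)"

definition restrict_pforest :: "('v, 'd) pforest \<Rightarrow> 'v set \<Rightarrow> ('v, 'd) pforest" where
  "restrict_pforest F U =
     \<lparr>verts = verts F \<inter> U,
      edges = edges F \<inter> U \<times> U,
      blocks = (\<lambda>B. B \<inter> U) ` blocks F - {{}},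
      deco = deco F\<rparr>"

definition merge_roots :: "('v, 'd) pforest \<Rightarrow> ('v, 'd) pforest" where
  "merge_roots F = F\<lparr>blocks := insert (roots F) {B \<in> blocks F. \<not> B \<subseteq> roots F} - {{}}\<rparr>"

definition disjoint_union ::
    "('v, 'd) pforest \<Rightarrow> ('w, 'd) pforest \<Rightarrow> ('v + 'w, 'd) pforest" where
  "disjoint_union F G =
     \<lparr>verts = verts F <+> verts G,
      edges = map_prod Inl Inl ` edges F \<union> map_prod Inr Inr ` edges G,
      blocks = (`) Inl ` blocks F \<union> (`) Inr ` blocks G,
      deco = case_sum (deco F) (deco G)\<rparr>"

definition relabel :: "('v \<Rightarrow> 'w) \<Rightarrow> ('v, 'd) pforest \<Rightarrow> ('w, 'd) pforest" where
  "relabel f F =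
     \<lparr>verts = f ` verts F,
      edges = map_prod f f ` edges F,
      blocks = (`) f ` blocks F,
      deco = deco F \<circ> inv_into (verts F) f\<rparr>"

definition ideals :: "('v, 'd) pforest \<Rightarrow> 'v set set" where
  "ideals F = {I. I \<subseteq> verts F \<and> (\<forall>v w. v \<in> I \<longrightarrow> (v, w) \<in> edges F \<longrightarrow> w \<in> I)}"

definition R_part :: "('v, 'd) pforest \<Rightarrow> 'v set \<Rightarrow> ('v, 'd) pforest" where
  "R_part F I = restrict_pforest F (verts F - I)"

definition P_part :: "('v, 'd) pforest \<Rightarrow> 'v set \<Rightarrow> ('v, 'd) pforest" where
  "P_part F I = merge_roots (restrict_pforest F I)"


subsection \<open>Compatibility with isomorphism\<close>

lemma pforest_iso_refl: "pforest_iso F F"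
  unfolding pforest_iso_def pforest_iso_by_def by (intro exI[of _ id]) auto

lemma partitioned_forest_parent_unique:
  assumes "partitioned_forest F" "(u, v) \<in> edges F" "(u', v) \<in> edges F"
  shows "u = u'"
proof -
  have "\<forall>u u' v. (u, v) \<in> edges F \<longrightarrow> (u', v) \<in> edges F \<longrightarrow> u = u'"
    using assms(1) unfolding partitioned_forest_def by (elim conjE)
  then show ?thesis using assms(2,3) by blast
qed

lemma pforest_iso_by_sym:
  assumes pf: "partitioned_forest F" and i: "pforest_iso_by f F G"
  shows "pforest_iso_by (inv_into (verts F) f) G F"
proof -
  let ?g = "inv_into (verts F) f"
  have b: "bij_betw f (verts F) (verts G)" using i by (simp add: pforest_iso_by_def)
  have bg: "bij_betw ?g (verts G) (verts F)" using b by (rule bij_betw_inv_into)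
  have fg: "f (?g y) = y" if "y \<in> verts G" for y using b that by (rule bij_betw_inv_into_right)
  have gf: "?g (f x) = x" if "x \<in> verts F" for x using b that by (rule bij_betw_inv_into_left)
  have gv: "?g y \<in> verts F" if "y \<in> verts G" for y using bg that by (auto simp: bij_betw_def)
  have sub: "B \<subseteq> verts F" if "B \<in> blocks F" for B
    using pf that by (auto simp: partitioned_forest_def partition_on_def)
  have im: "?g ` f ` B = B" if "B \<in> blocks F" for B
    using sub[OF that] gf by (force simp: image_image)
  have "(`) ?g ` blocks G = (`) ?g ` (`) f ` blocks F" using i by (simp add: pforest_iso_by_def)
  also have "\<dots> = blocks F" using im by (force simp: image_image)
  finally have 1: "(`) ?g ` blocks G = blocks F" .
  show ?thesis
    unfolding pforest_iso_by_def using bg 1 i gv fg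
    by (simp add: pforest_iso_by_def) metis
qed

lemma pforest_iso_by_trans:
  assumes "pforest_iso_by f F G" "pforest_iso_by g G H"
  shows "pforest_iso_by (g \<circ> f) F H"
proof -
  have v: "f v \<in> verts G" if "v \<in> verts F" for v
    using assms(1) that by (auto simp: pforest_iso_by_def bij_betw_def)
  have "(`) (g \<circ> f) ` blocks F = (`) g ` (`) f ` blocks F"
    by (simp add: image_image)
  then have bl: "(`) (g \<circ> f) ` blocks F = blocks H"
    using assms unfolding pforest_iso_by_def by simp
  have b: "bij_betw (g \<circ> f) (verts F) (verts H)"
    using assms bij_betw_trans[of f "verts F" "verts G" g "verts H"]
    by (simp add: pforest_iso_by_def)
  show ?thesis
    using assms v b bl by (simp add: pforest_iso_by_def)
qed

lemma pforest_iso_by_blocks_sub: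
  assumes "partitioned_forest F" "B \<in> blocks F"
  shows "B \<subseteq> verts F" "B \<noteq> {}"
  using assms by (auto simp: partitioned_forest_def partition_on_def)

lemma pforest_iso_by_roots:
  assumes "partitioned_forest F" "partitioned_forest G" "pforest_iso_by f F G"
  shows "roots G = f ` roots F"
proof -
  have b: "f ` verts F = verts G" and
    e: "\<And>u v. u \<in> verts F \<Longrightarrow> v \<in> verts F \<Longrightarrow> (u, v) \<in> edges F \<longleftrightarrow> (f u, f v) \<in> edges G"
    using assms(3) by (auto simp: pforest_iso_by_def bij_betw_def)
  have s: "edges F \<subseteq> verts F \<times> verts F" "edges G \<subseteq> verts G \<times> verts G"
    using assms by (auto simp: partitioned_forest_def)
  have "f v \<in> roots G \<longleftrightarrow> v \<in> roots F" if v: "v \<in> verts F" for v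
  proof -
    have "(\<exists>x. (x, f v) \<in> edges G) \<longleftrightarrow> (\<exists>u. (u, v) \<in> edges F)"
    proof
      assume "\<exists>x. (x, f v) \<in> edges G"
      then obtain x where x: "(x, f v) \<in> edges G" by blast
      then have "x \<in> f ` verts F" using s b by blast
      then show "\<exists>u. (u, v) \<in> edges F" using x e v by blast
    next
      assume "\<exists>u. (u, v) \<in> edges F"
      then show "\<exists>x. (x, f v) \<in> edges G" using s e v by blast
    qed
    then show ?thesis using v b by (auto simp: roots_def)
  qed
  moreover have "roots G \<subseteq> f ` verts F" "roots F \<subseteq> verts F" using b by (auto simp: roots_def)
  ultimately show ?thesis by blast
qed

lemma restrict_roots:
  assumes "edges F \<subseteq> verts F \<times> verts F"
  shows "roots (restrict_pforest F U) = {v \<in> verts F \<inter> U. \<forall>u\<in>U. (u, v) \<notin> edges F}"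
  by (auto simp: roots_def restrict_pforest_def)

lemma partitioned_forest_restrict:
  assumes "partitioned_forest F"
  shows "partitioned_forest (restrict_pforest F U)"
proof -
  let ?R = "restrict_pforest F U"
  have e: "edges F \<subseteq> verts F \<times> verts F" using assms by (simp add: partitioned_forest_def)
  have ac: "acyclic (edges F \<inter> U \<times> U)"
    using assms by (auto simp: partitioned_forest_def intro: acyclic_subset)
  have p: "partition_on (verts F \<inter> U) ((\<lambda>B. B \<inter> U) ` blocks F - {{}})"
    using assms by (intro partition_on_transform) (auto simp: partitioned_forest_def disjnt_def)
  have bl: "(v \<in> roots ?R \<and> w \<in> roots ?R) \<or> (\<exists>u. (u, v) \<in> edges ?R \<and> (u, w) \<in> edges ?R)"
    if B: "B \<in> blocks ?R" "v \<in> B" "w \<in> B" for B v w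
  proof -
    obtain C where C: "C \<in> blocks F" "B = C \<inter> U"
      using B by (auto simp: restrict_pforest_def)
    have vw: "v \<in> C" "w \<in> C" "v \<in> U" "w \<in> U" using B C by auto
    have vs: "v \<in> verts F" "w \<in> verts F"
      using vw pforest_iso_by_blocks_sub[OF assms C(1)] by auto
    have un: "\<And>u u' v. (u, v) \<in> edges F \<Longrightarrow> (u', v) \<in> edges F \<Longrightarrow> u = u'"
      using partitioned_forest_parent_unique[OF assms] by blast
    have "(v \<in> roots F \<and> w \<in> roots F) \<or> (\<exists>u. (u, v) \<in> edges F \<and> (u, w) \<in> edges F)"
      using assms C vw by (auto simp: partitioned_forest_def)
    then show ?thesis
    proof
      assume "v \<in> roots F \<and> w \<in> roots F"
      then have "v \<in> roots ?R \<and> w \<in> roots ?R"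
        using vw vs unfolding restrict_roots[OF e] by (auto simp: roots_def)
      then show ?thesis ..
    next
      assume "\<exists>u. (u, v) \<in> edges F \<and> (u, w) \<in> edges F"
      then obtain u where u: "(u, v) \<in> edges F" "(u, w) \<in> edges F" by blast
      show ?thesis
      proof (cases "u \<in> U")
        case True
        then have "(u, v) \<in> edges ?R \<and> (u, w) \<in> edges ?R"
          using u vw by (simp add: restrict_pforest_def)
        then show ?thesis by blast
      next
        case False
        have "u' \<notin> U" if "(u', v) \<in> edges F \<or> (u', w) \<in> edges F" for u'
          using that u un False by metis
        then show ?thesis using vw vs by (auto simp: restrict_roots[OF e])
      qed
    qed
  qed
  show ?thesis
    unfolding partitioned_forest_def
    using assms e ac p bl
    by (simp add: restrict_pforest_def partitioned_forest_def) blast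
qed

lemma roots_merge_roots [simp]: "roots (merge_roots F) = roots F"
  by (simp add: roots_def merge_roots_def)

lemma partitioned_forest_root_block:
  assumes "partitioned_forest F" "B \<in> blocks F"
  shows "B \<subseteq> roots F \<or> B \<inter> roots F = {}"
proof -
  have "w \<in> roots F" if vw: "v \<in> B" "w \<in> B" "v \<in> roots F" for v w
  proof -
    have "(v \<in> roots F \<and> w \<in> roots F) \<or> (\<exists>u. (u, v) \<in> edges F \<and> (u, w) \<in> edges F)"
      using assms vw(1,2) unfolding partitioned_forest_def by blast
    then show ?thesis using vw(3) by (auto simp: roots_def)
  qed
  then show ?thesis by blast
qed

lemma acyclic_has_root:
  assumes "partitioned_forest F" "verts F \<noteq> {}"
  shows "roots F \<noteq> {}"
proof -
  have "edges F \<subseteq> verts F \<times> verts F" "finite (verts F)" "acyclic (edges F)"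
    using assms(1) unfolding partitioned_forest_def by blast+
  then have "wf (edges F)" by (meson finite_SigmaI finite_acyclic_wf finite_subset)
  moreover obtain x where "x \<in> verts F" using assms(2) by blast
  ultimately obtain v where v: "v \<in> verts F" "\<And>u. (u, v) \<in> edges F \<Longrightarrow> u \<notin> verts F"
    using wfE_min by metis
  have "edges F \<subseteq> verts F \<times> verts F" using assms(1) by (simp add: partitioned_forest_def)
  then have "v \<in> roots F" using v unfolding roots_def by blast
  then show ?thesis by blast
qed

lemma partitioned_tree_merge_roots:
  assumes "partitioned_forest F"
  shows "partitioned_tree (merge_roots F)"
proof -
  let ?P = "insert (roots F) {B \<in> blocks F. \<not> B \<subseteq> roots F} - {{}}"
  have rv: "roots F \<subseteq> verts F" by (auto simp: roots_def)
  have pt: "partition_on (verts F) (blocks F)" using assms by (simp add: partitioned_forest_def)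
  have rb: "B \<inter> roots F = {}" if "B \<in> blocks F" "\<not> B \<subseteq> roots F" for B
    using partitioned_forest_root_block[OF assms that(1)] that(2) by blast
  have p: "partition_on (verts F) ?P"
  proof (rule partition_onI)
    have u: "\<Union>(blocks F) = verts F" using pt by (simp add: partition_on_def)
    show "\<Union>?P = verts F"
    proof (intro equalityI subsetI)
      fix x assume "x \<in> \<Union>?P"
      then show "x \<in> verts F" using u rv by blast
    next
      fix x assume "x \<in> verts F"
      then obtain B where B: "B \<in> blocks F" "x \<in> B" using u by blast
      show "x \<in> \<Union>?P"
      proof (cases "B \<subseteq> roots F")
        case True
        then show ?thesis using B by blast
      next
        case False
        then show ?thesis using B by blast
      qed
    qed
    have d: "p \<inter> q = {}" if "p \<in> blocks F" "q \<in> blocks F" "p \<noteq> q" for p q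
      using pt that unfolding partition_on_def disjoint_def by blast
    show "disjnt p q" if "p \<in> ?P" "q \<in> ?P" "p \<noteq> q" for p q
      using that rb d unfolding disjnt_def by blast
    show "{} \<notin> ?P" by simp
  qed
  have "partitioned_forest (merge_roots F)"
    unfolding partitioned_forest_def roots_merge_roots
    using assms p partitioned_forest_root_block[OF assms]
    unfolding partitioned_forest_def by (simp add: merge_roots_def) (blast+)?
  moreover have "verts F = {} \<or> roots F \<in> blocks (merge_roots F)"
    using acyclic_has_root[OF assms] by (auto simp: merge_roots_def)
  ultimately show ?thesis
    unfolding partitioned_tree_def roots_merge_roots by (auto simp: merge_roots_def)
qed

lemma partitioned_tree_P_part:
  "partitioned_forest F \<Longrightarrow> partitioned_tree (P_part F I)"
  by (simp add: P_part_def partitioned_tree_merge_roots partitioned_forest_restrict)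

lemma partitioned_tree_R_part:
  assumes "partitioned_tree F" "I \<in> ideals F"
  shows "partitioned_tree (R_part F I)"
proof -
  have pf: "partitioned_forest F" using assms by (simp add: partitioned_tree_def)
  let ?R = "R_part F I"
  have pR: "partitioned_forest ?R"
    by (simp add: R_part_def partitioned_forest_restrict pf)
  have e: "edges F \<subseteq> verts F \<times> verts F" using pf by (simp add: partitioned_forest_def)
  have r: "roots ?R \<subseteq> roots F - I"
    using assms(2) e unfolding R_part_def restrict_roots[OF e]
    by (auto simp: roots_def ideals_def)
  have "\<exists>B\<in>blocks ?R. roots ?R \<subseteq> B" if ne: "verts ?R \<noteq> {}"
  proof -
    have ne': "verts F \<noteq> {}" using ne by (auto simp: R_part_def restrict_pforest_def)
    then obtain B where B: "B \<in> blocks F" "roots F \<subseteq> B"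
      using assms by (auto simp: partitioned_tree_def)
    have sub: "roots ?R \<subseteq> B \<inter> (verts F - I)" using r B by (auto simp: roots_def)
    moreover have "B \<inter> (verts F - I) \<noteq> {}" using acyclic_has_root[OF pR ne] sub by blast
    ultimately have "B \<inter> (verts F - I) \<in> blocks ?R" using B(1)
      by (simp add: R_part_def restrict_pforest_def)
    then show ?thesis using sub by blast
  qed
  then show ?thesis using pR by (auto simp: partitioned_tree_def)
qed

lemma partitioned_forest_relabel:
  assumes "partitioned_forest F" "inj_on f (verts F)"
  shows "pforest_iso_by f F (relabel f F)"
proof -
  have e: "edges F \<subseteq> verts F \<times> verts F" using assms by (simp add: partitioned_forest_def)
  have "(u, v) \<in> edges F \<longleftrightarrow> (f u, f v) \<in> map_prod f f ` edges F"
    if "u \<in> verts F" "v \<in> verts F" for u v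
  proof
    assume "(f u, f v) \<in> map_prod f f ` edges F"
    then obtain a b where ab: "(a, b) \<in> edges F" "f u = f a" "f v = f b" by auto
    moreover have "a \<in> verts F" "b \<in> verts F" using e ab by auto
    ultimately show "(u, v) \<in> edges F" using that assms(2) by (auto dest: inj_onD)
  next
    assume "(u, v) \<in> edges F"
    then have "map_prod f f (u, v) \<in> map_prod f f ` edges F" by (rule imageI)
    then show "(f u, f v) \<in> map_prod f f ` edges F" by simp
  qed
  then show ?thesis
    using assms by (auto simp: pforest_iso_by_def relabel_def bij_betw_def)
qed

lemma pforest_iso_by_partitioned_forest:
  assumes i: "pforest_iso_by f F G" and pf: "partitioned_forest F"
    and e: "edges G \<subseteq> verts G \<times> verts G"
  shows "partitioned_forest G"
proof -
  have b: "inj_on f (verts F)" "f ` verts F = verts G" and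
    ee: "\<And>u v. u \<in> verts F \<Longrightarrow> v \<in> verts F \<Longrightarrow> (u, v) \<in> edges F \<longleftrightarrow> (f u, f v) \<in> edges G"
    and bl: "blocks G = (`) f ` blocks F"
    using i by (auto simp: pforest_iso_by_def bij_betw_def)
  have eF: "edges F \<subseteq> verts F \<times> verts F" using pf by (simp add: partitioned_forest_def)
  let ?g = "inv_into (verts F) f"
  have gf: "?g (f v) = v" if "v \<in> verts F" for v using b that by simp
  have down: "(?g x, ?g y) \<in> edges F" if "(x, y) \<in> edges G" for x y
  proof -
    have "x \<in> f ` verts F" "y \<in> f ` verts F" using that e b(2) by auto
    then obtain u v where uv: "u \<in> verts F" "v \<in> verts F" "x = f u" "y = f v" by blast
    then show ?thesis using that ee[of u v] gf by simp
  qed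
  have tr: "(?g x, ?g y) \<in> (edges F)\<^sup>+" if "(x, y) \<in> (edges G)\<^sup>+" for x y
    using that
  proof (induction rule: trancl_induct)
    case (base y)
    then show ?case using down by blast
  next
    case (step y z)
    show ?case by (rule trancl_into_trancl[OF step.IH down[OF step.hyps(2)]])
  qed
  have acF: "acyclic (edges F)" using pf unfolding partitioned_forest_def by (elim conjE)
  have ac: "acyclic (edges G)"
    unfolding acyclic_def
  proof (intro allI notI)
    fix x assume "(x, x) \<in> (edges G)\<^sup>+"
    from tr[OF this] show False using acF unfolding acyclic_def by blast
  qed
  have un: "u = u'" if "(u, v) \<in> edges G" "(u', v) \<in> edges G" for u u' v
  proof -
    have "?g u = ?g u'"
      by (rule partitioned_forest_parent_unique[OF pf down[OF that(1)] down[OF that(2)]])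
    moreover have "u \<in> f ` verts F" "u' \<in> f ` verts F" using that e b by auto
    ultimately show ?thesis by (metis f_inv_into_f)
  qed
  have r: "f v \<in> roots G" if v: "v \<in> roots F" for v
  proof -
    have v': "v \<in> verts F" using v by (simp add: roots_def)
    have "(x, f v) \<notin> edges G" for x
      using down[of x "f v"] gf[OF v'] v by (auto simp: roots_def)
    then show ?thesis using v' b by (auto simp: roots_def)
  qed
  have p: "partition_on (verts G) (blocks G)"
  proof -
    have pF: "partition_on (verts F) (blocks F)" using pf by (simp add: partitioned_forest_def)
    have sub: "B \<subseteq> verts F" if "B \<in> blocks F" for B using pF that by (auto simp: partition_on_def)
    show ?thesis
    proof (rule partition_onI)
      have "\<Union>(blocks F) = verts F" using pF by (simp add: partition_on_def)
      then show "\<Union>(blocks G) = verts G" unfolding bl b(2)[symmetric] by blast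
      show "{} \<notin> blocks G" using pF bl by (auto simp: partition_on_def)
      show "disjnt p q" if pq: "p \<in> blocks G" "q \<in> blocks G" "p \<noteq> q" for p q
      proof -
        obtain B C where BC: "B \<in> blocks F" "C \<in> blocks F" "p = f ` B" "q = f ` C"
          using pq bl by auto
        have "\<And>X Y. X \<in> blocks F \<Longrightarrow> Y \<in> blocks F \<Longrightarrow> X \<noteq> Y \<Longrightarrow> X \<inter> Y = {}"
          using pF unfolding partition_on_def disjoint_def by blast
        moreover have "B \<noteq> C" using BC pq(3) by blast
        ultimately have "B \<inter> C = {}" using BC(1,2) by blast
        then show ?thesis
          using BC inj_on_image_Int[OF b(1) sub[OF BC(1)] sub[OF BC(2)]] by (simp add: disjnt_def)
      qed
    qed
  qed
  have c: "(v \<in> roots G \<and> w \<in> roots G) \<or> (\<exists>u. (u, v) \<in> edges G \<and> (u, w) \<in> edges G)"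
    if B: "B \<in> blocks G" "v \<in> B" "w \<in> B" for B v w
  proof -
    obtain C x y where C: "C \<in> blocks F" "x \<in> C" "y \<in> C" "v = f x" "w = f y"
      using B bl by auto
    have "(x \<in> roots F \<and> y \<in> roots F) \<or> (\<exists>u. (u, x) \<in> edges F \<and> (u, y) \<in> edges F)"
      using pf C by (auto simp: partitioned_forest_def)
    then show ?thesis
    proof
      assume "x \<in> roots F \<and> y \<in> roots F"
      then show ?thesis using C r by simp
    next
      assume "\<exists>u. (u, x) \<in> edges F \<and> (u, y) \<in> edges F"
      then obtain u where u: "(u, x) \<in> edges F" "(u, y) \<in> edges F" by blast
      then have "u \<in> verts F" "x \<in> verts F" "y \<in> verts F" using eF by auto
      then have "(f u, v) \<in> edges G" "(f u, w) \<in> edges G" using u C ee by auto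
      then show ?thesis by blast
    qed
  qed
  have fin: "finite (verts G)"
    unfolding b(2)[symmetric] using pf by (simp add: partitioned_forest_def)
  show ?thesis
    unfolding partitioned_forest_def using e ac un p c fin by blast
qed

lemma partitioned_forest_disjoint_union:
  assumes F: "partitioned_forest F" and G: "partitioned_forest G"
  shows "partitioned_forest (disjoint_union F G)"
proof -
  let ?S = "disjoint_union F G"
  have eF: "edges F \<subseteq> verts F \<times> verts F" and eG: "edges G \<subseteq> verts G \<times> verts G"
    using F G by (auto simp: partitioned_forest_def)
  have pF: "partition_on (verts F) (blocks F)" and pG: "partition_on (verts G) (blocks G)"
    using F G by (auto simp: partitioned_forest_def)
  have t: "(case (x, y) of (Inl a, Inl b) \<Rightarrow> (a, b) \<in> (edges F)\<^sup>+
                        | (Inr a, Inr b) \<Rightarrow> (a, b) \<in> (edges G)\<^sup>+ | _ \<Rightarrow> False)"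
    if "(x, y) \<in> (edges ?S)\<^sup>+" for x y
    using that
  proof (induction rule: trancl_induct)
    case (base y)
    then show ?case by (auto simp: disjoint_union_def)
  next
    case (step y z)
    show ?case using step.hyps(2) step.IH
      by (cases x; cases y; cases z)
        (auto simp: disjoint_union_def elim: trancl_into_trancl)
  qed
  have ac: "acyclic (edges ?S)"
    unfolding acyclic_def
  proof (intro allI notI)
    fix x assume "(x, x) \<in> (edges ?S)\<^sup>+"
    from t[OF this] show False using F G
      by (auto simp: partitioned_forest_def acyclic_def split: sum.splits)
  qed
  have p: "partition_on (verts ?S) (blocks ?S)"
  proof (rule partition_onI)
    show "\<Union>(blocks ?S) = verts ?S" using pF pG
      by (simp add: disjoint_union_def partition_on_def Plus_def Union_Un_distrib
          flip: image_Union)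
    show "{} \<notin> blocks ?S" using pF pG by (auto simp: disjoint_union_def partition_on_def)
    have d: "\<And>X Y. X \<in> blocks F \<Longrightarrow> Y \<in> blocks F \<Longrightarrow> X \<noteq> Y \<Longrightarrow> X \<inter> Y = {}"
      "\<And>X Y. X \<in> blocks G \<Longrightarrow> Y \<in> blocks G \<Longrightarrow> X \<noteq> Y \<Longrightarrow> X \<inter> Y = {}"
      by (rule disjointD[OF partition_onD2[OF pF]]; assumption)
        (rule disjointD[OF partition_onD2[OF pG]]; assumption)
    show "disjnt p q" if pq: "p \<in> blocks ?S" "q \<in> blocks ?S" "p \<noteq> q" for p q
    proof -
      have P: "(\<exists>X\<in>blocks F. p = Inl ` X) \<or> (\<exists>X\<in>blocks G. p = Inr ` X)"
        and Q: "(\<exists>Y\<in>blocks F. q = Inl ` Y) \<or> (\<exists>Y\<in>blocks G. q = Inr ` Y)"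
        using pq(1,2) by (auto simp: disjoint_union_def)
      from P show ?thesis
      proof (elim disjE bexE)
        fix X assume X: "X \<in> blocks F" "p = Inl ` X"
        from Q show ?thesis
        proof (elim disjE bexE)
          fix Y assume "Y \<in> blocks F" "q = Inl ` Y"
          then show ?thesis using d(1)[of X Y] X pq(3) by (auto simp: disjnt_def)
        qed (auto simp: X disjnt_def)
      next
        fix X assume X: "X \<in> blocks G" "p = Inr ` X"
        from Q show ?thesis
        proof (elim disjE bexE)
          fix Y assume "Y \<in> blocks G" "q = Inr ` Y"
          then show ?thesis using d(2)[of X Y] X pq(3) by (auto simp: disjnt_def)
        qed (auto simp: X disjnt_def)
      qed
    qed
  qed
  have rt: "Inl v \<in> roots ?S \<longleftrightarrow> v \<in> roots F" "Inr w \<in> roots ?S \<longleftrightarrow> w \<in> roots G" for v w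
    by (auto simp: roots_def disjoint_union_def)
  have c: "(v \<in> roots ?S \<and> w \<in> roots ?S) \<or> (\<exists>u. (u, v) \<in> edges ?S \<and> (u, w) \<in> edges ?S)"
    if B: "B \<in> blocks ?S" "v \<in> B" "w \<in> B" for B v w
  proof -
    consider C x y where "C \<in> blocks F" "x \<in> C" "y \<in> C" "v = Inl x" "w = Inl y"
      | C x y where "C \<in> blocks G" "x \<in> C" "y \<in> C" "v = Inr x" "w = Inr y"
      using B by (auto simp: disjoint_union_def)
    then show ?thesis
    proof cases
      case 1
      then have "(x \<in> roots F \<and> y \<in> roots F) \<or> (\<exists>u. (u, x) \<in> edges F \<and> (u, y) \<in> edges F)"
        using F unfolding partitioned_forest_def by blast
      then show ?thesis
      proof
        assume "\<exists>u. (u, x) \<in> edges F \<and> (u, y) \<in> edges F"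
        then obtain u where "(u, x) \<in> edges F" "(u, y) \<in> edges F" by blast
        then have "(Inl u, v) \<in> edges ?S \<and> (Inl u, w) \<in> edges ?S"
          using 1 by (auto simp: disjoint_union_def)
        then show ?thesis by blast
      qed (simp add: 1 rt)
    next
      case 2
      then have "(x \<in> roots G \<and> y \<in> roots G) \<or> (\<exists>u. (u, x) \<in> edges G \<and> (u, y) \<in> edges G)"
        using G unfolding partitioned_forest_def by blast
      then show ?thesis
      proof
        assume "\<exists>u. (u, x) \<in> edges G \<and> (u, y) \<in> edges G"
        then obtain u where "(u, x) \<in> edges G" "(u, y) \<in> edges G" by blast
        then have "(Inr u, v) \<in> edges ?S \<and> (Inr u, w) \<in> edges ?S"
          using 2 by (auto simp: disjoint_union_def)
        then show ?thesis by blast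
      qed (simp add: 2 rt)
    qed
  qed
  have fin: "finite (verts ?S)" using F G
    by (simp add: disjoint_union_def partitioned_forest_def)
  have es: "edges ?S \<subseteq> verts ?S \<times> verts ?S" using eF eG by (auto simp: disjoint_union_def)
  have un: "u = u'" if "(u, v) \<in> edges ?S" "(u', v) \<in> edges ?S" for u u' v
    using that partitioned_forest_parent_unique[OF F] partitioned_forest_parent_unique[OF G]
    by (cases v) (auto simp: disjoint_union_def)
  show ?thesis
    unfolding partitioned_forest_def using fin es ac un p c by blast
qed

lemma partitioned_forest_relabel':
  assumes "partitioned_forest F" "inj_on f (verts F)"
  shows "partitioned_forest (relabel f F)"
proof (rule pforest_iso_by_partitioned_forest[OF partitioned_forest_relabel[OF assms] assms(1)])
  show "edges (relabel f F) \<subseteq> verts (relabel f F) \<times> verts (relabel f F)"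
    using assms by (auto simp: relabel_def partitioned_forest_def)
qed

lemma pforest_iso_merge_roots:
  assumes "partitioned_forest F" "partitioned_forest G" "pforest_iso_by f F G"
  shows "pforest_iso_by f (merge_roots F) (merge_roots G)"
proof -
  have r: "roots G = f ` roots F" by (rule pforest_iso_by_roots[OF assms])
  have inj: "inj_on f (verts F)" and bl: "blocks G = (`) f ` blocks F"
    using assms(3) by (auto simp: pforest_iso_by_def bij_betw_def)
  have s: "f ` B \<subseteq> f ` roots F \<longleftrightarrow> B \<subseteq> roots F" if "B \<in> blocks F" for B
  proof -
    have B: "B \<subseteq> verts F" using pforest_iso_by_blocks_sub[OF assms(1) that] by simp
    have R: "roots F \<subseteq> verts F" by (auto simp: roots_def)
    have "f ` B \<subseteq> f ` roots F \<longleftrightarrow> (\<forall>x\<in>B. f x \<in> f ` roots F)" by blast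
    also have "\<dots> \<longleftrightarrow> B \<subseteq> roots F" using inj_on_image_mem_iff[OF inj _ R] B by blast
    finally show ?thesis .
  qed
  have "(`) f ` blocks (merge_roots F) = blocks (merge_roots G)"
    using s by (auto simp: merge_roots_def r bl)
  then show ?thesis
    using assms(3) by (auto simp: pforest_iso_by_def merge_roots_def)
qed

lemma pforest_iso_restrict:
  assumes "partitioned_forest F" "pforest_iso_by f F G" "U \<subseteq> verts F"
  shows "pforest_iso_by f (restrict_pforest F U) (restrict_pforest G (f ` U))"
proof -
  have inj: "inj_on f (verts F)" and im: "f ` verts F = verts G"
    and bl: "blocks G = (`) f ` blocks F"
    using assms(2) by (auto simp: pforest_iso_by_def bij_betw_def)
  have i: "f ` B \<inter> f ` U = f ` (B \<inter> U)" if "B \<in> blocks F" for B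
    using inj_on_image_Int[OF inj, of B U] pforest_iso_by_blocks_sub[OF assms(1) that] assms(3)
    by auto
  let ?R = "restrict_pforest F U" and ?S = "restrict_pforest G (f ` U)"
  have m: "f u \<in> f ` U \<longleftrightarrow> u \<in> U" if "u \<in> verts F" for u
    by (rule inj_on_image_mem_iff[OF inj that assms(3)])
  have e: "(u, v) \<in> edges F \<longleftrightarrow> (f u, f v) \<in> edges G" if "u \<in> verts F" "v \<in> verts F" for u v
    using assms(2) that by (simp add: pforest_iso_by_def)
  have d: "deco G (f v) = deco F v" if "v \<in> verts F" for v
    using assms(2) that by (simp add: pforest_iso_by_def)
  have "(`) f ` blocks ?R = blocks ?S"
  proof -
    have 1: "(`) f ` (S - {{}}) = (`) f ` S - {{}}" for S by auto
    have "(`) f ` (\<lambda>B. B \<inter> U) ` blocks F = (\<lambda>B. B \<inter> f ` U) ` blocks G"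
      unfolding bl image_image by (rule image_cong) (simp_all add: i)
    then show ?thesis by (simp only: 1 restrict_pforest_def pforest.select_convs)
  qed
  moreover have "bij_betw f (verts ?R) (verts ?S)"
  proof (rule bij_betw_imageI)
    show "inj_on f (verts ?R)"
      by (rule inj_on_subset[OF inj]) (simp add: restrict_pforest_def)
    show "f ` verts ?R = verts ?S"
      using inj_on_image_Int[OF inj subset_refl assms(3)] im by (simp add: restrict_pforest_def)
  qed
  moreover have "(u, v) \<in> edges ?R \<longleftrightarrow> (f u, f v) \<in> edges ?S" if "u \<in> verts ?R" "v \<in> verts ?R" for u v
    using that e[of u v] by (simp add: restrict_pforest_def m)
  moreover have "deco ?S (f v) = deco ?R v" if "v \<in> verts ?R" for v
    using that d[of v] by (simp add: restrict_pforest_def)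
  ultimately show ?thesis unfolding pforest_iso_by_def by (intro conjI ballI)
qed

lemma pforest_iso_disjoint_union:
  assumes F: "pforest_iso_by f F F'" and G: "pforest_iso_by g G G'"
  shows "pforest_iso_by (map_sum f g) (disjoint_union F G) (disjoint_union F' G')"
proof -
  have b: "bij_betw (map_sum f g) (verts F <+> verts G) (verts F' <+> verts G')"
  proof (rule bij_betw_imageI)
    show "inj_on (map_sum f g) (verts F <+> verts G)"
    proof (rule inj_onI)
      have i: "inj_on f (verts F)" "inj_on g (verts G)"
        using F G by (simp_all add: pforest_iso_by_def bij_betw_def)
      fix x y assume "x \<in> verts F <+> verts G" "y \<in> verts F <+> verts G"
        "map_sum f g x = map_sum f g y"
      then show "x = y"
        by (cases x; cases y) (auto dest: inj_onD[OF i(1)] inj_onD[OF i(2)])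
    qed
    have "f ` verts F = verts F'" "g ` verts G = verts G'"
      using F G by (auto simp: pforest_iso_by_def bij_betw_def)
    moreover have "map_sum f g ` (verts F <+> verts G) = f ` verts F <+> g ` verts G"
      by (simp add: Plus_def image_Un image_image)
    ultimately show "map_sum f g ` (verts F <+> verts G) = verts F' <+> verts G'" by simp
  qed
  have "(`) (map_sum f g) ` ((`) Inl ` blocks F \<union> (`) Inr ` blocks G) =
      (`) Inl ` (`) f ` blocks F \<union> (`) Inr ` (`) g ` blocks G"
    by (simp add: image_Un image_image)
  also have "\<dots> = (`) Inl ` blocks F' \<union> (`) Inr ` blocks G'"
    using F G by (simp add: pforest_iso_by_def)
  finally have bl: "(`) (map_sum f g) ` ((`) Inl ` blocks F \<union> (`) Inr ` blocks G) =
    (`) Inl ` blocks F' \<union> (`) Inr ` blocks G'" .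
  have e: "(x, y) \<in> edges (disjoint_union F G) \<longleftrightarrow>
        (map_sum f g x, map_sum f g y) \<in> edges (disjoint_union F' G')"
    if "x \<in> verts F <+> verts G" "y \<in> verts F <+> verts G" for x y
    using that F G
    by (cases x; cases y) (auto simp: disjoint_union_def pforest_iso_by_def)
  have d: "deco (disjoint_union F' G') (map_sum f g x) = deco (disjoint_union F G) x"
    if "x \<in> verts F <+> verts G" for x
    using that F G by (cases x) (auto simp: disjoint_union_def pforest_iso_by_def)
  show ?thesis
    unfolding pforest_iso_by_def using b bl e d
    by (auto simp: disjoint_union_def)
qed

lemma pforest_iso_ideals:
  assumes "edges F \<subseteq> verts F \<times> verts F" "edges G \<subseteq> verts G \<times> verts G" "pforest_iso_by f F G"
  shows "bij_betw ((`) f) (ideals F) (ideals G)"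
proof -
  have inj: "inj_on f (verts F)" and im: "f ` verts F = verts G" and
    e: "\<And>u v. u \<in> verts F \<Longrightarrow> v \<in> verts F \<Longrightarrow> (u, v) \<in> edges F \<longleftrightarrow> (f u, f v) \<in> edges G"
    using assms(3) by (auto simp: pforest_iso_by_def bij_betw_def)
  have "inj_on ((`) f) (ideals F)"
    by (rule inj_on_subset[OF inj_on_image_Pow[OF inj]]) (auto simp: ideals_def)
  moreover have "(`) f ` ideals F = ideals G"
  proof (intro equalityI subsetI)
    fix J assume "J \<in> (`) f ` ideals F"
    then obtain I where I: "I \<in> ideals F" "J = f ` I" by blast
    have "w \<in> J" if vw: "v \<in> J" "(v, w) \<in> edges G" for v w
    proof -
      obtain a where a: "a \<in> I" "v = f a" using vw I by blast
      obtain b where b: "b \<in> verts F" "w = f b" using vw assms(2) im by blast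
      have "(a, b) \<in> edges F" using a b vw e I by (auto simp: ideals_def)
      then show ?thesis using a b I by (auto simp: ideals_def)
    qed
    moreover have "J \<subseteq> verts G" using I unfolding im[symmetric] by (auto simp: ideals_def)
    ultimately show "J \<in> ideals G" unfolding ideals_def by blast
  next
    fix J assume J: "J \<in> ideals G"
    let ?I = "{v \<in> verts F. f v \<in> J}"
    have "?I \<in> ideals F" using J e assms(1) by (auto simp: ideals_def)
    moreover have "J \<subseteq> f ` verts F" using J unfolding im by (simp add: ideals_def)
    then have "J = f ` ?I" by blast
    ultimately show "J \<in> (`) f ` ideals F" by blast
  qed
  ultimately show ?thesis by (simp add: bij_betw_def)
qed


section \<open>The Hopf algebra of partitioned trees\<close>

text \<open>
  Every finite partitioned forest is isomorphic to one whose vertices are natural numbers.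
\<close>

definition ptree_rel :: "(nat, 'd) pforest \<Rightarrow> (nat, 'd) pforest \<Rightarrow> bool" where
  "ptree_rel F G \<longleftrightarrow> partitioned_tree F \<and> partitioned_tree G \<and> pforest_iso F G"

definition empty_pforest :: "(nat, 'd) pforest" where
  "empty_pforest = \<lparr>verts = {}, edges = {}, blocks = {}, deco = undefined\<rparr>"

lemma partitioned_tree_empty: "partitioned_tree empty_pforest"
  by (simp add: partitioned_tree_def partitioned_forest_def empty_pforest_def partition_on_empty
      acyclic_def)

quotient_type 'd ptree = "(nat, 'd) pforest" / partial: ptree_rel
proof (rule part_equivpI)
  show "\<exists>F. ptree_rel F (F :: (nat, 'd) pforest)"
    using partitioned_tree_empty pforest_iso_refl unfolding ptree_rel_def by blast
  show "symp (ptree_rel :: (nat, 'd) pforest \<Rightarrow> _)"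
    by (rule sympI)
      (auto simp: ptree_rel_def pforest_iso_def partitioned_tree_def dest: pforest_iso_by_sym)
  show "transp (ptree_rel :: (nat, 'd) pforest \<Rightarrow> _)"
    by (rule transpI) (auto simp: ptree_rel_def pforest_iso_def dest: pforest_iso_by_trans)
qed

lift_definition empty_ptree :: "'d ptree" is empty_pforest
  by (simp add: ptree_rel_def partitioned_tree_empty pforest_iso_refl)

lift_definition ptree_decos :: "'d ptree \<Rightarrow> 'd set" is "\<lambda>F. deco F ` verts F"
proof -
  fix F G :: "(nat, 'd) pforest"
  assume "ptree_rel F G"
  then obtain f where f: "pforest_iso_by f F G" by (auto simp: ptree_rel_def pforest_iso_def)
  then have "verts G = f ` verts F" by (auto simp: pforest_iso_by_def bij_betw_def)
  then show "deco F ` verts F = deco G ` verts G"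
    using f by (auto simp: pforest_iso_by_def image_image)
qed

text \<open>\<open>sum_encode\<close> brings the disjoint union back to vertices in \<open>nat\<close>.\<close>

lift_definition ptree_prod :: "'d ptree \<Rightarrow> 'd ptree \<Rightarrow> 'd ptree" is
  "\<lambda>F G. merge_roots (relabel sum_encode (disjoint_union F G))"
proof -
  fix F F' G G' :: "(nat, 'd) pforest"
  assume a: "ptree_rel F F'" "ptree_rel G G'"
  then obtain f g where fg: "pforest_iso_by f F F'" "pforest_iso_by g G G'"
    by (auto simp: ptree_rel_def pforest_iso_def)
  let ?S = "disjoint_union F G" and ?S' = "disjoint_union F' G'"
  have pf: "partitioned_forest ?S" "partitioned_forest ?S'"
    using a by (auto simp: ptree_rel_def partitioned_tree_def intro: partitioned_forest_disjoint_union)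
  have inj: "inj_on sum_encode A" for A by (rule inj_on_subset[OF inj_sum_encode subset_UNIV])
  let ?R = "relabel sum_encode ?S" and ?R' = "relabel sum_encode ?S'"
  have pR: "partitioned_forest ?R" "partitioned_forest ?R'"
    using pf inj by (auto intro: partitioned_forest_relabel')
  have "pforest_iso_by (sum_encode \<circ> (map_sum f g \<circ> inv_into (verts ?S) sum_encode)) ?R ?R'"
    by (rule pforest_iso_by_trans[OF pforest_iso_by_trans
          [OF pforest_iso_by_sym[OF pf(1) partitioned_forest_relabel[OF pf(1) inj]]
            pforest_iso_disjoint_union[OF fg]] partitioned_forest_relabel[OF pf(2) inj]])
  then show "ptree_rel (merge_roots ?R) (merge_roots ?R')"
    using pR unfolding ptree_rel_def pforest_iso_def
    by (auto intro: partitioned_tree_merge_roots pforest_iso_merge_roots)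
qed

lift_definition ptree_coprod :: "'d ptree \<Rightarrow> ('d ptree \<times> 'd ptree \<Rightarrow>\<^sub>0 'k::field)" is
  "\<lambda>F. \<Sum>I\<in>ideals F. Poly_Mapping.single (abs_ptree (R_part F I), abs_ptree (P_part F I)) 1"
proof -
  fix F G :: "(nat, 'd) pforest"
  assume r: "ptree_rel F G"
  then obtain f where f: "pforest_iso_by f F G" by (auto simp: ptree_rel_def pforest_iso_def)
  have pt: "partitioned_tree F" "partitioned_tree G"
    and pf: "partitioned_forest F" "partitioned_forest G"
    using r by (auto simp: ptree_rel_def partitioned_tree_def)
  have im: "f ` verts F = verts G" and inj: "inj_on f (verts F)"
    using f by (auto simp: pforest_iso_by_def bij_betw_def)
  have bij: "bij_betw ((`) f) (ideals F) (ideals G)"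
    using pforest_iso_ideals[OF _ _ f] pf by (auto simp: partitioned_forest_def)
  have *: "abs_ptree (R_part F I) = abs_ptree (R_part G (f ` I)) \<and>
           abs_ptree (P_part F I) = abs_ptree (P_part G (f ` I))" if I: "I \<in> ideals F" for I
  proof -
    have sub: "I \<subseteq> verts F" using I by (simp add: ideals_def)
    have J: "f ` I \<in> ideals G" using bij I by (auto simp: bij_betw_def)
    have d: "f ` (verts F - I) = verts G - f ` I"
      using inj_on_image_set_diff[OF inj _ sub, of "verts F"] im by auto
    have "pforest_iso_by f (R_part F I) (R_part G (f ` I))"
      unfolding R_part_def d[symmetric] by (rule pforest_iso_restrict[OF pf(1) f]) simp
    then have 1: "ptree_rel (R_part F I) (R_part G (f ` I))"
      using partitioned_tree_R_part pt I J by (auto simp: ptree_rel_def pforest_iso_def)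
    have "pforest_iso_by f (P_part F I) (P_part G (f ` I))"
      unfolding P_part_def
      by (intro pforest_iso_merge_roots partitioned_forest_restrict pforest_iso_restrict pf f sub)
    then have 2: "ptree_rel (P_part F I) (P_part G (f ` I))"
      using partitioned_tree_P_part pf by (auto simp: ptree_rel_def pforest_iso_def)
    show ?thesis
      using Quotient_rel_abs[OF Quotient_ptree 1] Quotient_rel_abs[OF Quotient_ptree 2] by simp
  qed
  have "(\<Sum>I\<in>ideals F. Poly_Mapping.single (abs_ptree (R_part F I), abs_ptree (P_part F I)) 1) =
      (\<Sum>I\<in>ideals F. Poly_Mapping.single (abs_ptree (R_part G (f ` I)), abs_ptree (P_part G (f ` I))) (1::'k))"
    by (rule sum.cong) (auto simp: *)
  also have "\<dots> = (\<Sum>I\<in>ideals G. Poly_Mapping.single (abs_ptree (R_part G I), abs_ptree (P_part G I)) 1)"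
    by (rule sum.reindex_bij_betw[OF bij])
  finally show "(\<Sum>I\<in>ideals F. Poly_Mapping.single (abs_ptree (R_part F I), abs_ptree (P_part F I)) (1::'k)) =
    (\<Sum>I\<in>ideals G. Poly_Mapping.single (abs_ptree (R_part G I), abs_ptree (P_part G I)) 1)" .
qed

definition CP_algebra :: "'d set \<Rightarrow> ('d ptree, 'k::field) bialg" where
  "CP_algebra D =
     \<lparr>hspace = {p. \<forall>T\<in>Poly_Mapping.keys p. ptree_decos T \<subseteq> D},
      hmult = bilin_ext (\<lambda>S T. Poly_Mapping.single (ptree_prod S T) 1),
      hone = Poly_Mapping.single empty_ptree 1,
      hcomult = lin_ext ptree_coprod,
      hcounit = (\<lambda>p. Poly_Mapping.lookup p empty_ptree)\<rparr>"


section \<open>The Connes-Kreimer Hopf algebra\<close>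

text \<open>
  Isomorphism classes of decorated rooted trees; decorated rooted forests are multisets of these.
  With disjoint union as the addition of multisets, the product of finitely supported functions
  provided by the library (convolution) is the product of the Connes-Kreimer algebra, and on pairs
  of forests it is the product of its tensor square.
\<close>

datatype 'd rtree = Node 'd "'d rtree multiset"

type_synonym 'd rforest = "'d rtree multiset"

definition B_plus :: "'d \<Rightarrow> 'd rforest \<Rightarrow> 'd rforest" where
  "B_plus d F = {#Node d F#}"

primrec ck_coprod_tree :: "'d rtree \<Rightarrow> ('d rforest \<times> 'd rforest \<Rightarrow>\<^sub>0 'k::field)" where
  "ck_coprod_tree (Node d F) =
     Poly_Mapping.single ({#}, B_plus d F) 1 +
     lin_ext (\<lambda>(G, H). Poly_Mapping.single (B_plus d G, H) 1) (prod_mset (image_mset ck_coprod_tree F))"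

definition ck_coprod :: "'d rforest \<Rightarrow> ('d rforest \<times> 'd rforest \<Rightarrow>\<^sub>0 'k::field)" where
  "ck_coprod F = prod_mset (image_mset ck_coprod_tree F)"

lemma ck_coprod_empty: "ck_coprod {#} = Poly_Mapping.single ({#}, {#}) 1"
  by (simp add: ck_coprod_def flip: single_one zero_prod_def)

lemma ck_coprod_union: "ck_coprod (F + G) = ck_coprod F * ck_coprod G"
  by (simp add: ck_coprod_def)

lemma ck_coprod_B_plus:
  "ck_coprod (B_plus d F) =
     Poly_Mapping.single ({#}, B_plus d F) 1 + lin_ext (\<lambda>(G, H). Poly_Mapping.single (B_plus d G, H) 1) (ck_coprod F)"
  by (simp add: ck_coprod_def B_plus_def)

definition CK_algebra :: "'d set \<Rightarrow> ('d rforest, 'k::field) bialg" where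
  "CK_algebra D =
     \<lparr>hspace = {p. \<forall>F\<in>Poly_Mapping.keys p. \<forall>t\<in>#F. set_rtree t \<subseteq> D},
      hmult = (*),
      hone = Poly_Mapping.single {#} 1,
      hcomult = lin_ext ck_coprod,
      hcounit = (\<lambda>p. Poly_Mapping.lookup p {#})\<rparr>"

end

(*
Let H be a connected graded commutative bialgebra over a field of characteristic zero, with a basis
closed under products, and let V be the space of its primitive elements. The convolution E of the
antipode with the derivation "multiply by the degree" kills products and multiplies a homogeneous
primitive element by its degree; so E, divided by the degree and followed by a projection onto V,
is a linear map H -> V that kills products and is the identity on V. By the universal property of
the tensor coalgebra it induces a morphism of bialgebras from H to the shuffle algebra of V, which
is injective because it is injective on primitive elements. It is surjective because each
primitive v has a cocycle L_v with L_v(1) = v: then v_1 ... v_n |-> L_(v_1)(... L_(v_n)(1)) is a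
morphism of coalgebras back from T(V), and it is a section up to terms of smaller length. In both
examples the cocycles come from one operator: graft an object onto a vertex of another, in all
possible ways, and divide by the number of vertices.
*)
theory Submission
  imports Defs
begin

section \<open>Linear maps between free vector spaces\<close>

text \<open>Surjectivity is the real content. The morphism to the shuffle algebra exists and is
  injective for every bialgebra of this kind, but in the polynomial algebra in two primitive
  variables x and y nothing maps to the antisymmetric tensor xy - yx. Grafting is the extra
  structure that excludes this. Its law \<open>G x 0\<close> = \<open>deg x\<close> times x is the
  origin of the division by the number of vertices: it gives L_v(1) = v. Characteristic zero enters
  only through this division and the one by the degree.

  The projection onto V is there because E need not take primitive values: on the tree with a root
  and two leaves in the Connes-Kreimer algebra it does not. Any linear projection will do, since
  only its values on V are prescribed.

  For partitioned trees the obstacle is that they are isomorphism classes. All pieces of a tree are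
  therefore represented by vertex subsets of one fixed forest (\<open>ptree_of\<close>), products by
  unions of subsets without edges between them, coproducts by sums over ideals; the laws then become
  identities between sets.\<close>

interpretation pm: vector_space "pm_scale :: 'k::field \<Rightarrow> ('x \<Rightarrow>\<^sub>0 'k) \<Rightarrow> _"
  by (rule vector_space_pm_scale)

interpretation pmp: vector_space_pair "pm_scale :: 'k::field \<Rightarrow> ('x \<Rightarrow>\<^sub>0 'k) \<Rightarrow> _"
    "pm_scale :: 'k \<Rightarrow> ('y \<Rightarrow>\<^sub>0 'k) \<Rightarrow> _"
  by (rule vector_space_pair.intro[OF vector_space_pm_scale vector_space_pm_scale])

abbreviation lin :: "(('x \<Rightarrow>\<^sub>0 'k::field) \<Rightarrow> ('y \<Rightarrow>\<^sub>0 'k)) \<Rightarrow> bool" where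
  "lin \<equiv> Vector_Spaces.linear pm_scale pm_scale"

lemma linI:
  assumes "\<And>p q. f (p + q) = f p + f q" "\<And>c p. f (pm_scale c p) = pm_scale c (f p)"
  shows "lin f"
  using assms by (simp add: Vector_Spaces.linear_iff pm.vector_space_axioms)

lemma lin_add: "lin f \<Longrightarrow> f (p + q) = f p + f q"
  by (rule pmp.linear_add)

lemma lin_diff: "lin f \<Longrightarrow> f (p - q) = f p - f q"
  by (rule pmp.linear_diff)

lemma lin_scale: "lin f \<Longrightarrow> f (pm_scale c p) = pm_scale c (f p)"
  by (rule pmp.linear_scale)

lemma lin_zero: "lin f \<Longrightarrow> f 0 = 0"
  by (rule pmp.linear_0)

lemma lin_sum: "lin f \<Longrightarrow> f (\<Sum>i\<in>I. g i) = (\<Sum>i\<in>I. f (g i))"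
  by (rule pmp.linear_sum)

lemma pm_scale_single [simp]: "pm_scale c (Poly_Mapping.single x a) = Poly_Mapping.single x (c * a)"
  by (rule poly_mapping_eqI) (simp add: lookup_single when_def)

text \<open>Vectors have different supports, so sums over \<open>keys\<close> do not combine
  directly; a common finite superset reduces additivity to sums over one index set.\<close>

lemma lin_ext_superset:
  assumes "finite A" "Poly_Mapping.keys p \<subseteq> A"
  shows "lin_ext g p = (\<Sum>x\<in>A. pm_scale (Poly_Mapping.lookup p x) (g x))"
  unfolding lin_ext_def
  by (rule sum.mono_neutral_left) (use assms in \<open>auto simp: in_keys_iff\<close>)

lemma lin_ext_single [simp]: "lin_ext g (Poly_Mapping.single x c) = pm_scale c (g x)"
  by (subst lin_ext_superset[of "{x}"]) auto

lemma lin_lin_ext: "lin (lin_ext g)"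
proof (rule linI)
  show "lin_ext g (p + q) = lin_ext g p + lin_ext g q" for p q
    using keys_add[of p q]
    by (simp add: lin_ext_superset[of "Poly_Mapping.keys p \<union> Poly_Mapping.keys q"] lookup_add
        pm.scale_left_distrib sum.distrib)
  show "lin_ext g (pm_scale c p) = pm_scale c (lin_ext g p)" for c p
    by (simp add: lin_ext_superset[of "Poly_Mapping.keys p"] in_keys_iff subset_iff
        pm.scale_sum_right)
qed

lemmas lin_ext_add [simp] = lin_add[OF lin_lin_ext]
  and lin_ext_diff [simp] = lin_diff[OF lin_lin_ext]
  and lin_ext_scale [simp] = lin_scale[OF lin_lin_ext]
  and lin_ext_zero [simp] = lin_zero[OF lin_lin_ext]
  and lin_ext_sum = lin_sum[OF lin_lin_ext]

lemma lin_ext_cong: "(\<And>x. x \<in> Poly_Mapping.keys p \<Longrightarrow> f x = g x) \<Longrightarrow> lin_ext f p = lin_ext g p"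
  unfolding lin_ext_def by (rule sum.cong) auto

lemma lin_ext_basis: "lin_ext (\<lambda>x. Poly_Mapping.single x 1) p = p"
proof (rule poly_mapping_eqI)
  fix y
  show "Poly_Mapping.lookup (lin_ext (\<lambda>x. Poly_Mapping.single x 1) p) y = Poly_Mapping.lookup p y"
    by (cases "y \<in> Poly_Mapping.keys p")
      (simp_all add: lin_ext_def lookup_sum lookup_single when_def if_distrib in_keys_iff
        cong: if_cong)
qed

lemma lin_lin_ext_comp: "lin f \<Longrightarrow> f (lin_ext g p) = lin_ext (\<lambda>x. f (g x)) p"
  unfolding lin_ext_def by (simp add: lin_sum lin_scale)

lemma lin_expand: "lin f \<Longrightarrow> f p = lin_ext (\<lambda>x. f (Poly_Mapping.single x 1)) p"
  using lin_lin_ext_comp[of f "\<lambda>x. Poly_Mapping.single x 1" p] by (simp add: lin_ext_basis)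

lemma lin_eqI:
  "lin f \<Longrightarrow> lin g \<Longrightarrow> (\<And>x. f (Poly_Mapping.single x 1) = g (Poly_Mapping.single x 1)) \<Longrightarrow> f p = g p"
  using lin_expand[of f p] lin_expand[of g p] by simp

lemma lin_ext_fun_add: "lin_ext (\<lambda>x. f x + g x) p = lin_ext f p + lin_ext g p"
  by (simp add: lin_ext_def pm.scale_right_distrib sum.distrib)

lemma lin_ext_fun_diff: "lin_ext (\<lambda>x. f x - g x) p = lin_ext f p - lin_ext g p"
  by (simp add: lin_ext_def pm.scale_right_diff_distrib sum_subtractf)

lemma lin_ext_fun_zero [simp]: "lin_ext (\<lambda>x. 0) p = 0"
  by (simp add: lin_ext_def)

lemma lin_ext_fun_scale: "lin_ext (\<lambda>x. pm_scale c (g x)) p = pm_scale c (lin_ext g p)"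
  by (simp add: lin_ext_def pm.scale_sum_right mult.commute)

lemma lin_ext_swap: "lin_ext (\<lambda>x. lin_ext (f x) q) p = lin_ext (\<lambda>y. lin_ext (\<lambda>x. f x y) p) q"
  unfolding lin_ext_def pm.scale_sum_right
  by (subst sum.swap) (simp add: mult.commute)

lemma lookup_lin_ext:
  "Poly_Mapping.lookup (lin_ext g p) y =
     (\<Sum>x\<in>Poly_Mapping.keys p. Poly_Mapping.lookup p x * Poly_Mapping.lookup (g x) y)"
  by (simp add: lin_ext_def lookup_sum)

lemma keys_pm_scale: "Poly_Mapping.keys (pm_scale c p) \<subseteq> Poly_Mapping.keys p"
  by (auto simp: in_keys_iff)

lemma keys_lin_ext:
  "Poly_Mapping.keys (lin_ext g p) \<subseteq> (\<Union>x\<in>Poly_Mapping.keys p. Poly_Mapping.keys (g x))"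
proof
  fix y assume "y \<in> Poly_Mapping.keys (lin_ext g p)"
  then have "(\<Sum>x\<in>Poly_Mapping.keys p. Poly_Mapping.lookup p x * Poly_Mapping.lookup (g x) y) \<noteq> 0"
    by (simp add: in_keys_iff lookup_lin_ext)
  then obtain x where "x \<in> Poly_Mapping.keys p" "Poly_Mapping.lookup (g x) y \<noteq> 0"
    by (metis (no_types, lifting) mult_zero_right sum.not_neutral_contains_not_neutral)
  then show "y \<in> (\<Union>x\<in>Poly_Mapping.keys p. Poly_Mapping.keys (g x))"
    by (auto simp: in_keys_iff)
qed

lemma lin_ext_in_subspace:
  "pm.subspace W \<Longrightarrow> (\<And>x. x \<in> Poly_Mapping.keys p \<Longrightarrow> g x \<in> W) \<Longrightarrow> lin_ext g p \<in> W"
  unfolding lin_ext_def by (intro pm.subspace_sum pm.subspace_scale) auto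

lemma subspace_keys: "pm.subspace {p :: 'x \<Rightarrow>\<^sub>0 'k::field. Poly_Mapping.keys p \<subseteq> A}"
proof -
  have "Poly_Mapping.keys (p + q) \<subseteq> A" if "Poly_Mapping.keys p \<subseteq> A" "Poly_Mapping.keys q \<subseteq> A"
    for p q :: "'x \<Rightarrow>\<^sub>0 'k"
    using that keys_add[of p q] by blast
  moreover have "Poly_Mapping.keys (pm_scale c p) \<subseteq> A" if "Poly_Mapping.keys p \<subseteq> A" for c and p :: "'x \<Rightarrow>\<^sub>0 'k"
    using that keys_pm_scale[of c p] by blast
  ultimately show ?thesis by (auto simp: pm.subspace_def)
qed

lemma lin_compose: "lin f \<Longrightarrow> lin g \<Longrightarrow> lin (\<lambda>p. g (f p))"
  by (rule linI) (simp_all add: lin_add lin_scale)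

lemma lin_plus: "lin f \<Longrightarrow> lin g \<Longrightarrow> lin (\<lambda>p. f p + g p)"
  by (rule linI) (simp_all add: lin_add lin_scale algebra_simps)

lemma lin_bilin_ext_right: "lin (bilin_ext g p)"
  by (rule linI) (simp_all add: bilin_ext_def lin_ext_fun_add lin_ext_fun_scale)

lemma lin_bilin_ext_left: "lin (\<lambda>p. bilin_ext g p q)"
  unfolding bilin_ext_def by (rule lin_lin_ext)

lemma bilin_ext_single [simp]:
  "bilin_ext g (Poly_Mapping.single x a) (Poly_Mapping.single y b) = pm_scale (a * b) (g x y)"
  by (simp add: bilin_ext_def)

lemmas bilin_ext_zero_right [simp] = lin_zero[OF lin_bilin_ext_right]
  and bilin_ext_zero_left [simp] = lin_zero[OF lin_bilin_ext_left]

lemma lin_tensor_right: "lin (tensor p)" and lin_tensor_left: "lin (\<lambda>p. tensor p q)"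
  unfolding tensor_def by (rule lin_bilin_ext_right lin_bilin_ext_left)+

lemma tensor_single [simp]:
  "tensor (Poly_Mapping.single x a) (Poly_Mapping.single y b) = Poly_Mapping.single (x, y) (a * b)"
  by (simp add: tensor_def)

text \<open>The universal property of the tensor product. Read from right to left it evaluates
  Sweedler sums on \<open>tensor p 1 + tensor 1 p\<close>.\<close>

lemma bilin_ext_eq_lin_ext_tensor: "bilin_ext g p q = lin_ext (\<lambda>(x, y). g x y) (tensor p q)"
  by (simp add: tensor_def bilin_ext_def lin_lin_ext_comp[OF lin_lin_ext])

lemma lin_tensor_map: "lin (tensor_map f g)"
  unfolding tensor_map_def by (rule lin_lin_ext)

lemma tensor_map_tensor:
  assumes "lin f" "lin g"
  shows "tensor_map f g (tensor p q) = tensor (f p) (g q)"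
proof -
  have "tensor (f p) (g q) = lin_ext (\<lambda>x. lin_ext (\<lambda>y. tensor (f (Poly_Mapping.single x 1))
     (g (Poly_Mapping.single y 1))) q) p"
    by (subst lin_expand[OF assms(1)], subst lin_expand[OF assms(2)])
      (simp only: lin_lin_ext_comp[OF lin_tensor_left] lin_lin_ext_comp[OF lin_tensor_right]
        lin_ext_swap[of _ p])
  then show ?thesis
    by (simp add: tensor_map_def flip: bilin_ext_eq_lin_ext_tensor) (simp add: bilin_ext_def)
qed

lemma lookup_tensor [simp]:
  "Poly_Mapping.lookup (tensor p q) (x, y) = Poly_Mapping.lookup p x * Poly_Mapping.lookup q y"
proof -
  have 1: "Poly_Mapping.lookup (tensor (Poly_Mapping.single a 1) q) (x, y) =
      (if a = x then Poly_Mapping.lookup q y else 0)" for a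
  proof -
    have "tensor (Poly_Mapping.single a 1) q = lin_ext (\<lambda>b. Poly_Mapping.single (a, b) 1) q"
      by (simp add: tensor_def bilin_ext_def)
    then show ?thesis
      by (auto simp: lookup_lin_ext lookup_single when_def if_distrib in_keys_iff cong: if_cong)
  qed
  have "tensor p q = lin_ext (\<lambda>a. tensor (Poly_Mapping.single a 1) q) p"
    by (rule lin_expand[OF lin_tensor_left])
  then show ?thesis
    by (auto simp: lookup_lin_ext 1 if_distrib in_keys_iff cong: if_cong)
qed

text \<open>The library product of finitely supported functions is that of a monoid algebra, so it
  obeys the same extension rules as every other bilinear map here.\<close>

lemma mult_eq_bilin_ext:
  fixes p q :: "'x::comm_monoid_add \<Rightarrow>\<^sub>0 'k::field"
  shows "p * q = bilin_ext (\<lambda>x y. Poly_Mapping.single (x + y) 1) p q"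
proof -
  have s: "pm_scale c r = Poly_Mapping.single 0 c * r" for c and r :: "'x \<Rightarrow>\<^sub>0 'k"
    unfolding pm_scale_def by (rule mult_map_scale_conv_mult)
  have l: "lin (\<lambda>p. p * q)" "lin (\<lambda>q. p * q)" for p q :: "'x \<Rightarrow>\<^sub>0 'k"
    by (rule linI; simp add: s algebra_simps)+
  have "Poly_Mapping.single x 1 * q = bilin_ext (\<lambda>x y. Poly_Mapping.single (x + y) 1) (Poly_Mapping.single x 1) q" for x
    by (rule lin_eqI[OF l(2) lin_bilin_ext_right]) (simp add: mult_single)
  then show ?thesis by (rule lin_eqI[OF l(1) lin_bilin_ext_left])
qed

section \<open>The shuffle algebra\<close>

lemma lin_id: "lin (\<lambda>p. p)"
  by (rule linI) simp_all

lemma lin_lin_ext_of: "lin f \<Longrightarrow> lin (\<lambda>p. lin_ext g (f p))"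
  by (rule lin_compose[OF _ lin_lin_ext])

lemma lin_bilin_ext_right_of: "lin f \<Longrightarrow> lin (\<lambda>q. bilin_ext g p (f q))"
  by (rule lin_compose[OF _ lin_bilin_ext_right])

lemma lin_bilin_ext_left_of: "lin f \<Longrightarrow> lin (\<lambda>p. bilin_ext g (f p) q)"
  by (rule lin_compose[OF _ lin_bilin_ext_left])

lemmas lin_intros = lin_id lin_lin_ext_of lin_plus lin_bilin_ext_right_of lin_bilin_ext_left_of

definition word_cons :: "('b \<Rightarrow>\<^sub>0 'k::field) \<Rightarrow> ('b list \<Rightarrow>\<^sub>0 'k) \<Rightarrow> ('b list \<Rightarrow>\<^sub>0 'k)" where
  "word_cons = bilin_ext (\<lambda>b w. Poly_Mapping.single (b # w) 1)"

definition word_cons_fst ::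
    "('b \<Rightarrow>\<^sub>0 'k::field) \<Rightarrow> ('b list \<times> 'b list \<Rightarrow>\<^sub>0 'k) \<Rightarrow> ('b list \<times> 'b list \<Rightarrow>\<^sub>0 'k)" where
  "word_cons_fst = bilin_ext (\<lambda>b (u, w). Poly_Mapping.single (b # u, w) 1)"

lemma pure_tensor_Cons: "pure_tensor (v # vs) = word_cons v (pure_tensor vs)"
  by (simp add: word_cons_def)

lemma lin_word_cons_right: "lin (word_cons v)" and lin_word_cons_left: "lin (\<lambda>v. word_cons v w)"
  unfolding word_cons_def by (rule lin_bilin_ext_right lin_bilin_ext_left)+

lemma lin_word_cons_fst: "lin (word_cons_fst v)"
  unfolding word_cons_fst_def by (rule lin_bilin_ext_right)

lemma lin_deconcatenation: "lin deconcatenation"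
  unfolding deconcatenation_def by (rule lin_lin_ext)

lemma lin_shuffle_prod_right: "lin (shuffle_prod p)" and
  lin_shuffle_prod_left: "lin (\<lambda>p. shuffle_prod p q)"
  unfolding shuffle_prod_def by (rule lin_bilin_ext_right lin_bilin_ext_left)+

lemma word_cons_zero [simp]: "word_cons 0 w = 0" "word_cons v 0 = 0"
  by (simp_all add: word_cons_def)

lemma word_cons_fst_zero [simp]: "word_cons_fst 0 t = 0"
  by (simp add: word_cons_fst_def)

lemma word_cons_fst_tensor: "word_cons_fst v (tensor p q) = tensor (word_cons v p) q"
proof -
  have "bilin_ext (\<lambda>b (u, w). Poly_Mapping.single (b # u, w) 1) v
      (bilin_ext (\<lambda>x y. Poly_Mapping.single (x, y) 1) p q) =
    bilin_ext (\<lambda>x y. Poly_Mapping.single (x, y) 1)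
      (bilin_ext (\<lambda>b w. Poly_Mapping.single (b # w) 1) v p) q"
    \<comment> \<open>One argument at a time is reduced to basis vectors: the patterns given to
      \<open>lin_eqI\<close> mark the place of that argument. The other multilinear identities
      follow the same scheme.\<close>
    by (rule lin_eqI[of "\<lambda>v. bilin_ext _ v _" "\<lambda>v. bilin_ext _ (bilin_ext _ v _) _"],
        (fast intro: lin_intros)+,
        rule lin_eqI[of "\<lambda>p. bilin_ext _ _ (bilin_ext _ p _)" "\<lambda>p. bilin_ext _ (bilin_ext _ _ p) _"],
        (fast intro: lin_intros)+,
        rule lin_eqI[of "\<lambda>q. bilin_ext _ _ (bilin_ext _ _ q)" "\<lambda>q. bilin_ext _ (bilin_ext _ _ _) q"],
        (fast intro: lin_intros)+, simp)
  then show ?thesis by (simp add: word_cons_fst_def tensor_def word_cons_def)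
qed

lemma lookup_word_cons_Nil [simp]: "Poly_Mapping.lookup (word_cons v w) [] = 0"
proof -
  have "[] \<notin> Poly_Mapping.keys (word_cons v w)"
    unfolding word_cons_def bilin_ext_def by (auto dest!: subsetD[OF keys_lin_ext])
  then show ?thesis by (simp add: in_keys_iff)
qed

lemma lookup_word_cons_unit: "Poly_Mapping.lookup (word_cons v (Poly_Mapping.single [] 1)) [x] = Poly_Mapping.lookup v x"
  by (auto simp: word_cons_def bilin_ext_def lookup_lin_ext lookup_single when_def if_distrib in_keys_iff
      cong: if_cong)

lemma deconcatenation_Nil: "deconcatenation (Poly_Mapping.single [] 1) = Poly_Mapping.single ([], []) 1"
  by (simp add: deconcatenation_def)

text \<open>The cut before the first letter gives the first term; every other cut leaves
  \<open>v\<close> in the left part. Hence prefixing \<open>v\<close> is a cocycle of the same shape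
  as \<open>L v\<close> in \<open>Delta_L\<close>.\<close>

lemma deconcatenation_word_cons:
  fixes v :: "'b \<Rightarrow>\<^sub>0 'k::field"
  shows "deconcatenation (word_cons v w) =
     tensor (Poly_Mapping.single [] 1) (word_cons v w) + word_cons_fst v (deconcatenation w)"
proof -
  have b: "deconcatenation (Poly_Mapping.single (b # w) 1) =
      tensor (Poly_Mapping.single [] 1) (Poly_Mapping.single (b # w) 1) +
      word_cons_fst (Poly_Mapping.single b 1) (deconcatenation (Poly_Mapping.single w (1::'k)))"
    for b and w :: "'b list"
    by (simp add: deconcatenation_def sum.atMost_Suc_shift word_cons_fst_def
        lin_sum[OF lin_bilin_ext_right] del: sum.atMost_Suc)
  show ?thesis
    unfolding word_cons_def deconcatenation_def word_cons_fst_def tensor_def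
    by (rule lin_eqI[of "\<lambda>v. lin_ext _ (bilin_ext _ v _)" "\<lambda>v. bilin_ext _ _ (bilin_ext _ v _) + bilin_ext _ v _"],
        (fast intro: lin_intros)+,
        rule lin_eqI[of "\<lambda>w. lin_ext _ (bilin_ext _ _ w)" "\<lambda>w. bilin_ext _ _ (bilin_ext _ _ w) + bilin_ext _ _ (lin_ext _ w)"],
        (fast intro: lin_intros)+,
        use b in \<open>simp add: deconcatenation_def word_cons_fst_def tensor_def del: sum.atMost_Suc\<close>)
qed

lemma shuffle_prod_Nil_left [simp]: "shuffle_prod (Poly_Mapping.single [] 1) q = q"
  using lin_eqI[OF lin_shuffle_prod_right lin_id, of "Poly_Mapping.single [] 1" q]
  by (simp add: shuffle_prod_def)

lemma shuffle_words_Nil_right [simp]: "shuffle_words u [] = {#u#}"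
  by (cases u) simp_all

lemma shuffle_prod_Nil_right [simp]: "shuffle_prod p (Poly_Mapping.single [] 1) = p"
  using lin_eqI[OF lin_shuffle_prod_left lin_id, of "Poly_Mapping.single [] 1" p]
  by (simp add: shuffle_prod_def)

text \<open>The shuffle recursion with arbitrary vectors as first letters, since the letters
  produced by \<open>phi\<close> need not be basis vectors.\<close>

lemma shuffle_prod_word_cons:
  fixes v v' :: "'b \<Rightarrow>\<^sub>0 'k::field"
  shows "shuffle_prod (word_cons v u) (word_cons v' u') =
     word_cons v (shuffle_prod u (word_cons v' u')) + word_cons v' (shuffle_prod (word_cons v u) u')"
proof -
  have m: "word_cons (Poly_Mapping.single b 1) (\<Sum>x\<in>#M. Poly_Mapping.single x 1) =
      (\<Sum>x\<in>#image_mset ((#) b) M. Poly_Mapping.single x (1::'k))"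
    for b :: 'b and M :: "'b list multiset"
    by (induction M) (simp_all add: lin_add[OF lin_word_cons_right], simp_all add: word_cons_def)
  have b: "shuffle_prod (Poly_Mapping.single (b # w) 1) (Poly_Mapping.single (b' # w') 1) =
      word_cons (Poly_Mapping.single b 1) (shuffle_prod (Poly_Mapping.single w 1) (Poly_Mapping.single (b' # w') 1)) +
      word_cons (Poly_Mapping.single b' 1) (shuffle_prod (Poly_Mapping.single (b # w) 1) (Poly_Mapping.single w' (1::'k)))"
    for b b' :: 'b and w w'
    by (simp add: shuffle_prod_def m)
  show ?thesis
    unfolding word_cons_def shuffle_prod_def
    by (rule lin_eqI[of "\<lambda>v. bilin_ext _ (bilin_ext _ v _) _"
          "\<lambda>v. bilin_ext _ v _ + bilin_ext _ _ (bilin_ext _ (bilin_ext _ v _) _)"],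
        (fast intro: lin_intros)+,
        rule lin_eqI[of "\<lambda>u. bilin_ext _ (bilin_ext _ _ u) _"
          "\<lambda>u. bilin_ext _ _ (bilin_ext _ u _) + bilin_ext _ _ (bilin_ext _ (bilin_ext _ _ u) _)"],
        (fast intro: lin_intros)+,
        rule lin_eqI[of "\<lambda>v. bilin_ext _ _ (bilin_ext _ v _)"
          "\<lambda>v. bilin_ext _ _ (bilin_ext _ _ (bilin_ext _ v _)) + bilin_ext _ v _"],
        (fast intro: lin_intros)+,
        rule lin_eqI[of "\<lambda>v. bilin_ext _ _ (bilin_ext _ _ v)"
          "\<lambda>v. bilin_ext _ _ (bilin_ext _ _ (bilin_ext _ _ v)) + bilin_ext _ _ (bilin_ext _ _ v)"],
        (fast intro: lin_intros)+,
        use b in \<open>simp add: word_cons_def shuffle_prod_def\<close>)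
qed

lemma subspace_tensor_space: "pm.subspace (tensor_space V)"
  unfolding tensor_space_def by (rule pm.subspace_span)

text \<open>The sets \<open>A\<close> and \<open>B\<close> are kept general to cover both the whole
  tensor space and the words of bounded length in \<open>Phi_psi\<close>.\<close>

lemma word_cons_span:
  assumes "v \<in> V" "w \<in> pm.span (pure_tensor ` A)" "\<And>vs. vs \<in> A \<Longrightarrow> v # vs \<in> B"
  shows "word_cons v w \<in> pm.span (pure_tensor ` B)"
  using assms(2)
proof (induction rule: pm.span_induct_alt)
  case base
  then show ?case by (simp add: pm.span_zero)
next
  case (step c x y)
  then obtain vs where "vs \<in> A" "x = pure_tensor vs" by blast
  then have "word_cons v x \<in> pm.span (pure_tensor ` B)"
    using assms(3) by (auto intro!: pm.span_base image_eqI[of _ _ "v # vs"] simp: pure_tensor_Cons simp del: pure_tensor.simps)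
  with step show ?case
    by (simp add: lin_add[OF lin_word_cons_right] lin_scale[OF lin_word_cons_right] pm.span_add pm.span_scale)
qed

lemma word_cons_tensor_space: "v \<in> V \<Longrightarrow> w \<in> tensor_space V \<Longrightarrow> word_cons v w \<in> tensor_space V"
  unfolding tensor_space_def by (rule word_cons_span[of v V w "lists V"]) auto

lemma Nil_tensor_space: "Poly_Mapping.single [] 1 \<in> tensor_space V"
  unfolding tensor_space_def by (rule pm.span_base) (auto intro!: image_eqI[of _ _ "[]"])

section \<open>Bialgebras with a grafting operator\<close>

lemma lin_times_right: "lin ((*) p)" and lin_times_left: "lin (\<lambda>p. p * q)"
  for p q :: "'x::comm_monoid_add \<Rightarrow>\<^sub>0 'k::field"
  unfolding mult_eq_bilin_ext by (rule lin_bilin_ext_right lin_bilin_ext_left)+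

lemma lin_ext_one [simp]: "lin_ext g 1 = g 0"
  by (simp flip: single_one)

text \<open>
  \<open>G x y\<close> is the sum, over the vertices of \<open>x\<close>, of the objects obtained by grafting \<open>y\<close> onto that
  vertex. If \<open>x\<close> is replaced by a primitive element, \<open>D_G\<close> says that \<open>G x\<close> is a cocycle.
\<close>

locale grafting_bialgebra =
  fixes D :: "'x::comm_monoid_add \<Rightarrow> ('x \<times> 'x \<Rightarrow>\<^sub>0 'k::field_char_0)"
    and deg :: "'x \<Rightarrow> nat"
    and G :: "'x \<Rightarrow> 'x \<Rightarrow> ('x \<Rightarrow>\<^sub>0 'k)"
    and S :: "'x set"
  assumes deg_add: "deg (x + y) = deg x + deg y"
    and deg_0_iff: "deg x = 0 \<longleftrightarrow> x = 0"
    and D_add: "D (x + y) = D x * D y"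
    and D_deg: "(y, z) \<in> Poly_Mapping.keys (D x) \<Longrightarrow> deg y + deg z = deg x"
    and D_counit_left: "Poly_Mapping.lookup (D x) (0, z) = (if z = x then 1 else 0)"
    and D_counit_right: "Poly_Mapping.lookup (D x) (z, 0) = (if z = x then 1 else 0)"
    and D_coassoc: "lin_ext (\<lambda>(y, z). lin_ext (\<lambda>(a, b). Poly_Mapping.single (a, b, z) 1) (D y)) (D x) =
          lin_ext (\<lambda>(y, z). lin_ext (\<lambda>(a, b). Poly_Mapping.single (y, a, b) 1) (D z)) (D x)"
    and G_deg: "z \<in> Poly_Mapping.keys (G x y) \<Longrightarrow> deg z = deg x + deg y"
    and G_zero_left: "G 0 y = 0"
    and G_zero_right: "G x 0 = Poly_Mapping.single x (of_nat (deg x))"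
    and D_G: "lin_ext D (G x y) =
          lin_ext (\<lambda>(a, b). tensor (Poly_Mapping.single a 1) (G b y)) (D x) +
          lin_ext (\<lambda>(a, b). lin_ext (\<lambda>(c, d). tensor (G a c) (Poly_Mapping.single (b + d) 1)) (D y)) (D x)"
    and zero_S: "0 \<in> S"
    and D_S: "x \<in> S \<Longrightarrow> (y, z) \<in> Poly_Mapping.keys (D x) \<Longrightarrow> y \<in> S \<and> z \<in> S"
    and G_S: "x \<in> S \<Longrightarrow> y \<in> S \<Longrightarrow> z \<in> Poly_Mapping.keys (G x y) \<Longrightarrow> z \<in> S"
begin

subsection \<open>Sweedler sums\<close>

definition sw :: "('x \<Rightarrow> 'x \<Rightarrow> ('w \<Rightarrow>\<^sub>0 'k)) \<Rightarrow> 'x \<Rightarrow> ('w \<Rightarrow>\<^sub>0 'k)" where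
  "sw f x = lin_ext (\<lambda>(y, z). f y z) (D x)"

text \<open>As a congruence rule for recursive definitions this supplies, in the termination proofs
  of \<open>E\<close> and \<open>phi\<close>, the fact that (y, z) occurs in the coproduct, which
  \<open>deg_less\<close> needs.\<close>

lemma sw_cong [fundef_cong]:
  "x = x' \<Longrightarrow> (\<And>y z. (y, z) \<in> Poly_Mapping.keys (D x') \<Longrightarrow> f y z = g y z) \<Longrightarrow> sw f x = sw g x'"
  unfolding sw_def by (auto intro: lin_ext_cong)

lemma sw_fun_add: "sw (\<lambda>y z. f y z + g y z) x = sw f x + sw g x"
  by (simp add: sw_def case_prod_unfold lin_ext_fun_add)

lemma sw_fun_diff: "sw (\<lambda>y z. f y z - g y z) x = sw f x - sw g x"
  by (simp add: sw_def case_prod_unfold lin_ext_fun_diff)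

lemma sw_fun_zero [simp]: "sw (\<lambda>y z. 0) x = 0"
  by (simp add: sw_def case_prod_unfold)

lemma lin_sw: "lin h \<Longrightarrow> h (sw f x) = sw (\<lambda>y z. h (f y z)) x"
  by (simp add: sw_def lin_lin_ext_comp case_prod_unfold)

lemma sw_add: "sw f (x + y) = sw (\<lambda>a b. sw (\<lambda>c d. f (a + c) (b + d)) y) x"
  by (simp add: sw_def D_add mult_eq_bilin_ext bilin_ext_def lin_lin_ext_comp[OF lin_lin_ext] case_prod_unfold)

lemma sw_swap: "sw (\<lambda>a b. sw (\<lambda>c d. f a b c d) y) x = sw (\<lambda>c d. sw (\<lambda>a b. f a b c d) x) y"
  unfolding sw_def case_prod_unfold by (rule lin_ext_swap)

lemma sw_assoc: "sw (\<lambda>y z. sw (\<lambda>a b. f a b z) y) x = sw (\<lambda>y z. sw (\<lambda>a b. f y a b) z) x"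
  using arg_cong[OF D_coassoc[of x], of "lin_ext (\<lambda>(a, b, c). f a b c)"]
  by (simp add: sw_def lin_lin_ext_comp[OF lin_lin_ext] case_prod_unfold)

lemma sw_zero_left: "sw (\<lambda>y z. if y = 0 then g y z else 0) x = g 0 x"
proof -
  have "sw (\<lambda>y z. if y = 0 then g y z else 0) x =
    (\<Sum>t\<in>{(0, x)}. pm_scale (Poly_Mapping.lookup (D x) t) (if fst t = 0 then g (fst t) (snd t) else 0))"
    unfolding sw_def lin_ext_def case_prod_unfold
    by (rule sum.mono_neutral_cong_right)
      (auto simp: D_counit_left in_keys_iff split: if_splits)
  then show ?thesis by (simp add: D_counit_left)
qed

lemma sw_zero_right: "sw (\<lambda>y z. if z = 0 then g y z else 0) x = g x 0"
proof -
  have "sw (\<lambda>y z. if z = 0 then g y z else 0) x =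
    (\<Sum>t\<in>{(x, 0)}. pm_scale (Poly_Mapping.lookup (D x) t) (if snd t = 0 then g (fst t) (snd t) else 0))"
    unfolding sw_def lin_ext_def case_prod_unfold
    by (rule sum.mono_neutral_cong_right)
      (auto simp: D_counit_right in_keys_iff split: if_splits)
  then show ?thesis by (simp add: D_counit_right)
qed

text \<open>The term (0, x) has coefficient 1 and is the only one whose second leg has full degree,
  so this split turns a convolution equation into a recursion on the degree.\<close>

lemma sw_split_left: "sw f x = f 0 x + sw (\<lambda>y z. if y = 0 then 0 else f y z) x"
proof -
  have "sw f x = sw (\<lambda>y z. (if y = 0 then f y z else 0) + (if y = 0 then 0 else f y z)) x"
    by (rule sw_cong) auto
  then show ?thesis by (simp add: sw_fun_add sw_zero_left)
qed

lemma deg_zero [simp]: "deg 0 = 0"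
  by (simp add: deg_0_iff)

lemma deg_less: "(y, z) \<in> Poly_Mapping.keys (D x) \<Longrightarrow> y \<noteq> 0 \<Longrightarrow> deg z < deg x"
  using D_deg[of y z x] deg_0_iff[of y] by simp

lemma D_zero: "D 0 = Poly_Mapping.single (0, 0) 1"
proof (rule poly_mapping_eqI)
  fix t :: "'x \<times> 'x"
  show "Poly_Mapping.lookup (D 0) t = Poly_Mapping.lookup (Poly_Mapping.single (0, 0) 1) t"
  proof (cases "t \<in> Poly_Mapping.keys (D 0)")
    case True
    then have "t = (0, 0)" using D_deg[of "fst t" "snd t" 0] by (cases t) (auto simp: deg_0_iff)
    then show ?thesis by (simp add: D_counit_left)
  next
    case False
    moreover have "(0, 0) \<in> Poly_Mapping.keys (D 0)" by (simp add: in_keys_iff D_counit_left)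
    ultimately have "t \<noteq> (0, 0)" by blast
    then show ?thesis using False by (auto simp: lookup_single when_def in_keys_iff)
  qed
qed

lemma sw_at_zero: "sw f 0 = f 0 0"
  by (simp add: sw_def D_zero)

subsection \<open>The infinitesimal part of the grading\<close>

text \<open>\<open>E\<close> is the convolution of the antipode with the derivation multiplying by the degree.\<close>

function E :: "'x \<Rightarrow> ('x \<Rightarrow>\<^sub>0 'k)" where
  "E x = Poly_Mapping.single x (of_nat (deg x)) -
     sw (\<lambda>y z. if y = 0 then 0 else Poly_Mapping.single y 1 * E z) x"
  by auto
termination by (relation "measure deg") (auto intro: deg_less)

declare E.simps [simp del]

text \<open>The recursion of \<open>E\<close> is this equation solved for its term with y = 0. The
  antipode itself never has to be constructed.\<close>

lemma E_convolution: "sw (\<lambda>y z. Poly_Mapping.single y 1 * E z) x = Poly_Mapping.single x (of_nat (deg x))"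
  using E.simps[of x] by (subst sw_split_left) simp

lemma E_zero [simp]: "E 0 = 0"
  by (subst E.simps) (simp add: sw_at_zero)

text \<open>\<open>E\<close> kills products of nontrivial factors. The proposed value
  \<open>F\<close> and the true value solve the same convolution equation over the product of the
  two coproducts, and a solution is determined by induction on the degree.\<close>

lemma E_add: "E (x + y) = (if x = 0 then E y else 0) + (if y = 0 then E x else 0)"
proof (induction "deg x + deg y" arbitrary: x y rule: less_induct)
  case less
  define F where "F a b = (if a = 0 then E b else 0) + (if b = 0 then E a else 0)" for a b
  let ?s = "\<lambda>x. Poly_Mapping.single x (1::'k)"
  have 1: "sw (\<lambda>a b. sw (\<lambda>c d. ?s (a + c) * E (b + d)) y) x = Poly_Mapping.single (x + y) (of_nat (deg (x + y)))"
    using E_convolution[of "x + y"] by (simp only: sw_add)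
  \<comment> \<open>That \<open>F\<close> solves the equation expresses that multiplication by the
    degree is a derivation.\<close>
  have "sw (\<lambda>a b. sw (\<lambda>c d. ?s (a + c) * F b d) y) x =
     sw (\<lambda>a b. (if b = 0 then sw (\<lambda>c d. ?s (a + c) * E d) y else 0) + ?s (a + y) * E b) x"
  proof (rule sw_cong[OF refl])
    fix a b
    have "sw (\<lambda>c d. ?s (a + c) * F b d) y =
        sw (\<lambda>c d. (if b = 0 then ?s (a + c) * E d else 0) + (if d = 0 then ?s (a + c) * E b else 0)) y"
      by (rule sw_cong) (auto simp: F_def algebra_simps)
    then show "sw (\<lambda>c d. ?s (a + c) * F b d) y =
        (if b = 0 then sw (\<lambda>c d. ?s (a + c) * E d) y else 0) + ?s (a + y) * E b"
      by (simp add: sw_fun_add sw_zero_right)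
  qed
  also have "\<dots> = sw (\<lambda>c d. ?s (x + c) * E d) y + sw (\<lambda>a b. ?s (a + y) * E b) x"
    by (simp add: sw_fun_add sw_zero_right)
  also have "sw (\<lambda>c d. ?s (x + c) * E d) y = ?s x * sw (\<lambda>c d. ?s c * E d) y"
    unfolding lin_sw[OF lin_times_right]
    by (rule sw_cong) (auto simp: mult_single simp flip: mult.assoc)
  also have "sw (\<lambda>a b. ?s (a + y) * E b) x = ?s y * sw (\<lambda>a b. ?s a * E b) x"
    unfolding lin_sw[OF lin_times_right]
    by (rule sw_cong) (auto simp: mult_single add.commute simp flip: mult.assoc)
  finally have 2: "sw (\<lambda>a b. sw (\<lambda>c d. ?s (a + c) * F b d) y) x = Poly_Mapping.single (x + y) (of_nat (deg (x + y)))"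
    by (simp add: E_convolution mult_single deg_add add.commute single_add)
  have "0 = sw (\<lambda>a b. sw (\<lambda>c d. ?s (a + c) * (E (b + d) - F b d)) y) x"
    using 1 2 by (simp add: right_diff_distrib sw_fun_diff)
  \<comment> \<open>If a or c is nonzero, b and d have smaller total degree and the induction
    hypothesis cancels the term; only a = c = 0 survives, and that term is the claim.\<close>
  also have "\<dots> = sw (\<lambda>a b. if a = 0 then sw (\<lambda>c d. if c = 0 then E (b + d) - F b d else 0) y else 0) x"
  proof (rule sw_cong[OF refl])
    fix a b assume ab: "(a, b) \<in> Poly_Mapping.keys (D x)"
    have "sw (\<lambda>c d. ?s (a + c) * (E (b + d) - F b d)) y =
      sw (\<lambda>c d. if a = 0 \<and> c = 0 then E (b + d) - F b d else 0) y"
    proof (rule sw_cong[OF refl])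
      fix c d assume cd: "(c, d) \<in> Poly_Mapping.keys (D y)"
      show "?s (a + c) * (E (b + d) - F b d) = (if a = 0 \<and> c = 0 then E (b + d) - F b d else 0)"
      proof (cases "a = 0 \<and> c = 0")
        case False
        then have "deg b + deg d < deg x + deg y"
          using D_deg[OF ab] D_deg[OF cd] deg_0_iff[of a] deg_0_iff[of c] by auto
        from less[OF this] have "E (b + d) = F b d" by (simp add: F_def)
        then show ?thesis using False by simp
      qed simp
    qed
    then show "sw (\<lambda>c d. ?s (a + c) * (E (b + d) - F b d)) y =
      (if a = 0 then sw (\<lambda>c d. if c = 0 then E (b + d) - F b d else 0) y else 0)" by auto
  qed
  also have "\<dots> = E (x + y) - F x y" by (simp add: sw_zero_left)
  finally show ?case by (simp add: F_def)
qed

subsection \<open>Primitive elements\<close>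

abbreviation Delta :: "('x \<Rightarrow>\<^sub>0 'k) \<Rightarrow> ('x \<times> 'x \<Rightarrow>\<^sub>0 'k)" where
  "Delta \<equiv> lin_ext D"

definition prim :: "('x \<Rightarrow>\<^sub>0 'k) set" where
  "prim = {p. Poly_Mapping.keys p \<subseteq> S \<and> Delta p = tensor p 1 + tensor 1 p}"

lemma subspace_prim: "pm.subspace prim"
proof -
  have "pm.subspace {p. Delta p = tensor p 1 + tensor 1 p}"
    by (auto simp: pm.subspace_def lin_add[OF lin_tensor_left] lin_add[OF lin_tensor_right]
        lin_scale[OF lin_tensor_left] lin_scale[OF lin_tensor_right] lin_zero[OF lin_tensor_left]
        lin_zero[OF lin_tensor_right] algebra_simps)
  from pm.subspace_inter[OF subspace_keys[of S] this] show ?thesis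
    by (simp add: prim_def Collect_conj_eq)
qed

lemma lin_ext_sw: "lin_ext (sw f) p = lin_ext (\<lambda>(y, z). f y z) (Delta p)"
  by (simp add: sw_def[abs_def] lin_lin_ext_comp[OF lin_lin_ext])

lemma lookup_Delta_zero_left: "Poly_Mapping.lookup (Delta p) (0, x) = Poly_Mapping.lookup p x"
  by (simp add: lookup_lin_ext D_counit_left if_distrib in_keys_iff cong: if_cong)

lemma lookup_Delta_zero_right: "Poly_Mapping.lookup (Delta p) (x, 0) = Poly_Mapping.lookup p x"
  by (simp add: lookup_lin_ext D_counit_right if_distrib in_keys_iff cong: if_cong)

lemma lookup_prim_zero: "p \<in> prim \<Longrightarrow> Poly_Mapping.lookup p 0 = 0"
  using lookup_Delta_zero_left[of p 0] by (simp add: prim_def lookup_add)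

text \<open>On a primitive element the convolution equation has only two terms, and the one from p
  \<otimes> 1 vanishes because \<open>E 0 = 0\<close>.\<close>

lemma E_prim:
  assumes "p \<in> prim"
  shows "lin_ext E p = lin_ext (\<lambda>x. Poly_Mapping.single x (of_nat (deg x))) p"
proof -
  have "lin_ext (\<lambda>x. Poly_Mapping.single x (of_nat (deg x))) p =
      lin_ext (sw (\<lambda>y z. Poly_Mapping.single y 1 * E z)) p"
    by (rule lin_ext_cong) (rule E_convolution[symmetric])
  also have "\<dots> = lin_ext (\<lambda>(y, z). Poly_Mapping.single y 1 * E z) (tensor p 1 + tensor 1 p)"
    using assms by (simp only: lin_ext_sw prim_def mem_Collect_eq)
  also have "\<dots> = lin_ext E p"
    by (simp flip: single_one bilin_ext_eq_lin_ext_tensor) (simp add: bilin_ext_def)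
  finally show ?thesis ..
qed

text \<open>In degree 0 the convention \<open>inverse 0 = 0\<close> removes the constant
  term.\<close>

definition normalize :: "('x \<Rightarrow>\<^sub>0 'k) \<Rightarrow> ('x \<Rightarrow>\<^sub>0 'k)" where
  "normalize = lin_ext (\<lambda>x. Poly_Mapping.single x (inverse (of_nat (deg x))))"

lemma normalize_deg:
  fixes p :: "'x \<Rightarrow>\<^sub>0 'k"
  assumes "Poly_Mapping.lookup p 0 = 0"
  shows "lin_ext (\<lambda>x. pm_scale (inverse (of_nat (deg x))) (Poly_Mapping.single x (of_nat (deg x)))) p = p"
proof -
  have "lin_ext (\<lambda>x. pm_scale (inverse (of_nat (deg x))) (Poly_Mapping.single x (of_nat (deg x)))) p =
      lin_ext (\<lambda>x. Poly_Mapping.single x (1::'k)) p"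
  proof (rule lin_ext_cong)
    fix x assume "x \<in> Poly_Mapping.keys p"
    then have "x \<noteq> 0" using assms by (auto simp: in_keys_iff)
    then show "pm_scale (inverse (of_nat (deg x))) (Poly_Mapping.single x (of_nat (deg x))) = Poly_Mapping.single x (1::'k)"
      by (simp add: deg_0_iff)
  qed
  then show ?thesis by (simp add: lin_ext_basis)
qed

text \<open>The coproduct preserves total degree, so it commutes with rescaling by a function of the
  degree; this keeps primitive elements primitive. The other two claims cancel the degree against
  the factor in \<open>E_prim\<close> and in \<open>G_zero_right\<close>, which is possible since a
  primitive element has no constant term.\<close>

lemma normalize_prim:
  assumes "p \<in> prim"
  shows "normalize p \<in> prim" "normalize (lin_ext E p) = p"
    "lin_ext (\<lambda>x. G x 0) (normalize p) = p"
proof -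
  have 0: "Poly_Mapping.lookup p 0 = 0" by (rule lookup_prim_zero[OF assms])
  define c :: "nat \<Rightarrow> 'k" where "c n = inverse (of_nat n)" for n
  have n: "normalize p = lin_ext (\<lambda>x. Poly_Mapping.single x (c (deg x))) p"
    by (simp add: normalize_def c_def)
  have "Delta (normalize p) = lin_ext (\<lambda>x. pm_scale (c (deg x)) (D x)) p"
    by (simp add: n lin_lin_ext_comp[OF lin_lin_ext])
  also have "\<dots> = lin_ext (\<lambda>x. lin_ext (\<lambda>(y, z). Poly_Mapping.single (y, z) (c (deg y + deg z))) (D x)) p"
  proof (rule lin_ext_cong)
    fix x
    have "lin_ext (\<lambda>(y, z). Poly_Mapping.single (y, z) (c (deg y + deg z))) (D x) =
        lin_ext (\<lambda>t. pm_scale (c (deg x)) (Poly_Mapping.single t 1)) (D x)"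
      by (rule lin_ext_cong) (auto simp: D_deg)
    also have "\<dots> = pm_scale (c (deg x)) (D x)"
      by (simp only: lin_ext_fun_scale lin_ext_basis)
    finally show "pm_scale (c (deg x)) (D x) =
      lin_ext (\<lambda>(y, z). Poly_Mapping.single (y, z) (c (deg y + deg z))) (D x)" ..
  qed
  also have "\<dots> = lin_ext (\<lambda>(y, z). Poly_Mapping.single (y, z) (c (deg y + deg z))) (tensor p 1 + tensor 1 p)"
    using assms by (simp add: prim_def flip: lin_lin_ext_comp[OF lin_lin_ext])
  also have "\<dots> = tensor (normalize p) 1 + tensor 1 (normalize p)"
    by (simp add: n tensor_def bilin_ext_def lin_lin_ext_comp[OF lin_lin_ext] flip: single_one)
  finally have "Delta (normalize p) = tensor (normalize p) 1 + tensor 1 (normalize p)" .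
  moreover have "Poly_Mapping.keys (normalize p) \<subseteq> Poly_Mapping.keys p"
    unfolding normalize_def by (rule subset_trans[OF keys_lin_ext]) auto
  ultimately show "normalize p \<in> prim" using assms by (auto simp: prim_def)
  show "normalize (lin_ext E p) = p"
    using normalize_deg[OF 0]
    by (simp add: E_prim[OF assms] normalize_def lin_lin_ext_comp[OF lin_lin_ext] mult.commute)
  show "lin_ext (\<lambda>x. G x 0) (normalize p) = p"
    using normalize_deg[OF 0]
    by (simp add: normalize_def lin_lin_ext_comp[OF lin_lin_ext] G_zero_right mult.commute)
qed

subsection \<open>The cocycles attached to primitive elements\<close>

definition L :: "('x \<Rightarrow>\<^sub>0 'k) \<Rightarrow> ('x \<Rightarrow>\<^sub>0 'k) \<Rightarrow> ('x \<Rightarrow>\<^sub>0 'k)" where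
  "L v b = bilin_ext G (normalize v) b"

lemma lin_L: "lin (L v)"
  unfolding L_def[abs_def] by (rule lin_bilin_ext_right)

lemma L_one: "v \<in> prim \<Longrightarrow> L v 1 = v"
  using normalize_prim(3)[of v] by (simp add: L_def bilin_ext_def flip: single_one)

text \<open>The Hochschild cocycle equation. With a primitive w in place of \<open>x\<close> in
  \<open>D_G\<close>, the part 1 \<otimes> w contributes only to the first sum and w \<otimes> 1
  only to the second, because \<open>G 0 y = 0\<close>.\<close>

lemma Delta_L:
  assumes "v \<in> prim"
  shows "Delta (L v p) = tensor 1 (L v p) + lin_ext (\<lambda>(a, b). tensor (L v (Poly_Mapping.single a 1)) (Poly_Mapping.single b 1)) (Delta p)"
proof (rule lin_eqI[of "\<lambda>p. Delta (L v p)"])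
  show "lin (\<lambda>p. Delta (L v p))" by (rule lin_compose[OF lin_L lin_lin_ext])
  show "lin (\<lambda>p. tensor 1 (L v p) + lin_ext (\<lambda>(a, b). tensor (L v (Poly_Mapping.single a 1)) (Poly_Mapping.single b 1)) (Delta p))"
    by (rule lin_plus[OF lin_compose[OF lin_L lin_tensor_right] lin_compose[OF lin_lin_ext lin_lin_ext]])
next
  fix y
  let ?w = "normalize v"
  have w: "Delta ?w = tensor ?w 1 + tensor 1 ?w" using normalize_prim(1)[OF assms] by (simp add: prim_def)
  let ?f = "\<lambda>a b. tensor (Poly_Mapping.single a 1) (G b y) +
    sw (\<lambda>c d. tensor (G a c) (Poly_Mapping.single (b + d) 1)) y"
  have "Delta (L v (Poly_Mapping.single y 1)) = lin_ext (sw ?f) ?w"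
    by (simp add: L_def bilin_ext_def lin_lin_ext_comp[OF lin_lin_ext] D_G sw_def[abs_def]
        lin_ext_fun_add case_prod_unfold)
  also have "\<dots> = lin_ext (\<lambda>x. ?f x 0) ?w + lin_ext (?f 0) ?w"
    by (simp add: lin_ext_sw w flip: single_one bilin_ext_eq_lin_ext_tensor) (simp add: bilin_ext_def)
  also have "lin_ext (?f 0) ?w = tensor 1 (L v (Poly_Mapping.single y 1))"
    by (simp add: G_zero_left L_def bilin_ext_def lin_zero[OF lin_tensor_left] lin_lin_ext_comp[OF lin_tensor_right])
  also have "lin_ext (\<lambda>x. ?f x 0) ?w = lin_ext (\<lambda>(a, b). tensor (L v (Poly_Mapping.single a 1)) (Poly_Mapping.single b 1)) (D y)"
    by (simp add: G_zero_left L_def bilin_ext_def lin_zero[OF lin_tensor_right] lin_lin_ext_comp[OF lin_tensor_left]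
        sw_def case_prod_unfold) (rule lin_ext_swap)
  finally show "Delta (L v (Poly_Mapping.single y 1)) = tensor 1 (L v (Poly_Mapping.single y 1)) +
      lin_ext (\<lambda>(a, b). tensor (L v (Poly_Mapping.single a 1)) (Poly_Mapping.single b 1)) (Delta (Poly_Mapping.single y 1))"
    by (simp add: add.commute)
qed

subsection \<open>The morphism to the shuffle algebra\<close>

lemma ex_proj: "\<exists>P. lin P \<and> range P \<subseteq> prim \<and> (\<forall>v\<in>prim. P v = v)"
  using pmp.linear_exists_left_inverse_on[OF lin_id subspace_prim] by auto

definition proj :: "('x \<Rightarrow>\<^sub>0 'k) \<Rightarrow> ('x \<Rightarrow>\<^sub>0 'k)" where
  "proj = (SOME P. lin P \<and> range P \<subseteq> prim \<and> (\<forall>v\<in>prim. P v = v))"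

lemma lin_proj: "lin proj" and proj_in_prim: "proj p \<in> prim" and proj_prim: "v \<in> prim \<Longrightarrow> proj v = v"
  using someI_ex[OF ex_proj] unfolding proj_def[symmetric] by blast+

definition letter :: "'x \<Rightarrow> ('x \<Rightarrow>\<^sub>0 'k)" where
  "letter x = proj (normalize (E x))"

lemma lin_normalize: "lin normalize"
  unfolding normalize_def by (rule lin_lin_ext)

lemma letter_in_prim: "letter x \<in> prim"
  unfolding letter_def by (rule proj_in_prim)

lemma lin_ext_letter_in_prim: "lin_ext letter p \<in> prim"
  by (rule lin_ext_in_subspace[OF subspace_prim letter_in_prim])

lemma letter_zero [simp]: "letter 0 = 0"
  by (simp add: letter_def lin_zero[OF lin_proj] lin_zero[OF lin_normalize])

lemma letter_add: "letter (x + y) = (if x = 0 then letter y else 0) + (if y = 0 then letter x else 0)"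
  by (simp add: letter_def E_add lin_zero[OF lin_proj] lin_zero[OF lin_normalize]
      lin_add[OF lin_proj] lin_add[OF lin_normalize])

lemma letter_prim: "v \<in> prim \<Longrightarrow> lin_ext letter v = v"
  using normalize_prim(2)[of v] lin_lin_ext_comp[OF lin_compose[OF lin_normalize lin_proj], of E v]
  by (simp add: letter_def[abs_def] proj_prim)

text \<open>The coalgebra morphism with corestriction \<open>letter\<close>: unfolded, it sums over
  the iterated coproducts of x the words formed by the letters of the legs. The test on
  \<open>y\<close> is there for termination and changes nothing, as \<open>letter 0 = 0\<close>;
  \<open>phi_eq\<close> removes it.\<close>

function phi :: "'x \<Rightarrow> ('x list \<Rightarrow>\<^sub>0 'k)" where
  "phi x = (if x = 0 then Poly_Mapping.single [] 1
     else sw (\<lambda>y z. if y = 0 then 0 else word_cons (letter y) (phi z)) x)"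
  by auto
termination by (relation "measure deg") (auto intro: deg_less)

declare phi.simps [simp del]

abbreviation Phi :: "('x \<Rightarrow>\<^sub>0 'k) \<Rightarrow> ('x list \<Rightarrow>\<^sub>0 'k)" where
  "Phi \<equiv> lin_ext phi"

lemma phi_zero [simp]: "phi 0 = Poly_Mapping.single [] 1"
  by (simp add: phi.simps)

lemma phi_eq: "phi x = (if x = 0 then Poly_Mapping.single [] 1 else 0) + sw (\<lambda>y z. word_cons (letter y) (phi z)) x"
  by (subst sw_split_left) (simp add: phi.simps[of x] sw_at_zero)

lemma Phi_eq: "Phi p = Poly_Mapping.single [] (Poly_Mapping.lookup p 0) +
    lin_ext (\<lambda>(y, z). word_cons (letter y) (phi z)) (Delta p)"
proof -
  have "Phi p = lin_ext (\<lambda>x. (if x = 0 then Poly_Mapping.single [] 1 else 0) + sw (\<lambda>y z. word_cons (letter y) (phi z)) x) p"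
    by (rule lin_ext_cong) (rule phi_eq)
  also have "\<dots> = lin_ext (\<lambda>x. if x = 0 then Poly_Mapping.single [] 1 else 0) p +
      lin_ext (\<lambda>(y, z). word_cons (letter y) (phi z)) (Delta p)"
    by (simp only: lin_ext_fun_add lin_ext_sw)
  also have "lin_ext (\<lambda>x. if x = 0 then Poly_Mapping.single [] 1 else 0) p = Poly_Mapping.single [] (Poly_Mapping.lookup p 0)"
    by (simp add: lin_ext_def if_distrib in_keys_iff cong: if_cong)
  finally show ?thesis .
qed

lemma phi_in_tensor_space: "phi x \<in> tensor_space prim"
proof (induction "deg x" arbitrary: x rule: less_induct)
  case less
  have "word_cons (letter y) (phi z) \<in> tensor_space prim" if "(y, z) \<in> Poly_Mapping.keys (D x)" for y z
  proof (cases "y = 0")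
    case True
    then show ?thesis using pm.subspace_0[OF subspace_tensor_space] by simp
  next
    case False
    then show ?thesis
      by (intro word_cons_tensor_space letter_in_prim less deg_less[OF that])
  qed
  then have "sw (\<lambda>y z. word_cons (letter y) (phi z)) x \<in> tensor_space prim"
    unfolding sw_def by (intro lin_ext_in_subspace subspace_tensor_space) auto
  then show ?case
    by (subst phi_eq) (auto intro!: pm.subspace_add[OF subspace_tensor_space] Nil_tensor_space
        pm.subspace_0[OF subspace_tensor_space])
qed

lemma Phi_in_tensor_space: "Phi p \<in> tensor_space prim"
  by (rule lin_ext_in_subspace[OF subspace_tensor_space phi_in_tensor_space])

lemma lookup_phi_Nil: "Poly_Mapping.lookup (phi x) [] = (if x = 0 then 1 else 0)"
  by (subst phi_eq) (simp add: lookup_add sw_def lookup_lin_ext case_prod_unfold)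

lemma lookup_Phi_Nil: "Poly_Mapping.lookup (Phi p) [] = Poly_Mapping.lookup p 0"
  by (simp add: lookup_lin_ext lookup_phi_Nil if_distrib in_keys_iff cong: if_cong)

text \<open>By coassociativity, splitting off the first letter and then cutting the rest agrees with
  cutting and then splitting off the first letter of the left part. The cut before the first letter
  accounts for the empty left part.\<close>

lemma deconcatenation_phi: "deconcatenation (phi x) = sw (\<lambda>y z. tensor (phi y) (phi z)) x"
proof (induction "deg x" arbitrary: x rule: less_induct)
  case less
  let ?e = "Poly_Mapping.single [] (1::'k)"
  let ?c = "\<lambda>y z. word_cons (letter y) (phi z)"
  show ?case
  proof (cases "x = 0")
    case True
    then show ?thesis by (simp add: sw_at_zero deconcatenation_Nil)
  next
    case False
    have "deconcatenation (phi x) = sw (\<lambda>y z. deconcatenation (?c y z)) x"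
      using False by (subst phi_eq) (simp add: lin_sw[OF lin_deconcatenation])
    also have "\<dots> = sw (\<lambda>y z. tensor ?e (?c y z) + sw (\<lambda>a b. tensor (?c y a) (phi b)) z) x"
    proof (rule sw_cong[OF refl])
      fix y z assume yz: "(y, z) \<in> Poly_Mapping.keys (D x)"
      show "deconcatenation (?c y z) = tensor ?e (?c y z) + sw (\<lambda>a b. tensor (?c y a) (phi b)) z"
      proof (cases "y = 0")
        case True
        then show ?thesis
          by (simp add: lin_zero[OF lin_deconcatenation] lin_zero[OF lin_tensor_left] lin_zero[OF lin_tensor_right])
      next
        case F: False
        show ?thesis
          by (simp add: deconcatenation_word_cons less[OF deg_less[OF yz F]] lin_sw[OF lin_word_cons_fst]
              word_cons_fst_tensor)
      qed
    qed
    also have "\<dots> = tensor ?e (phi x) + sw (\<lambda>y z. sw (\<lambda>a b. tensor (?c a b) (phi z)) y) x"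
      using False
      by (simp add: sw_fun_add phi_eq[of x] sw_assoc lin_sw[OF lin_tensor_right])
    \<comment> \<open>The inner sum is \<open>phi y\<close> without its constant term, which is
      present only for y = 0. The resulting correction cancels
      \<open>tensor ?e (phi x)\<close>.\<close>
    also have "sw (\<lambda>y z. sw (\<lambda>a b. tensor (?c a b) (phi z)) y) x =
        sw (\<lambda>y z. tensor (phi y) (phi z) - (if y = 0 then tensor ?e (phi z) else 0)) x"
    proof (rule sw_cong[OF refl])
      fix y z
      have "tensor (phi y) (phi z) = (if y = 0 then tensor ?e (phi z) else 0) + tensor (sw ?c y) (phi z)"
        by (subst phi_eq[of y]) (simp add: lin_add[OF lin_tensor_left] lin_zero[OF lin_tensor_left])
      then show "sw (\<lambda>a b. tensor (?c a b) (phi z)) y =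
          tensor (phi y) (phi z) - (if y = 0 then tensor ?e (phi z) else 0)"
        by (simp add: lin_sw[OF lin_tensor_left])
    qed
    finally show ?thesis by (simp add: sw_fun_diff sw_zero_left)
  qed
qed

text \<open>Since \<open>letter\<close> kills products, the first letter of a word of x + y comes
  from x alone or from y alone, and what follows is the image of a product of smaller total degree.
  This is the shuffle recursion.\<close>

lemma phi_add: "phi (x + y) = shuffle_prod (phi x) (phi y)"
proof (induction "deg x + deg y" arbitrary: x y rule: less_induct)
  case less
  let ?c = "\<lambda>y z. word_cons (letter y) (phi z)"
  show ?case
  proof (cases "x = 0 \<or> y = 0")
    case True
    then show ?thesis by auto
  next
    case False
    have ne: "x + y \<noteq> 0" using False deg_add[of x y] by (auto simp flip: deg_0_iff)
    have "phi (x + y) = sw (\<lambda>a b. sw (\<lambda>c d. ?c (a + c) (b + d)) y) x"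
      by (subst phi_eq) (simp add: ne sw_add)
    also have "\<dots> = sw (\<lambda>a b. sw (\<lambda>c d.
        (if a = 0 then ?c c (b + d) else 0) + (if c = 0 then ?c a (b + d) else 0)) y) x"
      by (intro sw_cong refl) (auto simp: letter_add lin_add[OF lin_word_cons_left])
    also have "\<dots> = sw (\<lambda>a b. (if a = 0 then sw (\<lambda>c d. ?c c (b + d)) y else 0) + ?c a (b + y)) x"
      by (rule sw_cong) (auto simp: sw_fun_add sw_zero_left)
    also have "\<dots> = sw (\<lambda>c d. ?c c (x + d)) y + sw (\<lambda>a b. ?c a (b + y)) x"
      by (simp add: sw_fun_add sw_zero_left)
    also have "sw (\<lambda>c d. ?c c (x + d)) y = sw (\<lambda>c d. word_cons (letter c) (shuffle_prod (phi x) (phi d))) y"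
    proof (rule sw_cong[OF refl])
      fix c d assume cd: "(c, d) \<in> Poly_Mapping.keys (D y)"
      show "?c c (x + d) = word_cons (letter c) (shuffle_prod (phi x) (phi d))"
        using less[of x d] deg_less[OF cd] by (cases "c = 0") auto
    qed
    also have "sw (\<lambda>a b. ?c a (b + y)) x = sw (\<lambda>a b. word_cons (letter a) (shuffle_prod (phi b) (phi y))) x"
    proof (rule sw_cong[OF refl])
      fix a b assume ab: "(a, b) \<in> Poly_Mapping.keys (D x)"
      show "?c a (b + y) = word_cons (letter a) (shuffle_prod (phi b) (phi y))"
        using less[of b y] deg_less[OF ab] by (cases "a = 0") auto
    qed
    also have "sw (\<lambda>c d. word_cons (letter c) (shuffle_prod (phi x) (phi d))) y +
        sw (\<lambda>a b. word_cons (letter a) (shuffle_prod (phi b) (phi y))) x =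
      sw (\<lambda>a b. sw (\<lambda>c d. shuffle_prod (?c a b) (?c c d)) y) x"
    proof -
      have x: "phi x = sw ?c x" and y: "phi y = sw ?c y" using False phi_eq[of x] phi_eq[of y] by simp_all
      have "sw (\<lambda>a b. sw (\<lambda>c d. shuffle_prod (?c a b) (?c c d)) y) x =
          sw (\<lambda>a b. sw (\<lambda>c d. word_cons (letter a) (shuffle_prod (phi b) (?c c d))) y) x +
          sw (\<lambda>c d. sw (\<lambda>a b. word_cons (letter c) (shuffle_prod (?c a b) (phi d))) x) y"
        by (subst sw_swap[of _ x y]) (simp add: shuffle_prod_word_cons sw_fun_add)
      also have "sw (\<lambda>a b. sw (\<lambda>c d. word_cons (letter a) (shuffle_prod (phi b) (?c c d))) y) x =
          sw (\<lambda>a b. word_cons (letter a) (shuffle_prod (phi b) (phi y))) x"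
        by (simp only: y lin_sw[OF lin_shuffle_prod_right] lin_sw[OF lin_word_cons_right])
      also have "sw (\<lambda>c d. sw (\<lambda>a b. word_cons (letter c) (shuffle_prod (?c a b) (phi d))) x) y =
          sw (\<lambda>c d. word_cons (letter c) (shuffle_prod (phi x) (phi d))) y"
        by (simp only: x lin_sw[OF lin_shuffle_prod_left] lin_sw[OF lin_word_cons_right])
      finally show ?thesis by (simp add: add.commute)
    qed
    also have "\<dots> = shuffle_prod (phi x) (phi y)"
      using False
      by (simp add: phi_eq[of x] phi_eq[of y] lin_sw[OF lin_shuffle_prod_left] lin_sw[OF lin_shuffle_prod_right]
          sw_swap[of _ x y])
    finally show ?thesis .
  qed
qed

lemma Phi_mult: "Phi (p * q) = shuffle_prod (Phi p) (Phi q)"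
  by (simp add: mult_eq_bilin_ext bilin_ext_def lin_lin_ext_comp[OF lin_lin_ext] phi_add
      lin_lin_ext_comp[OF lin_shuffle_prod_left] lin_lin_ext_comp[OF lin_shuffle_prod_right])
    (rule lin_ext_swap)

lemma deconcatenation_Phi: "deconcatenation (Phi p) = tensor_map Phi Phi (Delta p)"
proof -
  have "deconcatenation (Phi p) = lin_ext (sw (\<lambda>y z. tensor (phi y) (phi z))) p"
    by (simp add: lin_lin_ext_comp[OF lin_deconcatenation] deconcatenation_phi cong: lin_ext_cong)
  then show ?thesis by (simp add: lin_ext_sw tensor_map_def)
qed

section \<open>Injectivity, reduced to primitive elements\<close>

lemma Phi_prim:
  assumes "v \<in> prim"
  shows "Phi v = word_cons v (Poly_Mapping.single [] 1)"
proof -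
  have "Phi v = lin_ext (\<lambda>(y, z). word_cons (letter y) (phi z)) (tensor v 1 + tensor 1 v)"
    using assms by (subst Phi_eq) (simp add: lookup_prim_zero prim_def)
  also have "\<dots> = word_cons (lin_ext letter v) (Poly_Mapping.single [] 1)"
    by (simp flip: bilin_ext_eq_lin_ext_tensor) (simp add: bilin_ext_def lin_lin_ext_comp[OF lin_word_cons_left])
  finally show ?thesis by (simp add: letter_prim assms)
qed

text \<open>Induction on a bound for the degree. The reduced coproduct of an element of the kernel
  is killed by \<open>tensor_map Phi Phi\<close> and has both legs of smaller degree, so it
  vanishes. The element is then primitive, and \<open>Phi\<close> writes a primitive element as a
  one-letter word.\<close>

lemma Phi_inj:
  assumes "Poly_Mapping.keys p \<subseteq> S" "Phi p = 0"
  shows "p = 0"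
proof -
  have "p = 0" if "Poly_Mapping.keys p \<subseteq> {x \<in> S. deg x \<le> n}" "Phi p = 0" for n p
    using that
  proof (induction n arbitrary: p rule: less_induct)
    case (less n)
    define A where "A = {x \<in> S. deg x < n}"
    have "inj_on Phi {p. Poly_Mapping.keys p \<subseteq> A}"
    proof (rule inj_onI)
      fix p q assume pq: "p \<in> {p. Poly_Mapping.keys p \<subseteq> A}" "q \<in> {p. Poly_Mapping.keys p \<subseteq> A}" "Phi p = Phi q"
      then have k: "Poly_Mapping.keys (p - q) \<subseteq> A" using pm.subspace_diff[OF subspace_keys] by blast
      \<comment> \<open>\<open>A\<close> has a strict bound and the induction hypothesis a weak one,
        hence the passage from \<open>Suc m\<close> to \<open>m\<close>; for n = 0 the set
        \<open>A\<close> is empty.\<close>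
      show "p = q"
      proof (cases n)
        case 0
        then have "A = {}" by (simp add: A_def)
        then show ?thesis using pq by simp
      next
        case (Suc m)
        have "p - q = 0" by (rule less.IH[of m]) (use k Suc pq(3) in \<open>auto simp: A_def\<close>)
        then show ?thesis by simp
      qed
    qed
    \<comment> \<open>A linear left inverse \<open>g\<close> on the span of \<open>A\<close> shows
      that the tensor square of \<open>Phi\<close> is injective there: apply
      \<open>tensor_map g g\<close>.\<close>
    from pmp.linear_exists_left_inverse_on[OF lin_lin_ext subspace_keys this]
    obtain g where g: "lin g" and gp: "\<And>p. Poly_Mapping.keys p \<subseteq> A \<Longrightarrow> g (Phi p) = p" by auto
    have p0: "Poly_Mapping.lookup p 0 = 0" using lookup_Phi_Nil[of p] less.prems(2) by simp
    let ?r = "Delta p - tensor p 1 - tensor 1 p"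
    have keys_r: "Poly_Mapping.keys ?r \<subseteq> A \<times> A"
    proof
      fix t assume t: "t \<in> Poly_Mapping.keys ?r"
      obtain y z where yz: "t = (y, z)" by (cases t)
      from t have l: "Poly_Mapping.lookup (Delta p) (y, z) - Poly_Mapping.lookup p y * Poly_Mapping.lookup 1 z
          - Poly_Mapping.lookup 1 y * Poly_Mapping.lookup p z \<noteq> 0"
        by (simp add: in_keys_iff lookup_minus yz)
      have "y \<noteq> 0" using l p0 by (auto simp: lookup_Delta_zero_left lookup_one when_def)
      moreover have "z \<noteq> 0" using l p0 by (auto simp: lookup_Delta_zero_right lookup_one when_def)
      ultimately have "(y, z) \<in> Poly_Mapping.keys (Delta p)"
        using l by (auto simp: lookup_one when_def in_keys_iff)
      then obtain x where x: "x \<in> Poly_Mapping.keys p" "(y, z) \<in> Poly_Mapping.keys (D x)"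
        using keys_lin_ext[of D p] by blast
      have "deg y > 0" "deg z > 0" using \<open>y \<noteq> 0\<close> \<open>z \<noteq> 0\<close> deg_0_iff[of y] deg_0_iff[of z] by auto
      moreover have "x \<in> S" "deg x \<le> n" using x less.prems(1) by auto
      ultimately show "t \<in> A \<times> A" using D_deg[OF x(2)] D_S[OF _ x(2)] by (auto simp: A_def yz)
    qed
    have "tensor_map Phi Phi ?r = 0"
      using less.prems(2) deconcatenation_Phi[of p]
      by (simp add: lin_diff[OF lin_tensor_map] tensor_map_tensor lin_lin_ext lin_zero[OF lin_tensor_left]
          lin_zero[OF lin_tensor_right] lin_zero[OF lin_deconcatenation])
    then have "0 = tensor_map g g (tensor_map Phi Phi ?r)"
      by (simp add: lin_zero[OF lin_tensor_map])
    also have "\<dots> = lin_ext (\<lambda>t. tensor_map g g (tensor_map Phi Phi (Poly_Mapping.single t 1))) ?r"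
      by (rule lin_expand[OF lin_compose[OF lin_tensor_map lin_tensor_map]])
    also have "\<dots> = lin_ext (\<lambda>t. Poly_Mapping.single t 1) ?r"
    proof (rule lin_ext_cong)
      fix t assume "t \<in> Poly_Mapping.keys ?r"
      then obtain y z where yz: "t = (y, z)" "y \<in> A" "z \<in> A" using keys_r by (cases t) auto
      have "tensor_map g g (tensor_map Phi Phi (tensor (Poly_Mapping.single y (1::'k)) (Poly_Mapping.single z 1))) =
          tensor (g (Phi (Poly_Mapping.single y 1))) (g (Phi (Poly_Mapping.single z 1)))"
        by (simp only: tensor_map_tensor lin_lin_ext g)
      then show "tensor_map g g (tensor_map Phi Phi (Poly_Mapping.single t 1)) = Poly_Mapping.single t 1"
        using gp[of "Poly_Mapping.single y 1"] gp[of "Poly_Mapping.single z 1"] yz by simp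
    qed
    finally have "?r = 0" by (simp add: lin_ext_basis)
    then have v: "p \<in> prim" using less.prems(1) by (auto simp: prim_def algebra_simps)
    show "p = 0"
    proof (rule poly_mapping_eqI)
      fix x
      show "Poly_Mapping.lookup p x = Poly_Mapping.lookup 0 x"
        using Phi_prim[OF v] less.prems(2) lookup_word_cons_unit[of p x] by simp
    qed
  qed
  moreover obtain n where "\<forall>x\<in>Poly_Mapping.keys p. deg x \<le> n"
    using finite_nat_set_iff_bounded_le[of "deg ` Poly_Mapping.keys p"] by auto
  ultimately show ?thesis using assms by blast
qed

section \<open>Surjectivity: iterated cocycles as a section up to shorter words\<close>

fun psi :: "('x \<Rightarrow>\<^sub>0 'k) list \<Rightarrow> ('x \<Rightarrow>\<^sub>0 'k)" where
  "psi [] = 1"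
| "psi (v # vs) = L v (psi vs)"

text \<open>\<open>Delta_L\<close> mirrors \<open>deconcatenation_word_cons\<close>, so
  \<open>psi\<close> carries deconcatenation to the coproduct. Working with lists of vectors instead
  of tensors avoids a check that \<open>psi\<close> is multilinear.\<close>

lemma Delta_psi:
  assumes "vs \<in> lists prim"
  shows "Delta (psi vs) = (\<Sum>i\<le>length vs. tensor (psi (take i vs)) (psi (drop i vs)))"
  using assms
proof (induction vs)
  case Nil
  have "tensor 1 1 = Poly_Mapping.single (0 :: 'x, 0 :: 'x) (1::'k)" by (simp flip: single_one)
  then show ?case by (simp add: D_zero)
next
  case (Cons v vs)
  have f: "lin_ext (\<lambda>(a, b). tensor (L v (Poly_Mapping.single a 1)) (Poly_Mapping.single b 1)) (tensor p q) =
      tensor (L v p) q" for p q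
    using tensor_map_tensor[OF lin_L lin_id, of v p q] by (simp add: tensor_map_def)
  have "Delta (psi (v # vs)) = tensor 1 (psi (v # vs)) +
      (\<Sum>i\<le>length vs. tensor (L v (psi (take i vs))) (psi (drop i vs)))"
    using Cons by (simp add: Delta_L lin_ext_sum f)
  then show ?case by (simp add: sum.atMost_Suc_shift del: sum.atMost_Suc)
qed

lemma keys_L:
  assumes "v \<in> prim" "Poly_Mapping.keys p \<subseteq> S"
  shows "Poly_Mapping.keys (L v p) \<subseteq> S - {0}"
proof
  fix z assume "z \<in> Poly_Mapping.keys (L v p)"
  then obtain x where x: "x \<in> Poly_Mapping.keys (normalize v)" "z \<in> Poly_Mapping.keys (lin_ext (G x) p)"
    unfolding L_def bilin_ext_def using keys_lin_ext by fast
  then obtain y where y: "y \<in> Poly_Mapping.keys p" "z \<in> Poly_Mapping.keys (G x y)"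
    using keys_lin_ext by fast
  have w: "normalize v \<in> prim" by (rule normalize_prim(1)[OF assms(1)])
  have "x \<noteq> 0" using lookup_prim_zero[OF w] x(1) by (auto simp: in_keys_iff)
  then have "deg x \<noteq> 0" by (simp add: deg_0_iff)
  then have "deg z \<noteq> 0" using G_deg[OF y(2)] by simp
  then have "z \<noteq> 0" by (simp add: deg_0_iff)
  moreover have "z \<in> S" using G_S[OF _ _ y(2)] w x(1) y(1) assms(2) by (auto simp: prim_def)
  ultimately show "z \<in> S - {0}" by blast
qed

lemma keys_psi: "vs \<in> lists prim \<Longrightarrow> Poly_Mapping.keys (psi vs) \<subseteq> S"
proof (induction vs)
  case Nil
  then show ?case using zero_S by simp
next
  case (Cons v vs)
  then show ?case using keys_L[of v "psi vs"] by auto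
qed

lemma lookup_psi_zero: "vs \<in> lists prim \<Longrightarrow> vs \<noteq> [] \<Longrightarrow> Poly_Mapping.lookup (psi vs) 0 = 0"
  using keys_L keys_psi by (cases vs) (auto simp: in_keys_iff subset_iff)

text \<open>\<open>Phi \<circ> psi\<close> is unipotent for the filtration of the tensor algebra by the length of words.\<close>

lemma Phi_psi:
  assumes "vs \<in> lists prim"
  shows "Phi (psi vs) - pure_tensor vs \<in> pm.span (pure_tensor ` {us \<in> lists prim. length us < length vs})"
  using assms
proof (induction "length vs" arbitrary: vs rule: less_induct)
  case less
  let ?F = "\<lambda>n. pm.span (pure_tensor ` {us \<in> lists prim. length us < n})"
  show ?case
  proof (cases vs)
    case Nil
    then show ?thesis by (simp add: pm.span_zero)
  next
    case (Cons v us)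
    have vp: "v \<in> prim" and us: "us \<in> lists prim" using less.prems Cons by auto
    let ?t = "\<lambda>i. word_cons (lin_ext letter (psi (take i vs))) (Phi (psi (drop i vs)))"
    have t: "lin_ext (\<lambda>(y, z). word_cons (letter y) (phi z)) (tensor p q) = word_cons (lin_ext letter p) (Phi q)" for p q
      by (simp add: bilin_ext_def lin_lin_ext_comp[OF lin_word_cons_left] lin_lin_ext_comp[OF lin_word_cons_right]
          flip: bilin_ext_eq_lin_ext_tensor) (rule lin_ext_swap)
    \<comment> \<open>Term i turns the first i vectors into a single letter. It vanishes for i = 0,
      gives the letter \<open>v\<close> for i = 1 because \<open>L v 1 = v\<close>, and for i \<ge>
      2 it merges at least two vectors into one letter, so only shorter words arise.\<close>
    have "Phi (psi vs) = (\<Sum>i\<le>length vs. ?t i)"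
      using less.prems lookup_psi_zero[OF less.prems] Cons
      by (subst Phi_eq) (simp add: Delta_psi lin_ext_sum t del: psi.simps)
    also have "\<dots> = ?t 0 + (?t 1 + (\<Sum>i<length us. ?t (Suc (Suc i))))"
      using Cons by (simp add: sum.atMost_Suc_shift lessThan_Suc_atMost[symmetric] sum.lessThan_Suc_shift del: sum.atMost_Suc sum.lessThan_Suc)
    also have "?t 0 = 0" by (simp add: letter_zero)
    also have "?t 1 = word_cons v (Phi (psi us))"
      using Cons vp by (simp add: L_one letter_prim)
    finally have *: "Phi (psi vs) - pure_tensor vs =
        word_cons v (Phi (psi us) - pure_tensor us) + (\<Sum>i<length us. ?t (Suc (Suc i)))"
      by (simp add: Cons pure_tensor_Cons lin_diff[OF lin_word_cons_right] del: pure_tensor.simps)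
    have "word_cons v (Phi (psi us) - pure_tensor us) \<in> ?F (length vs)"
      by (rule word_cons_span[OF vp less.hyps[OF _ us]]) (use Cons vp in auto)
    moreover have "?t (Suc (Suc i)) \<in> ?F (length vs)" if "i < length us" for i
    proof (rule word_cons_span[OF lin_ext_letter_in_prim])
      let ?d = "drop (Suc (Suc i)) vs"
      have d: "?d \<in> lists prim" using less.prems by (auto dest: in_set_dropD)
      have "Phi (psi ?d) - pure_tensor ?d \<in> ?F (length ?d)"
        by (rule less.hyps) (use d Cons in auto)
      moreover have "?F (length ?d) \<subseteq> ?F (length us)"
        by (intro pm.span_mono image_mono) (auto simp: Cons)
      moreover have "pure_tensor ?d \<in> ?F (length us)"
        by (rule pm.span_base) (use d that Cons in auto)
      ultimately show "Phi (psi ?d) \<in> ?F (length us)"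
        using pm.span_add[of "Phi (psi ?d) - pure_tensor ?d" _ "pure_tensor ?d"] by auto
    qed (use lin_ext_letter_in_prim Cons in auto)
    ultimately show ?thesis unfolding * by (intro pm.span_add pm.span_sum) auto
  qed
qed

text \<open>By induction on the length, the error term of \<open>Phi_psi\<close> already lies in the
  image and can be subtracted.\<close>

lemma Phi_surj: "tensor_space prim \<subseteq> Phi ` {p. Poly_Mapping.keys p \<subseteq> S}"
proof -
  let ?W = "Phi ` {p. Poly_Mapping.keys p \<subseteq> S}"
  have W: "pm.subspace ?W"
    by (rule pmp.linear_subspace_image[OF lin_lin_ext subspace_keys])
  have "pure_tensor vs \<in> ?W" if "vs \<in> lists prim" for vs
    using that
  proof (induction "length vs" arbitrary: vs rule: less_induct)
    case less
    have "pm.span (pure_tensor ` {us \<in> lists prim. length us < length vs}) \<subseteq> ?W"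
      by (rule pm.span_minimal[OF _ W]) (use less in blast)
    then have "Phi (psi vs) - pure_tensor vs \<in> ?W" using Phi_psi[OF less.prems] by blast
    moreover have "Phi (psi vs) \<in> ?W" using keys_psi[OF less.prems] by blast
    ultimately have "Phi (psi vs) - (Phi (psi vs) - pure_tensor vs) \<in> ?W"
      using pm.subspace_diff[OF W] by blast
    then show ?case by simp
  qed
  then show ?thesis unfolding tensor_space_def by (intro pm.span_minimal W) auto
qed

theorem hopf_isomorphic_shuffle_algebra:
  assumes "hspace A = {p. Poly_Mapping.keys p \<subseteq> S}" "hmult A = (*)" "hone A = 1"
    "hcomult A = Delta" "hcounit A = (\<lambda>p. Poly_Mapping.lookup p 0)"
  shows "hopf_isomorphic A (shuffle_algebra prim)"
proof -
  have "inj_on Phi {p. Poly_Mapping.keys p \<subseteq> S}"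
  proof (rule inj_onI)
    fix p q assume pq: "p \<in> {p. Poly_Mapping.keys p \<subseteq> S}" "q \<in> {p. Poly_Mapping.keys p \<subseteq> S}" "Phi p = Phi q"
    then have "Poly_Mapping.keys (p - q) \<subseteq> S" using pm.subspace_diff[OF subspace_keys] by blast
    with pq Phi_inj[of "p - q"] show "p = q" by simp
  qed
  then have "bij_betw Phi {p. Poly_Mapping.keys p \<subseteq> S} (tensor_space prim)"
    using Phi_surj Phi_in_tensor_space by (auto simp: bij_betw_def)
  then have "hopf_iso A (shuffle_algebra prim) Phi"
    by (simp add: hopf_iso_def shuffle_algebra_def assms lin_lin_ext Phi_mult deconcatenation_Phi lookup_Phi_Nil)
  then show ?thesis unfolding hopf_isomorphic_def by blast
qed

end

section \<open>Multiplicative maps on monoid algebras\<close>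

text \<open>Three functions instead of one: in \<open>ck_coassoc\<close> the inner map depends on
  the outer leg, which is a sum for the product and one of the summands for each factor.\<close>

lemma lin_ext_mult:
  fixes f :: "'x::comm_monoid_add \<Rightarrow> ('y::comm_monoid_add \<Rightarrow>\<^sub>0 'k::field)"
  assumes "\<And>x y. f (x + y) = g x * h y"
  shows "lin_ext f (p * q) = lin_ext g p * lin_ext h q"
  by (simp add: mult_eq_bilin_ext[of p] bilin_ext_def lin_lin_ext_comp[OF lin_lin_ext] assms
      lin_lin_ext_comp[OF lin_times_left] lin_lin_ext_comp[OF lin_times_right] lin_ext_swap[of _ p])

lemma lin_ext_derivation:
  fixes f :: "'x::comm_monoid_add \<Rightarrow> ('x \<Rightarrow>\<^sub>0 'k::field)"
  assumes "\<And>x y. f (x + y) = f x * Poly_Mapping.single y 1 + Poly_Mapping.single x 1 * f y"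
  shows "lin_ext f (p * q) = lin_ext f p * q + p * lin_ext f q"
proof -
  have "lin_ext f (p * q) = lin_ext (\<lambda>x. lin_ext (\<lambda>y. f x * Poly_Mapping.single y 1) q) p +
      lin_ext (\<lambda>x. lin_ext (\<lambda>y. Poly_Mapping.single x 1 * f y) q) p"
    by (simp add: mult_eq_bilin_ext[of p] bilin_ext_def lin_lin_ext_comp[OF lin_lin_ext] assms lin_ext_fun_add)
  also have "lin_ext (\<lambda>x. lin_ext (\<lambda>y. f x * Poly_Mapping.single y 1) q) p = lin_ext f p * q"
    by (simp only: lin_lin_ext_comp[OF lin_times_left] lin_ext_basis flip: lin_lin_ext_comp[OF lin_times_right])
  also have "lin_ext (\<lambda>x. lin_ext (\<lambda>y. Poly_Mapping.single x 1 * f y) q) p = p * lin_ext f q"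
    by (simp only: lin_ext_basis flip: lin_lin_ext_comp[OF lin_times_right] lin_lin_ext_comp[OF lin_times_left])
  finally show ?thesis .
qed

lemma keys_mult_single:
  fixes p :: "'x::comm_monoid_add \<Rightarrow>\<^sub>0 'k::field"
  shows "Poly_Mapping.keys (p * Poly_Mapping.single y 1) \<subseteq> (\<lambda>x. x + y) ` Poly_Mapping.keys p"
  using keys_mult[of p "Poly_Mapping.single y 1"] by auto

lemma tensor_mult: "tensor p q * tensor p' q' = tensor (p * p') (q * q')"
  for p p' :: "'x::comm_monoid_add \<Rightarrow>\<^sub>0 'k::field" and q q' :: "'y::comm_monoid_add \<Rightarrow>\<^sub>0 'k"
  unfolding tensor_def mult_eq_bilin_ext
  by (rule lin_eqI[of "\<lambda>p. bilin_ext _ (bilin_ext _ p _) _" "\<lambda>p. bilin_ext _ (bilin_ext _ p _) _"],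
      (fast intro: lin_intros)+,
      rule lin_eqI[of "\<lambda>q. bilin_ext _ (bilin_ext _ _ q) _" "\<lambda>q. bilin_ext _ _ (bilin_ext _ q _)"],
      (fast intro: lin_intros)+,
      rule lin_eqI[of "\<lambda>p. bilin_ext _ _ (bilin_ext _ p _)" "\<lambda>p. bilin_ext _ (bilin_ext _ _ p) _"],
      (fast intro: lin_intros)+,
      rule lin_eqI[of "\<lambda>q. bilin_ext _ _ (bilin_ext _ _ q)" "\<lambda>q. bilin_ext _ _ (bilin_ext _ _ q)"],
      (fast intro: lin_intros)+, simp)

text \<open>The counit axioms of the locale concern coefficients, which are not multiplicative. The
  counit applied to one leg is, and so it can be computed by induction on forests; this translates
  the result.\<close>

lemma lookup_counit_left:
  "Poly_Mapping.lookup (lin_ext (\<lambda>(y, z). if y = 0 then Poly_Mapping.single z 1 else 0) p) z =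
     Poly_Mapping.lookup p (0, z)"
proof -
  have "Poly_Mapping.lookup (lin_ext (\<lambda>(y, z). if y = 0 then Poly_Mapping.single z 1 else 0) p) z =
      (\<Sum>t\<in>Poly_Mapping.keys p. if t = (0, z) then Poly_Mapping.lookup p t else 0)"
    unfolding lookup_lin_ext by (rule sum.cong) (auto simp: lookup_single when_def split: if_splits)
  then show ?thesis by (simp add: in_keys_iff)
qed

lemma lookup_counit_right:
  "Poly_Mapping.lookup (lin_ext (\<lambda>(y, z). if z = 0 then Poly_Mapping.single y 1 else 0) p) y =
     Poly_Mapping.lookup p (y, 0)"
proof -
  have "Poly_Mapping.lookup (lin_ext (\<lambda>(y, z). if z = 0 then Poly_Mapping.single y 1 else 0) p) y =
      (\<Sum>t\<in>Poly_Mapping.keys p. if t = (y, 0) then Poly_Mapping.lookup p t else 0)"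
    unfolding lookup_lin_ext by (rule sum.cong) (auto simp: lookup_single when_def split: if_splits)
  then show ?thesis by (simp add: in_keys_iff)
qed


section \<open>Grafting of rooted trees\<close>

primrec rtree_nodes :: "'d rtree \<Rightarrow> nat" where
  "rtree_nodes (Node d F) = Suc (\<Sum>n\<in>#image_mset rtree_nodes F. n)"

definition rforest_nodes :: "'d rforest \<Rightarrow> nat" where
  "rforest_nodes F = (\<Sum>t\<in>#F. rtree_nodes t)"

lemma rforest_nodes_empty [simp]: "rforest_nodes {#} = 0"
  by (simp add: rforest_nodes_def)

lemma rforest_nodes_union [simp]: "rforest_nodes (F + G) = rforest_nodes F + rforest_nodes G"
  by (simp add: rforest_nodes_def)

lemma rforest_nodes_B_plus [simp]: "rforest_nodes (B_plus d F) = Suc (rforest_nodes F)"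
  by (simp add: rforest_nodes_def B_plus_def)

text \<open>Union and \<open>B_plus\<close> are the operations for which the coproduct and grafting
  have closed rules; the nested recursion through multisets is confined to this proof.\<close>

lemma rforest_induct [case_names empty union B_plus]:
  assumes "P {#}" and U: "\<And>F G. P F \<Longrightarrow> P G \<Longrightarrow> P (F + G)" and "\<And>d F. P F \<Longrightarrow> P (B_plus d F)"
  shows "P F"
proof -
  have f: "P F" if "\<And>t. t \<in># F \<Longrightarrow> P {#t#}" for F
    using that
  proof (induction F)
    case (add t F)
    then show ?case using U[of "{#t#}" F] by simp
  qed (rule assms(1))
  have "P {#t#}" for t
  proof (induction t)
    case (Node d F)
    then show ?case using assms(3)[OF f[of F], of d] by (simp add: B_plus_def)
  qed
  then show ?thesis by (rule f)
qed

lemma rforest_nodes_eq_0_iff: "rforest_nodes F = 0 \<longleftrightarrow> F = {#}"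
proof -
  have "rtree_nodes t \<noteq> 0" for t :: "'d rtree" by (cases t) simp
  then show ?thesis by (cases F) (auto simp: rforest_nodes_def)
qed

lemma B_plus_nonempty [simp]: "B_plus d F \<noteq> {#}"
  by (simp add: B_plus_def)

text \<open>The derivation of the polynomial algebra on trees with value \<open>f t\<close> at the
  tree t, equal trees being counted with multiplicity. Its congruence rule admits the nested
  recursion of \<open>graft_tree\<close>.\<close>

definition forest_derivation :: "('d rtree \<Rightarrow> ('d rforest \<Rightarrow>\<^sub>0 'k::field)) \<Rightarrow> 'd rforest \<Rightarrow> ('d rforest \<Rightarrow>\<^sub>0 'k)" where
  "forest_derivation f F = (\<Sum>t\<in>#F. f t * Poly_Mapping.single (F - {#t#}) 1)"

lemma forest_derivation_cong [fundef_cong]: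
  "F = F' \<Longrightarrow> (\<And>t. t \<in># F' \<Longrightarrow> f t = g t) \<Longrightarrow> forest_derivation f F = forest_derivation g F'"
  by (simp add: forest_derivation_def cong: image_mset_cong)

lemma forest_derivation_empty [simp]: "forest_derivation f {#} = 0"
  by (simp add: forest_derivation_def)

lemma forest_derivation_single [simp]: "forest_derivation f {#t#} = f t"
  by (simp add: forest_derivation_def flip: zero_multiset_def)

lemma forest_derivation_add:
  "forest_derivation f (add_mset t F) =
     f t * Poly_Mapping.single F 1 + Poly_Mapping.single {#t#} 1 * forest_derivation f F"
proof -
  have "(\<Sum>s\<in>#F. f s * Poly_Mapping.single (add_mset t F - {#s#}) 1) =
      (\<Sum>s\<in>#F. Poly_Mapping.single {#t#} 1 * (f s * Poly_Mapping.single (F - {#s#}) 1))"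
  proof (rule arg_cong[of _ _ sum_mset], rule image_mset_cong)
    fix s assume "s \<in># F"
    then show "f s * Poly_Mapping.single (add_mset t F - {#s#}) 1 =
        Poly_Mapping.single {#t#} 1 * (f s * Poly_Mapping.single (F - {#s#}) 1)"
      by (simp add: mult_single mult.left_commute[of _ "f s"])
  qed
  then show ?thesis by (simp add: forest_derivation_def sum_mset_distrib_left)
qed

lemma forest_derivation_union:
  "forest_derivation f (F + G) =
     forest_derivation f F * Poly_Mapping.single G 1 + Poly_Mapping.single F 1 * forest_derivation f G"
proof (induction F)
  case empty
  then show ?case by (simp flip: zero_multiset_def)
next
  case (add t F)
  have 1: "Poly_Mapping.single (add_mset t F) (1::'b) = Poly_Mapping.single {#t#} 1 * Poly_Mapping.single F 1"
    and 2: "Poly_Mapping.single (F + G) (1::'b) = Poly_Mapping.single F 1 * Poly_Mapping.single G 1"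
    by (simp_all add: mult_single)
  show ?case
    using add forest_derivation_add[of f t "F + G"]
    by (simp add: forest_derivation_add 1 2 distrib_left distrib_right mult.assoc add.assoc)
qed

text \<open>The first summand grafts onto the root, the second onto the vertices of the
  subtrees.\<close>

function graft_tree :: "'d rtree \<Rightarrow> 'd rforest \<Rightarrow> ('d rforest \<Rightarrow>\<^sub>0 'k::field)" where
  "graft_tree (Node d F) G = Poly_Mapping.single (B_plus d (F + G)) 1 +
     lin_ext (\<lambda>E. Poly_Mapping.single (B_plus d E) 1) (forest_derivation (\<lambda>t. graft_tree t G) F)"
  by pat_completeness auto
termination
proof (relation "measure (\<lambda>(t, G). rtree_nodes t)")
  fix d and F G :: "'a rforest" and t
  assume "t \<in># F"
  then have "rtree_nodes t \<le> (\<Sum>n\<in>#image_mset rtree_nodes F. n)"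
    by (metis image_mset.identity id_apply sum_mset.remove multi_member_split image_mset_add_mset sum_mset.add_mset le_add1)
  then show "((t, G), Node d F, G) \<in> measure (\<lambda>(t, G). rtree_nodes t)" by simp
qed simp

declare graft_tree.simps [simp del]

definition graft :: "'d rforest \<Rightarrow> 'd rforest \<Rightarrow> ('d rforest \<Rightarrow>\<^sub>0 'k::field)" where
  "graft F G = forest_derivation (\<lambda>t. graft_tree t G) F"

lemma graft_empty [simp]: "graft {#} G = 0"
  by (simp add: graft_def)

lemma graft_union: "graft (F + F') G = graft F G * Poly_Mapping.single F' 1 + Poly_Mapping.single F 1 * graft F' G"
  by (simp add: graft_def forest_derivation_union)

lemma graft_B_plus: "graft (B_plus d F) G = Poly_Mapping.single (B_plus d (F + G)) 1 +
     lin_ext (\<lambda>E. Poly_Mapping.single (B_plus d E) 1) (graft F G)"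
  by (simp add: graft_def B_plus_def[of d F] graft_tree.simps)

lemma graft_empty_right: "graft F {#} = Poly_Mapping.single F (of_nat (rforest_nodes F))"
proof (induction F rule: rforest_induct)
  case (union F G)
  then show ?case by (simp add: graft_union mult_single flip: single_add)
next
  case (B_plus d F)
  then show ?case by (simp add: graft_B_plus flip: single_add)
qed simp

lemma keys_graft:
  assumes "E \<in> Poly_Mapping.keys (graft F G :: 'd rforest \<Rightarrow>\<^sub>0 'k::field)"
  shows "rforest_nodes E = rforest_nodes F + rforest_nodes G \<and>
    (\<Union>t\<in>set_mset E. set_rtree t) = (\<Union>t\<in>set_mset F \<union> set_mset G. set_rtree t)"
  using assms
proof (induction F arbitrary: E rule: rforest_induct)
  case (union F F')
  then have "E \<in> Poly_Mapping.keys (graft F G * Poly_Mapping.single F' (1::'k) + graft F' G * Poly_Mapping.single F 1)"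
    by (simp add: graft_union mult.commute)
  from subsetD[OF keys_add this] have "E \<in> (\<lambda>x. x + F') ` Poly_Mapping.keys (graft F G :: 'd rforest \<Rightarrow>\<^sub>0 'k) \<union>
      (\<lambda>x. x + F) ` Poly_Mapping.keys (graft F' G :: 'd rforest \<Rightarrow>\<^sub>0 'k)"
    using keys_mult_single[of "graft F G :: 'd rforest \<Rightarrow>\<^sub>0 'k" F']
      keys_mult_single[of "graft F' G :: 'd rforest \<Rightarrow>\<^sub>0 'k" F] by blast
  then consider E1 where "E1 \<in> Poly_Mapping.keys (graft F G :: 'd rforest \<Rightarrow>\<^sub>0 'k)" "E = E1 + F'"
    | E1 where "E1 \<in> Poly_Mapping.keys (graft F' G :: 'd rforest \<Rightarrow>\<^sub>0 'k)" "E = F + E1"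
    by (auto simp: add.commute)
  then show ?case
  proof cases
    case 1
    then show ?thesis using union.IH(1)[OF 1(1)] by (simp add: image_Un Un_ac)
  next
    case 2
    then show ?thesis using union.IH(2)[OF 2(1)] by (simp add: image_Un Un_ac)
  qed
next
  case (B_plus d F)
  then have "E \<in> {B_plus d (F + G)} \<union> B_plus d ` Poly_Mapping.keys (graft F G :: 'd rforest \<Rightarrow>\<^sub>0 'k)"
    unfolding graft_B_plus
    by (auto dest!: subsetD[OF keys_add] subsetD[OF keys_lin_ext])
  then consider "E = B_plus d (F + G)"
    | E1 where "E1 \<in> Poly_Mapping.keys (graft F G :: 'd rforest \<Rightarrow>\<^sub>0 'k)" "E = B_plus d E1"
    by auto
  then show ?case
  proof cases
    case 1
    then show ?thesis by (simp add: B_plus_def[of _ "_ + _"]) (simp add: B_plus_def rforest_nodes_def image_Un)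
  next
    case 2
    then show ?thesis using B_plus.IH[OF 2(1)] by simp (simp add: B_plus_def)
  qed
qed simp

section \<open>Coproduct of rooted forests: grading, counit, coassociativity, grafting\<close>

lemma ck_coprod_zero [simp]: "ck_coprod {#} = 1"
  by (simp add: ck_coprod_def)

lemma keys_ck_coprod:
  assumes "t \<in> Poly_Mapping.keys (ck_coprod F :: 'd rforest \<times> 'd rforest \<Rightarrow>\<^sub>0 'k::field)"
  shows "rforest_nodes (fst t) + rforest_nodes (snd t) = rforest_nodes F \<and>
    (\<Union>s\<in>set_mset (fst t) \<union> set_mset (snd t). set_rtree s) = (\<Union>s\<in>set_mset F. set_rtree s)"
  using assms
proof (induction F arbitrary: t rule: rforest_induct)
  case empty
  then show ?case by simp
next
  case (union F F')
  then obtain u u' where u: "u \<in> Poly_Mapping.keys (ck_coprod F :: 'd rforest \<times> 'd rforest \<Rightarrow>\<^sub>0 'k)"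
    "u' \<in> Poly_Mapping.keys (ck_coprod F' :: 'd rforest \<times> 'd rforest \<Rightarrow>\<^sub>0 'k)" "t = u + u'"
    using subsetD[OF keys_mult, of t "ck_coprod F :: _ \<Rightarrow>\<^sub>0 'k" "ck_coprod F'"] unfolding ck_coprod_union by blast
  have "(\<Union>s\<in>set_mset (fst t) \<union> set_mset (snd t). set_rtree s) =
    (\<Union>s\<in>set_mset (fst u) \<union> set_mset (snd u). set_rtree s) \<union> (\<Union>s\<in>set_mset (fst u') \<union> set_mset (snd u'). set_rtree s)"
    using u(3) by auto
  then show ?case using union.IH(1)[OF u(1)] union.IH(2)[OF u(2)] u(3) by simp
next
  case (B_plus d F)
  then have "t \<in> {({#}, B_plus d F)} \<union>
      (\<lambda>u. (B_plus d (fst u), snd u)) ` Poly_Mapping.keys (ck_coprod F :: 'd rforest \<times> 'd rforest \<Rightarrow>\<^sub>0 'k)"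
    unfolding ck_coprod_B_plus case_prod_unfold
    by (auto dest!: subsetD[OF keys_add] subsetD[OF keys_lin_ext] intro: rev_image_eqI)
  then consider "t = ({#}, B_plus d F)"
    | u where "u \<in> Poly_Mapping.keys (ck_coprod F :: 'd rforest \<times> 'd rforest \<Rightarrow>\<^sub>0 'k)" "t = (B_plus d (fst u), snd u)"
    by auto
  then show ?case
  proof cases
    case 2
    then show ?thesis using B_plus.IH[OF 2(1)] by simp (auto simp: B_plus_def)
  qed simp
qed

text \<open>The map is multiplicative, and in the coproduct of \<open>B_plus d F\<close> only the
  first summand has an empty left leg.\<close>

lemma ck_counit_left: "lin_ext (\<lambda>(y, z). if y = {#} then Poly_Mapping.single z 1 else 0) (ck_coprod F) = Poly_Mapping.single F 1"
  (is "?e (ck_coprod F) = _")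
proof (induction F rule: rforest_induct)
  case empty
  then show ?case by (simp add: zero_prod_def flip: zero_multiset_def)
next
  case (union F G)
  have "?e (p * q) = ?e p * ?e q" for p q
    by (rule lin_ext_mult) (auto simp: mult_single)
  then show ?case by (simp only: ck_coprod_union union mult_single mult_1)
next
  case (B_plus d F)
  then show ?case by (simp add: ck_coprod_B_plus lin_lin_ext_comp[OF lin_lin_ext] case_prod_unfold)
qed

text \<open>The counit acts on the right leg and \<open>B_plus\<close> on the left one, so they
  commute and the induction hypothesis applies; the first summand of the coproduct of
  \<open>B_plus d F\<close> drops out.\<close>

lemma ck_counit_right: "lin_ext (\<lambda>(y, z). if z = {#} then Poly_Mapping.single y 1 else 0) (ck_coprod F) = Poly_Mapping.single F (1::'k::field)"
  (is "?e (ck_coprod F) = _")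
proof (induction F rule: rforest_induct)
  case empty
  then show ?case by (simp add: zero_prod_def flip: zero_multiset_def)
next
  case (union F G)
  have "?e (p * q) = ?e p * ?e q" for p q
    by (rule lin_ext_mult) (auto simp: mult_single)
  then show ?case by (simp only: ck_coprod_union union mult_single mult_1)
next
  case (B_plus d F)
  have "lin_ext (\<lambda>t. if snd t = {#} then Poly_Mapping.single (B_plus d (fst t)) (1::'k) else 0) (ck_coprod F) =
    lin_ext (\<lambda>G. Poly_Mapping.single (B_plus d G) 1)
      (lin_ext (\<lambda>(y, z). if z = {#} then Poly_Mapping.single y 1 else 0) (ck_coprod F))"
    by (simp add: lin_lin_ext_comp[OF lin_lin_ext] case_prod_unfold if_distrib cong: if_cong)
  also have "\<dots> = Poly_Mapping.single (B_plus d F) 1" by (simp add: B_plus)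
  finally show ?case
    by (simp add: ck_coprod_B_plus lin_lin_ext_comp[OF lin_lin_ext] case_prod_unfold cong: if_cong)
qed

text \<open>Both iterated coproducts are multiplicative and obey the same recursion on
  \<open>B_plus d F\<close>, in which \<open>B_plus\<close> acts on the first of the three
  legs.\<close>

lemma ck_coassoc:
  "lin_ext (\<lambda>(y, z). lin_ext (\<lambda>(a, b). Poly_Mapping.single (a, b, z) 1) (ck_coprod y)) (ck_coprod F) =
   lin_ext (\<lambda>(y, z). lin_ext (\<lambda>(a, b). Poly_Mapping.single (y, a, b) 1) (ck_coprod z)) (ck_coprod F :: _ \<Rightarrow>\<^sub>0 'k::field)"
  (is "?T1 (ck_coprod F) = ?T2 (ck_coprod F)")
proof (induction F rule: rforest_induct)
  case empty
  then show ?case by (simp add: zero_prod_def flip: zero_multiset_def)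
next
  case (union F G)
  have "?T1 (p * q) = ?T1 p * ?T1 q" for p q :: "_ \<Rightarrow>\<^sub>0 'k"
    by (rule lin_ext_mult, clarsimp simp: ck_coprod_union, rule lin_ext_mult) (auto simp: mult_single)
  moreover have "?T2 (p * q) = ?T2 p * ?T2 q" for p q :: "_ \<Rightarrow>\<^sub>0 'k"
    by (rule lin_ext_mult, clarsimp simp: ck_coprod_union, rule lin_ext_mult) (auto simp: mult_single)
  ultimately show ?case by (simp only: ck_coprod_union union)
next
  case (B_plus d F)
  let ?b = "lin_ext (\<lambda>t. Poly_Mapping.single (B_plus d (fst t), snd t) (1::'k))"
  have "?T1 (ck_coprod (B_plus d F)) = Poly_Mapping.single ({#}, {#}, B_plus d F) 1 +
      lin_ext (\<lambda>t. Poly_Mapping.single ({#}, B_plus d (fst t), snd t) 1) (ck_coprod F) + ?b (?T1 (ck_coprod F))"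
    by (simp add: ck_coprod_B_plus lin_lin_ext_comp[OF lin_lin_ext] case_prod_unfold lin_ext_fun_add zero_prod_def
        flip: zero_multiset_def)
  moreover have "?T2 (ck_coprod (B_plus d F)) = Poly_Mapping.single ({#}, {#}, B_plus d F) 1 +
      lin_ext (\<lambda>t. Poly_Mapping.single ({#}, B_plus d (fst t), snd t) 1) (ck_coprod F) + ?b (?T2 (ck_coprod F))"
    by (simp add: ck_coprod_B_plus lin_lin_ext_comp[OF lin_lin_ext] case_prod_unfold lin_ext_fun_add)
  ultimately show ?case by (simp only: B_plus)
qed

text \<open>The summand \<open>f\<close> of the right side obeys a Leibniz rule in its pair of
  forests, and the coproduct is multiplicative, so both sides follow the same rule on unions. On
  \<open>B_plus\<close> both reduce by the cocycle property, with an extra term for grafting onto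
  the new root.\<close>

lemma ck_coprod_graft:
  "lin_ext ck_coprod (graft F G) =
     lin_ext (\<lambda>(a, b). tensor (Poly_Mapping.single a 1) (graft b G)) (ck_coprod F) +
     lin_ext (\<lambda>(a, b). lin_ext (\<lambda>(c, d). tensor (graft a c) (Poly_Mapping.single (b + d) 1)) (ck_coprod G))
       (ck_coprod F :: _ \<Rightarrow>\<^sub>0 'k::field)"
proof -
  let ?s = "\<lambda>x. Poly_Mapping.single x (1::'k)"
  define f where "f t = tensor (?s (fst t)) (graft (snd t) G) +
    lin_ext (\<lambda>(c, d). tensor (graft (fst t) c) (?s (snd t + d))) (ck_coprod G)" for t
  have f_zero: "f ({#}, b) = tensor 1 (graft b G)" for b
    by (simp add: f_def lin_zero[OF lin_tensor_left] case_prod_unfold flip: single_one zero_multiset_def)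
  have f_add: "f (t + u) = f t * ?s u + ?s t * f u" for t u
  proof -
    obtain a b a' b' where tu: "t = (a, b)" "u = (a', b')" by (cases t, cases u)
    have g: "tensor p q * ?s u = tensor (p * ?s a') (q * ?s b')" "?s t * tensor p q = tensor (?s a * p) (?s b * q)" for p q
      using tensor_mult[of p q "?s a'" "?s b'"] tensor_mult[of "?s a" "?s b" p q] by (simp_all add: tu)
    have "lin_ext (\<lambda>(c, d). tensor (graft (a + a') c) (?s (b + b' + d))) (ck_coprod G) =
        lin_ext (\<lambda>(c, d). tensor (graft a c) (?s (b + d)) * ?s u + ?s t * tensor (graft a' c) (?s (b' + d))) (ck_coprod G)"
      by (simp add: graft_union lin_add[OF lin_tensor_left] g mult_single) (simp add: ac_simps)
    also have "\<dots> = lin_ext (\<lambda>(c, d). tensor (graft a c) (?s (b + d))) (ck_coprod G) * ?s u +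
        ?s t * lin_ext (\<lambda>(c, d). tensor (graft a' c) (?s (b' + d))) (ck_coprod G)"
      by (simp add: case_prod_unfold lin_ext_fun_add lin_lin_ext_comp[OF lin_times_left] lin_lin_ext_comp[OF lin_times_right])
    finally have 1: "lin_ext (\<lambda>(c, d). tensor (graft (a + a') c) (?s (b + b' + d))) (ck_coprod G) = \<dots>" .
    have 2: "tensor (?s (a + a')) (graft (b + b') G) = tensor (?s a) (graft b G) * ?s u + ?s t * tensor (?s a') (graft b' G)"
      by (simp add: graft_union lin_add[OF lin_tensor_right] g mult_single)
    show ?thesis using 1 2 by (simp add: f_def tu algebra_simps)
  qed
  have "lin_ext ck_coprod (graft F G) = lin_ext f (ck_coprod F)"
  proof (induction F rule: rforest_induct)
    case empty
    then show ?case by (simp add: f_zero lin_zero[OF lin_tensor_right] zero_prod_def flip: zero_multiset_def)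
  next
    case (union F F')
    have m: "lin_ext ck_coprod (p * q) = lin_ext ck_coprod p * lin_ext ck_coprod q" for p q :: "_ \<Rightarrow>\<^sub>0 'k"
      by (rule lin_ext_mult) (rule ck_coprod_union)
    show ?case by (simp add: graft_union m union ck_coprod_union lin_ext_derivation[of f, OF f_add])
  next
    case (B_plus d F)
    let ?B = "lin_ext (\<lambda>E. ?s (B_plus d E))"
    let ?B1 = "lin_ext (\<lambda>t. ?s (B_plus d (fst t), snd t))"
    have B1_tensor: "?B1 (tensor p q) = tensor (?B p) q" for p q
      using tensor_map_tensor[OF lin_lin_ext lin_id, of "\<lambda>E. ?s (B_plus d E)" p q]
      by (simp add: tensor_map_def case_prod_unfold)
    have D_B: "lin_ext ck_coprod (?B p) = tensor 1 (?B p) + ?B1 (lin_ext ck_coprod p)" for p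
    proof (rule lin_eqI[of "\<lambda>p. lin_ext ck_coprod (?B p)"])
      show "lin (\<lambda>p. lin_ext ck_coprod (?B p))" by (rule lin_compose[OF lin_lin_ext lin_lin_ext])
      show "lin (\<lambda>p. tensor 1 (?B p) + ?B1 (lin_ext ck_coprod p))"
        by (rule lin_plus[OF lin_compose[OF lin_lin_ext lin_tensor_right] lin_compose[OF lin_lin_ext lin_lin_ext]])
    qed (simp add: ck_coprod_B_plus case_prod_unfold flip: single_one zero_multiset_def)
    \<comment> \<open>The second term belongs to the new root: the part c of \<open>G\<close> joins
      the forest below it, the part d joins the right leg. Summed over the coproduct of
      \<open>F\<close> it yields the coproduct of \<open>F + G\<close>.\<close>
    have f_B: "f (B_plus d a, b) = ?B1 (f (a, b)) + ?B1 (?s (a, b) * ck_coprod G)" for a b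
    proof -
      have "?s (a, b) * ck_coprod G = lin_ext (\<lambda>(c, d). ?s (a + c, b + d)) (ck_coprod G)"
        by (subst lin_ext_basis[of "ck_coprod G", symmetric])
          (simp add: lin_lin_ext_comp[OF lin_times_right] mult_single plus_prod_def case_prod_unfold del: single_one)
      then have "?B1 (?s (a, b) * ck_coprod G) = lin_ext (\<lambda>(c, e). ?s (B_plus d (a + c), b + e)) (ck_coprod G)"
        by (simp add: lin_lin_ext_comp[OF lin_lin_ext] case_prod_unfold)
      then show ?thesis
        by (simp add: f_def graft_B_plus B1_tensor lin_add[OF lin_tensor_left] lin_lin_ext_comp[OF lin_lin_ext[of "\<lambda>t. ?s (B_plus d (fst t), snd t)"]]
            lin_ext_fun_add case_prod_unfold)
    qed
    have "lin_ext f (ck_coprod (B_plus d F)) = f ({#}, B_plus d F) + lin_ext (\<lambda>(a, b). f (B_plus d a, b)) (ck_coprod F)"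
      by (simp add: ck_coprod_B_plus lin_lin_ext_comp[OF lin_lin_ext] case_prod_unfold)
    also have "lin_ext (\<lambda>(a, b). f (B_plus d a, b)) (ck_coprod F) =
        lin_ext (\<lambda>t. ?B1 (f t)) (ck_coprod F) + lin_ext (\<lambda>t. ?B1 (?s t * ck_coprod G)) (ck_coprod F)"
      by (simp only: f_B lin_ext_fun_add case_prod_unfold prod.collapse)
    also have "lin_ext (\<lambda>t. ?B1 (f t)) (ck_coprod F) = ?B1 (lin_ext f (ck_coprod F))"
      by (simp only: lin_lin_ext_comp[OF lin_lin_ext])
    also have "lin_ext (\<lambda>t. ?B1 (?s t * ck_coprod G)) (ck_coprod F) = ?B1 (ck_coprod F * ck_coprod G)"
      by (rule lin_expand[OF lin_compose[OF lin_times_left lin_lin_ext], symmetric])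
    finally show ?case
      by (simp add: graft_B_plus D_B f_zero B_plus ck_coprod_B_plus[of d "F + G"] ck_coprod_union lin_add[OF lin_tensor_right]
          case_prod_unfold flip: single_one zero_multiset_def)
  qed
  then show ?thesis by (simp add: f_def[abs_def] lin_ext_fun_add case_prod_unfold)
qed

section \<open>The Connes-Kreimer algebra as an instance\<close>

lemma grafting_bialgebra_CK:
  "grafting_bialgebra (ck_coprod :: _ \<Rightarrow> _ \<Rightarrow>\<^sub>0 'k::field_char_0) rforest_nodes graft {F. \<forall>t\<in>#F. set_rtree t \<subseteq> D}"
proof
  let ?D = "ck_coprod :: _ \<Rightarrow> _ \<Rightarrow>\<^sub>0 'k"
  show "Poly_Mapping.lookup (?D x) (0, z) = (if z = x then 1 else 0)" for x z
  proof -
    have "lin_ext (\<lambda>(y, z). if y = 0 then Poly_Mapping.single z 1 else 0) (?D x) = Poly_Mapping.single x 1"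
      using ck_counit_left[of x] by simp
    then show ?thesis
      using lookup_counit_left[of "?D x" z] by (auto simp: lookup_single when_def)
  qed
  show "Poly_Mapping.lookup (?D x) (z, 0) = (if z = x then 1 else 0)" for x z
  proof -
    have "lin_ext (\<lambda>(y, z). if z = 0 then Poly_Mapping.single y 1 else 0) (?D x) = Poly_Mapping.single x 1"
      using ck_counit_right[of x] by simp
    then show ?thesis
      using lookup_counit_right[of "?D x" z] by (auto simp: lookup_single when_def)
  qed
  show "rforest_nodes y + rforest_nodes z = rforest_nodes x" if "(y, z) \<in> Poly_Mapping.keys (?D x)" for x y z
    using keys_ck_coprod[OF that] by simp
  show "rforest_nodes z = rforest_nodes x + rforest_nodes y" if "z \<in> Poly_Mapping.keys (graft x y :: _ \<Rightarrow>\<^sub>0 'k)" for x y z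
    using keys_graft[OF that] by blast
  have S: "{F. \<forall>t\<in>#F. set_rtree t \<subseteq> D} = {F. (\<Union>t\<in>set_mset F. set_rtree t) \<subseteq> D}"
    by (simp only: UN_subset_iff)
  show "y \<in> {F. \<forall>t\<in>#F. set_rtree t \<subseteq> D} \<and> z \<in> {F. \<forall>t\<in>#F. set_rtree t \<subseteq> D}"
    if "x \<in> {F. \<forall>t\<in>#F. set_rtree t \<subseteq> D}" "(y, z) \<in> Poly_Mapping.keys (?D x)" for x y z
    using keys_ck_coprod[OF that(2)] that(1) unfolding S
    by (simp only: fst_conv snd_conv UN_Un Un_subset_iff mem_Collect_eq flip: conjunct2[OF keys_ck_coprod[OF that(2)]])
  show "z \<in> {F. \<forall>t\<in>#F. set_rtree t \<subseteq> D}"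
    if "x \<in> {F. \<forall>t\<in>#F. set_rtree t \<subseteq> D}" "y \<in> {F. \<forall>t\<in>#F. set_rtree t \<subseteq> D}"
      "z \<in> Poly_Mapping.keys (graft x y :: _ \<Rightarrow>\<^sub>0 'k)" for x y z
    using that(1,2) unfolding S
    by (simp only: UN_Un Un_subset_iff mem_Collect_eq conjunct2[OF keys_graft[OF that(3)]])
  show "graft x 0 = Poly_Mapping.single x (of_nat (rforest_nodes x) :: 'k)" for x :: "'a rforest"
    using graft_empty_right[of x] by simp
  show "(graft 0 y :: _ \<Rightarrow>\<^sub>0 'k) = 0" for y :: "'a rforest"
    by simp
qed (simp_all add: rforest_nodes_eq_0_iff ck_coprod_union ck_coassoc ck_coprod_graft)

lemma CK_hopf_isomorphic:
  "\<exists>W :: ('d rforest \<Rightarrow>\<^sub>0 'k::field_char_0) set. module.subspace pm_scale W \<and>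
     hopf_isomorphic (CK_algebra D :: ('d rforest, 'k) bialg) (shuffle_algebra W)"
proof -
  interpret grafting_bialgebra "ck_coprod :: 'd rforest \<Rightarrow> _ \<Rightarrow>\<^sub>0 'k" rforest_nodes graft "{F. \<forall>t\<in>#F. set_rtree t \<subseteq> D}"
    by (rule grafting_bialgebra_CK)
  have "hopf_isomorphic (CK_algebra D :: ('d rforest, 'k) bialg) (shuffle_algebra prim)"
    by (rule hopf_isomorphic_shuffle_algebra) (auto simp: CK_algebra_def simp flip: zero_multiset_def)
  with subspace_prim show ?thesis by blast
qed

section \<open>Partitioned trees carried by subsets of a forest\<close>

text \<open>The partition as a relation: restriction acts on it pointwise, while blocks as sets are
  cut and may become empty.\<close>

definition same_block :: "('v, 'd) pforest \<Rightarrow> 'v \<Rightarrow> 'v \<Rightarrow> bool" where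
  "same_block F u v \<longleftrightarrow> (\<exists>B\<in>blocks F. u \<in> B \<and> v \<in> B)"

lemma partitioned_forestD:
  assumes "partitioned_forest F"
  shows "finite (verts F)" "edges F \<subseteq> verts F \<times> verts F" "acyclic (edges F)"
    "partition_on (verts F) (blocks F)"
  using assms unfolding partitioned_forest_def by blast+

lemma partitioned_forest_edgeD:
  "partitioned_forest F \<Longrightarrow> (u, v) \<in> edges F \<Longrightarrow> u \<in> verts F \<and> v \<in> verts F"
  using partitioned_forestD(2) by blast

lemma same_blockD: "partitioned_forest F \<Longrightarrow> same_block F u v \<Longrightarrow> u \<in> verts F \<and> v \<in> verts F"
  unfolding same_block_def using pforest_iso_by_blocks_sub(1) by blast

lemma same_block_restrict [simp]:
  "same_block (restrict_pforest F U) u v \<longleftrightarrow> same_block F u v \<and> u \<in> U \<and> v \<in> U"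
  unfolding same_block_def restrict_pforest_def by auto

lemma same_block_merge_roots:
  assumes "partitioned_forest F"
  shows "same_block (merge_roots F) u v \<longleftrightarrow> (u \<in> roots F \<and> v \<in> roots F) \<or> same_block F u v"
proof -
  have "same_block (merge_roots F) u v \<longleftrightarrow>
      (u \<in> roots F \<and> v \<in> roots F) \<or> (\<exists>B\<in>blocks F. \<not> B \<subseteq> roots F \<and> u \<in> B \<and> v \<in> B)"
    by (auto simp: same_block_def merge_roots_def)
  then show ?thesis unfolding same_block_def by blast
qed

lemma restrict_pforest_simps [simp]:
  "verts (restrict_pforest F U) = verts F \<inter> U" "edges (restrict_pforest F U) = edges F \<inter> U \<times> U"
  "deco (restrict_pforest F U) = deco F"
  by (simp_all add: restrict_pforest_def)

text \<open>The way back from the relation to an equality between sets of blocks.\<close>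

lemma partition_image_eq:
  assumes P: "partition_on A P" and Q: "partition_on A' Q" and f: "bij_betw f A A'"
    and s: "\<And>u v. u \<in> A \<Longrightarrow> v \<in> A \<Longrightarrow> (\<exists>B\<in>P. u \<in> B \<and> v \<in> B) \<longleftrightarrow> (\<exists>B\<in>Q. f u \<in> B \<and> f v \<in> B)"
  shows "(`) f ` P = Q"
proof -
  have uP: "\<Union>P = A" "{} \<notin> P" and uQ: "\<Union>Q = A'" "{} \<notin> Q"
    using P Q by (auto simp: partition_on_def)
  have dP: "\<And>X Y x. X \<in> P \<Longrightarrow> Y \<in> P \<Longrightarrow> x \<in> X \<Longrightarrow> x \<in> Y \<Longrightarrow> X = Y"
    using disjointD[OF partition_onD2[OF P]] by blast
  have dQ: "\<And>X Y x. X \<in> Q \<Longrightarrow> Y \<in> Q \<Longrightarrow> x \<in> X \<Longrightarrow> x \<in> Y \<Longrightarrow> X = Y"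
    using disjointD[OF partition_onD2[OF Q]] by blast
  have im: "f ` A = A'" using f by (simp add: bij_betw_def)
  have sub: "f ` B \<in> Q" if B: "B \<in> P" for B
  proof -
    obtain u where u: "u \<in> B" using B uP by (metis ex_in_conv)
    have BA: "B \<subseteq> A" using B uP by blast
    obtain B' where B': "B' \<in> Q" "f u \<in> B'" using u BA im uQ by blast
    have "f ` B = B'"
    proof (intro equalityI subsetI)
      fix x assume "x \<in> f ` B"
      then obtain v where v: "v \<in> B" "x = f v" by blast
      then obtain C where "C \<in> Q" "f u \<in> C" "f v \<in> C" using s[of u v] u B BA by blast
      then show "x \<in> B'" using dQ[OF _ B'(1) _ B'(2)] v by blast
    next
      fix x assume x: "x \<in> B'"
      then obtain v where v: "v \<in> A" "x = f v" using B' uQ im by blast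
      then obtain C where "C \<in> P" "u \<in> C" "v \<in> C" using s[of u v] u BA x B' by blast
      then show "x \<in> f ` B" using dP[OF _ B _ u] v by blast
    qed
    then show ?thesis using B' by simp
  qed
  have "B' \<in> (`) f ` P" if B': "B' \<in> Q" for B'
  proof -
    obtain x where x: "x \<in> B'" using B' uQ by (metis ex_in_conv)
    then obtain u where u: "u \<in> A" "x = f u" using B' uQ im by blast
    then obtain B where B: "B \<in> P" "u \<in> B" using uP by blast
    have "f ` B = B'" by (rule dQ[OF sub[OF B(1)] B', of x]) (use B u x in auto)
    then show ?thesis using B by blast
  qed
  with sub show ?thesis by blast
qed

lemma partitioned_tree_same_block:
  assumes "partitioned_tree F" "u \<in> roots F" "v \<in> roots F"
  shows "same_block F u v"
  using assms unfolding partitioned_tree_def same_block_def by (auto simp: roots_def)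

lemma same_block_cases:
  assumes "partitioned_forest F" "same_block F u v"
  obtains "u \<in> roots F" "v \<in> roots F" | w where "(w, u) \<in> edges F" "(w, v) \<in> edges F"
  using assms unfolding partitioned_forest_def same_block_def by metis

text \<open>
  In a partitioned tree the roots form one block, so an isomorphism only has to respect the blocks
  of siblings.
\<close>

lemma pforest_iso_byI:
  assumes F: "partitioned_tree F" and G: "partitioned_tree G" and f: "bij_betw f (verts F) (verts G)"
    and e: "\<And>u v. u \<in> verts F \<Longrightarrow> v \<in> verts F \<Longrightarrow> (u, v) \<in> edges F \<longleftrightarrow> (f u, f v) \<in> edges G"
    and d: "\<And>v. v \<in> verts F \<Longrightarrow> deco G (f v) = deco F v"
    and s: "\<And>w u v. (w, u) \<in> edges F \<Longrightarrow> (w, v) \<in> edges F \<Longrightarrow> same_block F u v \<longleftrightarrow> same_block G (f u) (f v)"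
  shows "pforest_iso_by f F G"
proof -
  have pF: "partitioned_forest F" and pG: "partitioned_forest G"
    using F G by (simp_all add: partitioned_tree_def)
  have im: "f ` verts F = verts G" using f by (simp add: bij_betw_def)
  have r: "f u \<in> roots G \<longleftrightarrow> u \<in> roots F" if u: "u \<in> verts F" for u
  proof -
    have "(\<exists>w. (w, f u) \<in> edges G) \<longleftrightarrow> (\<exists>w. (w, u) \<in> edges F)"
    proof
      assume "\<exists>w. (w, f u) \<in> edges G"
      then obtain w where w: "(w, f u) \<in> edges G" by blast
      then obtain x where "x \<in> verts F" "w = f x" using partitioned_forest_edgeD[OF pG] im by blast
      then show "\<exists>w. (w, u) \<in> edges F" using e[of x u] u w by blast
    next
      assume "\<exists>w. (w, u) \<in> edges F"
      then obtain w where "(w, u) \<in> edges F" by blast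
      then show "\<exists>w. (w, f u) \<in> edges G" using e[of w u] u partitioned_forest_edgeD[OF pF] by blast
    qed
    then show ?thesis using u im by (auto simp: roots_def)
  qed
  have "same_block F u v \<longleftrightarrow> same_block G (f u) (f v)" if uv: "u \<in> verts F" "v \<in> verts F" for u v
  proof
    assume b: "same_block F u v"
    from pF b show "same_block G (f u) (f v)"
    proof (cases rule: same_block_cases)
      case 1
      then show ?thesis using partitioned_tree_same_block[OF G] r[OF uv(1)] r[OF uv(2)] by simp
    next
      case (2 w)
      then show ?thesis using s[of w u v] b by simp
    qed
  next
    assume b: "same_block G (f u) (f v)"
    from pG b show "same_block F u v"
    proof (cases rule: same_block_cases)
      case 1
      then show ?thesis using partitioned_tree_same_block[OF F] r[OF uv(1)] r[OF uv(2)] by simp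
    next
      case (2 w)
      then obtain x where "x \<in> verts F" "w = f x" using partitioned_forest_edgeD[OF pG] im by blast
      then have "(x, u) \<in> edges F" "(x, v) \<in> edges F" using e uv 2 by auto
      then show ?thesis using s[of x u v] b by simp
    qed
  qed
  then have "(`) f ` blocks F = blocks G"
    unfolding same_block_def
    by (intro partition_image_eq[OF partitioned_forestD(4)[OF pF] partitioned_forestD(4)[OF pG] f])
  then show ?thesis unfolding pforest_iso_by_def using f e d by blast
qed

lemma abs_ptree_eqI:
  assumes "partitioned_tree F" "partitioned_tree G" "pforest_iso_by f F G"
  shows "abs_ptree F = abs_ptree G"
  by (rule Quotient_rel_abs[OF Quotient_ptree]) (use assms in \<open>auto simp: ptree_rel_def pforest_iso_def\<close>)

lemma abs_ptree_eqD:
  assumes "partitioned_tree F" "partitioned_tree G" "abs_ptree F = abs_ptree G"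
  obtains f where "pforest_iso_by f F G"
proof -
  have "ptree_rel F F" "ptree_rel G G"
    using assms by (auto simp: ptree_rel_def intro: pforest_iso_refl)
  then have "ptree_rel F G" using Quotient_rel[OF Quotient_ptree, of F G] assms(3) by blast
  then show ?thesis using that by (auto simp: ptree_rel_def pforest_iso_def)
qed

text \<open>
  For an ideal \<open>I\<close> of a partitioned tree \<open>T\<close>, both \<open>P\<^sup>I(T)\<close> and \<open>R\<^sup>I(T)\<close> have this form, since the
  roots of \<open>R\<^sup>I(T)\<close> already lie in one block.
\<close>

definition ptree_of :: "(nat, 'd) pforest \<Rightarrow> nat set \<Rightarrow> 'd ptree" where
  "ptree_of H U = abs_ptree (merge_roots (restrict_pforest H U))"

lemma partitioned_tree_merge_restrict:
  "partitioned_forest H \<Longrightarrow> partitioned_tree (merge_roots (restrict_pforest H U))"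
  by (intro partitioned_tree_merge_roots partitioned_forest_restrict)

lemma merge_restrict_simps [simp]:
  "verts (merge_roots (restrict_pforest H U)) = verts H \<inter> U"
  "edges (merge_roots (restrict_pforest H U)) = edges H \<inter> U \<times> U"
  "deco (merge_roots (restrict_pforest H U)) = deco H"
  by (simp_all add: merge_roots_def restrict_pforest_def)

lemma same_block_merge_restrict:
  assumes "partitioned_forest H" "(w, u) \<in> edges H" "w \<in> U" "u \<in> U" "v \<in> U"
  shows "same_block (merge_roots (restrict_pforest H U)) u v \<longleftrightarrow> same_block H u v"
proof -
  have "u \<notin> roots (restrict_pforest H U)"
    using assms by (auto simp: roots_def restrict_pforest_def)
  then show ?thesis
    using assms by (simp add: same_block_merge_roots[OF partitioned_forest_restrict[OF assms(1)]])
qed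

text \<open>A vertex of \<open>U\<close> whose parent lies outside \<open>U\<close> becomes a root,
  and all roots are merged into one block anyway. So blocks only have to be compared for siblings
  whose common parent is also in \<open>U\<close>.\<close>

lemma ptree_of_eqI:
  assumes H: "partitioned_forest H" and H': "partitioned_forest H'"
    and U: "U \<subseteq> verts H" and U': "U' \<subseteq> verts H'" and f: "bij_betw f U U'"
    and e: "\<And>u v. u \<in> U \<Longrightarrow> v \<in> U \<Longrightarrow> (u, v) \<in> edges H \<longleftrightarrow> (f u, f v) \<in> edges H'"
    and d: "\<And>v. v \<in> U \<Longrightarrow> deco H' (f v) = deco H v"
    and s: "\<And>w u v. w \<in> U \<Longrightarrow> u \<in> U \<Longrightarrow> v \<in> U \<Longrightarrow> (w, u) \<in> edges H \<Longrightarrow> (w, v) \<in> edges H \<Longrightarrow>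
       same_block H u v \<longleftrightarrow> same_block H' (f u) (f v)"
  shows "ptree_of H U = ptree_of H' U'"
proof -
  have fU: "f u \<in> U'" if "u \<in> U" for u using f that by (auto simp: bij_betw_def)
  show ?thesis
    unfolding ptree_of_def
  proof (rule abs_ptree_eqI[OF partitioned_tree_merge_restrict[OF H] partitioned_tree_merge_restrict[OF H']
        pforest_iso_byI[OF partitioned_tree_merge_restrict[OF H] partitioned_tree_merge_restrict[OF H']]])
    show "bij_betw f (verts (merge_roots (restrict_pforest H U))) (verts (merge_roots (restrict_pforest H' U')))"
      using f U U' by (simp add: Int_absorb1)
    fix u v w
    assume "(w, u) \<in> edges (merge_roots (restrict_pforest H U))" "(w, v) \<in> edges (merge_roots (restrict_pforest H U))"
    then have a: "w \<in> U" "u \<in> U" "v \<in> U" "(w, u) \<in> edges H" "(w, v) \<in> edges H" by auto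
    then have "(f w, f u) \<in> edges H'" using e by blast
    then show "same_block (merge_roots (restrict_pforest H U)) u v \<longleftrightarrow>
      same_block (merge_roots (restrict_pforest H' U')) (f u) (f v)"
      using a s[OF a] fU same_block_merge_restrict[OF H, of w u U v]
        same_block_merge_restrict[OF H', of "f w" "f u" U' "f v"] by blast
  qed (use e d fU in auto)
qed

lemma ptree_of_eqD:
  assumes H: "partitioned_forest H" and H': "partitioned_forest H'"
    and U: "U \<subseteq> verts H" and U': "U' \<subseteq> verts H'" and eq: "ptree_of H U = ptree_of H' U'"
  obtains f where "bij_betw f U U'"
    "\<forall>u\<in>U. \<forall>v\<in>U. (u, v) \<in> edges H \<longleftrightarrow> (f u, f v) \<in> edges H'"
    "\<forall>v\<in>U. deco H' (f v) = deco H v"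
    "\<forall>w\<in>U. \<forall>u\<in>U. \<forall>v\<in>U. (w, u) \<in> edges H \<longrightarrow> (w, v) \<in> edges H \<longrightarrow>
       (same_block H u v \<longleftrightarrow> same_block H' (f u) (f v))"
proof -
  let ?F = "merge_roots (restrict_pforest H U)" and ?G = "merge_roots (restrict_pforest H' U')"
  obtain f where f: "pforest_iso_by f ?F ?G"
    using abs_ptree_eqD[OF partitioned_tree_merge_restrict[OF H] partitioned_tree_merge_restrict[OF H']]
      eq unfolding ptree_of_def by blast
  have b: "bij_betw f U U'"
    using f U U' by (simp add: pforest_iso_by_def Int_absorb1)
  have fU: "f u \<in> U'" if "u \<in> U" for u using b that by (auto simp: bij_betw_def)
  have e: "(u, v) \<in> edges H \<longleftrightarrow> (f u, f v) \<in> edges H'" if "u \<in> U" "v \<in> U" for u v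
  proof -
    have "u \<in> verts ?F" "v \<in> verts ?F" using that U by auto
    then have "(u, v) \<in> edges ?F \<longleftrightarrow> (f u, f v) \<in> edges ?G"
      using f unfolding pforest_iso_by_def by blast
    then show ?thesis using that fU by simp
  qed
  have d: "deco H' (f v) = deco H v" if "v \<in> U" for v
    using f U that by (auto simp: pforest_iso_by_def)
  have bl: "blocks ?G = (`) f ` blocks ?F" using f by (simp add: pforest_iso_by_def)
  have sub: "B \<subseteq> U" if "B \<in> blocks ?F" for B
  proof -
    have "partitioned_forest ?F"
      using partitioned_tree_merge_restrict[OF H] by (simp add: partitioned_tree_def)
    from pforest_iso_by_blocks_sub(1)[OF this that] show ?thesis by simp
  qed
  have sb: "same_block H u v \<longleftrightarrow> same_block H' (f u) (f v)"
    if a: "w \<in> U" "u \<in> U" "v \<in> U" "(w, u) \<in> edges H" "(w, v) \<in> edges H" for w u v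
  proof -
    have "(f w, f u) \<in> edges H'" using e a by blast
    moreover have "same_block ?F u v \<longleftrightarrow> same_block ?G (f u) (f v)"
    proof -
      have "f x \<in> f ` B \<longleftrightarrow> x \<in> B" if "x \<in> U" "B \<in> blocks ?F" for x B
        using inj_on_image_mem_iff[OF _ that(1) sub[OF that(2)], of f] b by (auto simp: bij_betw_def)
      then show ?thesis unfolding same_block_def bl using a(2,3) by auto
    qed
    ultimately show ?thesis
      using a fU same_block_merge_restrict[OF H, of w u U v]
        same_block_merge_restrict[OF H', of "f w" "f u" U' "f v"] by blast
  qed
  show ?thesis by (rule that[OF b]) (use e d sb in blast)+
qed

lemma abs_ptree_eq_ptree_of:
  assumes "partitioned_tree F"
  shows "abs_ptree F = ptree_of F (verts F)"
  unfolding ptree_of_def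
proof (rule abs_ptree_eqI[OF assms _ pforest_iso_byI[OF assms]])
  have pF: "partitioned_forest F" using assms by (simp add: partitioned_tree_def)
  show "partitioned_tree (merge_roots (restrict_pforest F (verts F)))"
    by (rule partitioned_tree_merge_restrict[OF pF])
  then show "partitioned_tree (merge_roots (restrict_pforest F (verts F)))" .
  show "bij_betw id (verts F) (verts (merge_roots (restrict_pforest F (verts F))))" by simp
  show "(u, v) \<in> edges F \<longleftrightarrow> (id u, id v) \<in> edges (merge_roots (restrict_pforest F (verts F)))"
    if "u \<in> verts F" "v \<in> verts F" for u v using that by simp
  show "same_block F u v \<longleftrightarrow> same_block (merge_roots (restrict_pforest F (verts F))) (id u) (id v)"
    if "(w, u) \<in> edges F" "(w, v) \<in> edges F" for w u v
    using same_block_merge_restrict[OF pF that(1)] partitioned_forest_edgeD[OF pF that(1)]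
      partitioned_forest_edgeD[OF pF that(2)] by simp
qed simp

lemma ptree_of_restrict:
  assumes "partitioned_forest H" "V \<subseteq> U" "U \<subseteq> verts H"
  shows "ptree_of (restrict_pforest H U) V = ptree_of H V"
  by (rule ptree_of_eqI[where f = id])
    (use assms in \<open>auto simp: partitioned_forest_restrict\<close>)

lemma ptree_of_merge_restrict:
  assumes "partitioned_forest H" "V \<subseteq> U" "U \<subseteq> verts H"
  shows "ptree_of (merge_roots (restrict_pforest H U)) V = ptree_of H V"
proof (rule ptree_of_eqI[where f = id])
  show "partitioned_forest (merge_roots (restrict_pforest H U))"
    using partitioned_tree_merge_restrict[OF assms(1)] by (simp add: partitioned_tree_def)
  fix w u v
  assume "w \<in> V" "u \<in> V" "v \<in> V" "(w, u) \<in> edges (merge_roots (restrict_pforest H U))"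
  then show "same_block (merge_roots (restrict_pforest H U)) u v \<longleftrightarrow> same_block H (id u) (id v)"
    using same_block_merge_restrict[OF assms(1), of w u U v] assms(2) by auto
qed (use assms in auto)

lemma ptree_cases:
  obtains F where "partitioned_tree F" "T = ptree_of F (verts F)"
proof -
  have "partitioned_tree (rep_ptree T)"
    using Quotient_rep_reflp[OF Quotient_ptree, of T] by (simp add: ptree_rel_def)
  moreover have "T = ptree_of (rep_ptree T) (verts (rep_ptree T))"
    using Quotient_abs_rep[OF Quotient_ptree, of T] abs_ptree_eq_ptree_of[OF calculation] by simp
  ultimately show ?thesis by (rule that)
qed

lemma ptree_rel_merge_restrict:
  "partitioned_forest H \<Longrightarrow> ptree_rel (merge_roots (restrict_pforest H U)) (merge_roots (restrict_pforest H U))"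
  by (simp add: ptree_rel_def partitioned_tree_merge_restrict pforest_iso_refl)

subsection \<open>Size and decorations\<close>

lift_definition ptree_nodes :: "'d ptree \<Rightarrow> nat" is "\<lambda>F. card (verts F)"
  by (auto simp: ptree_rel_def pforest_iso_def pforest_iso_by_def dest: bij_betw_same_card)

lemma ptree_nodes_ptree_of: "partitioned_forest H \<Longrightarrow> U \<subseteq> verts H \<Longrightarrow> ptree_nodes (ptree_of H U) = card U"
  unfolding ptree_of_def by (simp add: ptree_nodes.abs_eq[OF ptree_rel_merge_restrict] Int_absorb1)

lemma ptree_decos_ptree_of: "partitioned_forest H \<Longrightarrow> U \<subseteq> verts H \<Longrightarrow> ptree_decos (ptree_of H U) = deco H ` U"
  unfolding ptree_of_def by (simp add: ptree_decos.abs_eq[OF ptree_rel_merge_restrict] Int_absorb1)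

lemma ptree_of_empty:
  fixes H :: "(nat, 'd) pforest"
  assumes "partitioned_forest H"
  shows "ptree_of H {} = empty_ptree"
proof -
  have "empty_ptree = ptree_of (empty_pforest :: (nat, 'd) pforest) (verts (empty_pforest :: (nat, 'd) pforest))"
    unfolding empty_ptree_def by (rule abs_ptree_eq_ptree_of[OF partitioned_tree_empty])
  also have "\<dots> = ptree_of H {}"
    by (rule ptree_of_eqI[where f = id])
      (use assms partitioned_tree_empty in \<open>auto simp: partitioned_tree_def empty_pforest_def\<close>)
  finally show ?thesis ..
qed

lemma ptree_of_eq_empty_iff:
  assumes "partitioned_forest H" "U \<subseteq> verts H"
  shows "ptree_of H U = empty_ptree \<longleftrightarrow> U = {}"
proof
  assume "ptree_of H U = empty_ptree"
  then have "card U = 0"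
    using ptree_nodes_ptree_of[OF assms] ptree_nodes_ptree_of[OF assms(1), of "{}"] ptree_of_empty[OF assms(1)]
    by simp
  moreover have "finite U" using assms partitioned_forestD(1) finite_subset by blast
  ultimately show "U = {}" by simp
qed (simp add: ptree_of_empty assms)

subsection \<open>The product\<close>

definition separated :: "('v, 'd) pforest \<Rightarrow> 'v set \<Rightarrow> 'v set \<Rightarrow> bool" where
  "separated H A B \<longleftrightarrow> A \<subseteq> verts H \<and> B \<subseteq> verts H \<and> A \<inter> B = {} \<and>
     (\<forall>a\<in>A. \<forall>b\<in>B. (a, b) \<notin> edges H \<and> (b, a) \<notin> edges H)"

lemma separated_mono: "separated H A B \<Longrightarrow> A' \<subseteq> A \<Longrightarrow> B' \<subseteq> B \<Longrightarrow> separated H A' B'"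
  by (simp add: separated_def subset_iff disjoint_iff) metis

lemma same_block_relabel:
  assumes "partitioned_forest F" "inj f"
  shows "same_block (relabel f F) (f u) (f v) \<longleftrightarrow> same_block F u v"
  using assms unfolding same_block_def relabel_def by (auto simp: inj_image_mem_iff)

lemma same_block_disjoint_union [simp]:
  "same_block (disjoint_union F G) (Inl a) (Inl b) \<longleftrightarrow> same_block F a b"
  "same_block (disjoint_union F G) (Inr c) (Inr d) \<longleftrightarrow> same_block G c d"
  by (auto simp: same_block_def disjoint_union_def)

lemma edges_disjoint_union [simp]:
  "(Inl a, Inl b) \<in> edges (disjoint_union F G) \<longleftrightarrow> (a, b) \<in> edges F"
  "(Inr c, Inr d) \<in> edges (disjoint_union F G) \<longleftrightarrow> (c, d) \<in> edges G"
  "(Inl a, Inr d) \<notin> edges (disjoint_union F G)" "(Inr c, Inl b) \<notin> edges (disjoint_union F G)"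
  by (auto simp: disjoint_union_def)

lemma edges_relabel: "inj f \<Longrightarrow> (f u, f v) \<in> edges (relabel f F) \<longleftrightarrow> (u, v) \<in> edges F"
  by (auto simp: relabel_def dest: injD)

lemma deco_relabel: "inj f \<Longrightarrow> v \<in> verts F \<Longrightarrow> deco (relabel f F) (f v) = deco F v"
  using inj_on_subset[of f UNIV "verts F"] by (simp add: relabel_def)

lemma verts_relabel: "verts (relabel f F) = f ` verts F"
  by (simp add: relabel_def)

text \<open>Both sides merge the roots at the end, and since no edge joins \<open>A\<close> and
  \<open>B\<close>, siblings together with their parent lie on one side. The product thus becomes a
  union inside one forest.\<close>

lemma ptree_prod_ptree_of:
  assumes H: "partitioned_forest H" and sep: "separated H A B"
  shows "ptree_prod (ptree_of H A) (ptree_of H B) = ptree_of H (A \<union> B)"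
proof -
  let ?F = "merge_roots (restrict_pforest H A)" and ?G = "merge_roots (restrict_pforest H B)"
  have pt: "partitioned_tree ?F" "partitioned_tree ?G" by (rule partitioned_tree_merge_restrict[OF H])+
  then have pf: "partitioned_forest ?F" "partitioned_forest ?G" by (simp_all add: partitioned_tree_def)
  let ?S = "disjoint_union ?F ?G"
  have pS: "partitioned_forest ?S" by (rule partitioned_forest_disjoint_union[OF pf])
  let ?R = "relabel sum_encode ?S"
  have pR: "partitioned_forest ?R"
    by (rule partitioned_forest_relabel'[OF pS inj_on_subset[OF inj_sum_encode subset_UNIV]])
  have AB: "A \<subseteq> verts H" "B \<subseteq> verts H" "A \<inter> B = {}"
    and no: "\<And>a b. a \<in> A \<Longrightarrow> b \<in> B \<Longrightarrow> (a, b) \<notin> edges H \<and> (b, a) \<notin> edges H"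
    using sep by (auto simp: separated_def)
  have vS: "verts ?S = A <+> B" using AB by (simp add: disjoint_union_def Int_absorb1)
  have vR: "verts ?R = sum_encode ` (A <+> B)" using vS by (simp add: relabel_def)
  define k where "k x = (if x \<in> A then Inl x else Inr x)" for x :: nat
  have k: "k u \<in> verts ?S" if "u \<in> A \<union> B" for u using that vS by (auto simp: k_def)
  have "bij_betw k (A \<union> B) (A <+> B)"
    using AB(3) by (intro bij_betwI[where g = "case_sum id id"]) (auto simp: k_def)
  moreover have "bij_betw sum_encode (A <+> B) (sum_encode ` (A <+> B))"
    by (rule inj_on_imp_bij_betw) (rule inj_on_subset[OF inj_sum_encode subset_UNIV])
  ultimately have bij: "bij_betw (\<lambda>x. sum_encode (k x)) (A \<union> B) (sum_encode ` (A <+> B))"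
    using bij_betw_trans by (fastforce simp: comp_def)
  have ek: "(k u, k v) \<in> edges ?S \<longleftrightarrow> (u, v) \<in> edges H" if "u \<in> A \<union> B" "v \<in> A \<union> B" for u v
    using that no AB(3) by (auto simp: k_def)
  have "ptree_prod (ptree_of H A) (ptree_of H B) = abs_ptree (merge_roots ?R)"
    unfolding ptree_of_def
    by (rule ptree_prod.abs_eq) (rule ptree_rel_merge_restrict[OF H])+
  also have "\<dots> = ptree_of ?R (verts ?R)"
  proof -
    have "restrict_pforest ?R (verts ?R) = ?R"
    proof -
      have "B \<inter> verts ?R = B" "B \<noteq> {}" if "B \<in> blocks ?R" for B
        using pforest_iso_by_blocks_sub[OF pR that] by auto
      then have "(\<lambda>B. B \<inter> verts ?R) ` blocks ?R - {{}} = blocks ?R" by force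
      moreover have "edges ?R \<inter> verts ?R \<times> verts ?R = edges ?R" using partitioned_forestD(2)[OF pR] by blast
      ultimately show ?thesis by (simp add: restrict_pforest_def)
    qed
    then show ?thesis by (simp add: ptree_of_def)
  qed
  also have "\<dots> = ptree_of H (A \<union> B)"
  proof (rule sym, rule ptree_of_eqI[OF H pR _ subset_refl])
    show "bij_betw (\<lambda>x. sum_encode (k x)) (A \<union> B) (verts ?R)" using bij vR by simp
    show "A \<union> B \<subseteq> verts H" using AB by simp
    show "(u, v) \<in> edges H \<longleftrightarrow> (sum_encode (k u), sum_encode (k v)) \<in> edges ?R"
      if "u \<in> A \<union> B" "v \<in> A \<union> B" for u v
      using ek[OF that] by (simp add: edges_relabel[OF inj_sum_encode])
    show "deco ?R (sum_encode (k v)) = deco H v" if "v \<in> A \<union> B" for v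
      unfolding deco_relabel[OF inj_sum_encode k[OF that]] by (simp add: disjoint_union_def k_def)
    show "same_block H u v \<longleftrightarrow> same_block ?R (sum_encode (k u)) (sum_encode (k v))"
      if a: "w \<in> A \<union> B" "u \<in> A \<union> B" "v \<in> A \<union> B" "(w, u) \<in> edges H" "(w, v) \<in> edges H" for w u v
    proof -
      consider "w \<in> A" "u \<in> A" "v \<in> A" | "w \<in> B" "u \<in> B" "v \<in> B" using a no by blast
      then have "same_block ?S (k u) (k v) \<longleftrightarrow> same_block H u v"
      proof cases
        case 1
        then show ?thesis using same_block_merge_restrict[OF H a(4)] by (simp add: k_def)
      next
        case 2
        then have "u \<notin> A" "v \<notin> A" using AB(3) by auto
        then show ?thesis using 2 same_block_merge_restrict[OF H a(4)] by (simp add: k_def)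
      qed
      then show ?thesis by (simp add: same_block_relabel[OF pS inj_sum_encode])
    qed
  qed
  finally show ?thesis .
qed

lemma ptree_of_relabel:
  assumes F: "partitioned_forest F" and f: "inj f" and U: "U \<subseteq> verts F"
  shows "ptree_of (relabel f F) (f ` U) = ptree_of F U"
proof (rule sym, rule ptree_of_eqI[where f = f])
  show "partitioned_forest (relabel f F)"
    by (rule partitioned_forest_relabel'[OF F inj_on_subset[OF f subset_UNIV]])
  show "bij_betw f U (f ` U)"
    by (rule inj_on_imp_bij_betw[OF inj_on_subset[OF f subset_UNIV]])
qed (use assms in \<open>auto simp: verts_relabel edges_relabel[OF f] deco_relabel[OF f] same_block_relabel[OF F f] subset_iff\<close>)

lemma ptree_of_disjoint_union:
  fixes F G :: "(nat, 'd) pforest"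
  assumes F: "partitioned_forest F" and G: "partitioned_forest G"
  defines "H \<equiv> relabel sum_encode (disjoint_union F G)"
  shows "partitioned_forest H" "separated H ((\<lambda>x. sum_encode (Inl x)) ` verts F) ((\<lambda>x. sum_encode (Inr x)) ` verts G)"
    "U \<subseteq> verts F \<Longrightarrow> ptree_of H ((\<lambda>x. sum_encode (Inl x)) ` U) = ptree_of F U"
    "V \<subseteq> verts G \<Longrightarrow> ptree_of H ((\<lambda>x. sum_encode (Inr x)) ` V) = ptree_of G V"
    "(sum_encode (Inl a), sum_encode (Inl b)) \<in> edges H \<longleftrightarrow> (a, b) \<in> edges F"
proof -
  have S: "partitioned_forest (disjoint_union F G)" by (rule partitioned_forest_disjoint_union[OF F G])
  show H: "partitioned_forest H"
    unfolding H_def by (rule partitioned_forest_relabel'[OF S inj_on_subset[OF inj_sum_encode subset_UNIV]])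
  have e: "(sum_encode x, sum_encode y) \<in> edges H \<longleftrightarrow> (x, y) \<in> edges (disjoint_union F G)" for x y
    unfolding H_def by (rule edges_relabel[OF inj_sum_encode])
  have b: "same_block H (sum_encode x) (sum_encode y) \<longleftrightarrow> same_block (disjoint_union F G) x y" for x y
    unfolding H_def by (rule same_block_relabel[OF S inj_sum_encode])
  have v: "verts H = sum_encode ` (verts F <+> verts G)" by (simp add: H_def relabel_def disjoint_union_def)
  have d: "x \<in> verts F \<Longrightarrow> deco H (sum_encode (Inl x)) = deco F x"
    "y \<in> verts G \<Longrightarrow> deco H (sum_encode (Inr y)) = deco G y" for x y
    using deco_relabel[OF inj_sum_encode, of "Inl x" "disjoint_union F G"]
      deco_relabel[OF inj_sum_encode, of "Inr y" "disjoint_union F G"]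
    by (auto simp: H_def disjoint_union_def)
  have i: "sum_encode x = sum_encode y \<longleftrightarrow> x = y" for x y using inj_sum_encode by (auto dest: injD)
  show "separated H ((\<lambda>x. sum_encode (Inl x)) ` verts F) ((\<lambda>x. sum_encode (Inr x)) ` verts G)"
    by (auto simp: separated_def v e i)
  show "(sum_encode (Inl a), sum_encode (Inl b)) \<in> edges H \<longleftrightarrow> (a, b) \<in> edges F"
    by (simp add: e)
  show "ptree_of H ((\<lambda>x. sum_encode (Inl x)) ` U) = ptree_of F U" if "U \<subseteq> verts F"
    by (rule sym, rule ptree_of_eqI[where f = "\<lambda>x. sum_encode (Inl x)"])
      (use that F H in \<open>auto simp: e b v d i bij_betw_def inj_on_def subset_iff\<close>)
  show "ptree_of H ((\<lambda>x. sum_encode (Inr x)) ` V) = ptree_of G V" if "V \<subseteq> verts G"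
    by (rule sym, rule ptree_of_eqI[where f = "\<lambda>x. sum_encode (Inr x)"])
      (use that G H in \<open>auto simp: e b v d i bij_betw_def inj_on_def subset_iff\<close>)
qed

lemma ex_separated:
  obtains H A B where "partitioned_forest H" "separated H A B" "T = ptree_of H A" "U = ptree_of H B"
proof -
  obtain F G where F: "partitioned_tree F" "T = ptree_of F (verts F)" and G: "partitioned_tree G" "U = ptree_of G (verts G)"
    using ptree_cases by metis
  then have "partitioned_forest F" "partitioned_forest G" by (simp_all add: partitioned_tree_def)
  from ptree_of_disjoint_union[OF this] show ?thesis using that F(2) G(2) subset_refl by metis
qed

text \<open>Associativity needs three trees in one forest; with \<open>ptree_prod_ptree_of\<close>
  the monoid laws are then those of union.\<close>

lemma ex_separated3:
  obtains H A B C where "partitioned_forest H" "separated H A B" "separated H A C" "separated H B C"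
    "T = ptree_of H A" "U = ptree_of H B" "V = ptree_of H C"
proof -
  obtain F A B where F: "partitioned_forest F" "separated F A B" "T = ptree_of F A" "U = ptree_of F B"
    by (rule ex_separated)
  obtain G where G: "partitioned_tree G" "V = ptree_of G (verts G)" by (rule ptree_cases)
  then have pG: "partitioned_forest G" by (simp add: partitioned_tree_def)
  let ?H = "relabel sum_encode (disjoint_union F G)"
  let ?l = "\<lambda>x. sum_encode (Inl x)" and ?r = "\<lambda>x. sum_encode (Inr x)"
  note u = ptree_of_disjoint_union[OF F(1) pG]
  have sub: "A \<subseteq> verts F" "B \<subseteq> verts F" using F(2) by (auto simp: separated_def)
  have i: "sum_encode x = sum_encode y \<longleftrightarrow> x = y" for x y using inj_sum_encode by (auto dest: injD)
  have "separated ?H (?l ` A) (?l ` B)"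
    using F(2) u(2) by (auto simp: separated_def u(5) i)
  moreover have "separated ?H (?l ` A) (?r ` verts G)" "separated ?H (?l ` B) (?r ` verts G)"
    using separated_mono[OF u(2) image_mono[OF sub(1)] subset_refl]
      separated_mono[OF u(2) image_mono[OF sub(2)] subset_refl] .
  ultimately show ?thesis
    using that[OF u(1)] u(3)[OF sub(1)] u(3)[OF sub(2)] u(4)[OF subset_refl] F(3,4) G(2) by metis
qed

text \<open>With the product of trees as addition, the library product of finitely supported
  functions is the product of \<open>CP_algebra\<close>, as the locale requires.\<close>

instantiation ptree :: (type) comm_monoid_add
begin

definition zero_ptree :: "'a ptree" where "zero_ptree = empty_ptree"

definition plus_ptree :: "'a ptree \<Rightarrow> 'a ptree \<Rightarrow> 'a ptree" where "plus_ptree = ptree_prod"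

instance
proof
  fix T U V :: "'a ptree"
  obtain H A B C where H: "partitioned_forest H" and s: "separated H A B" "separated H A C" "separated H B C"
    and T: "T = ptree_of H A" "U = ptree_of H B" "V = ptree_of H C" by (rule ex_separated3)
  have "separated H (A \<union> B) C" "separated H A (B \<union> C)" "separated H B A" "separated H {} A"
    using s by (auto simp: separated_def)
  note p = s(1,3) this
  show "T + U + V = T + (U + V)"
    unfolding plus_ptree_def T using p by (simp add: ptree_prod_ptree_of[OF H] Un_assoc)
  show "T + U = U + T"
    unfolding plus_ptree_def T using p by (simp add: ptree_prod_ptree_of[OF H] Un_commute)
  show "0 + T = T"
    unfolding plus_ptree_def zero_ptree_def T ptree_of_empty[OF H, symmetric]
    using p by (simp add: ptree_prod_ptree_of[OF H])
qed

end

section \<open>The coproduct of partitioned trees as a sum over ideals\<close>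

definition ideals_in :: "('v, 'd) pforest \<Rightarrow> 'v set \<Rightarrow> 'v set set" where
  "ideals_in H U = {I. I \<subseteq> U \<and> (\<forall>v\<in>I. \<forall>w\<in>U. (v, w) \<in> edges H \<longrightarrow> w \<in> I)}"

lemma ideals_inD: "I \<in> ideals_in H U \<Longrightarrow> I \<subseteq> U"
  by (simp add: ideals_in_def)

lemma finite_subset_verts: "partitioned_forest H \<Longrightarrow> U \<subseteq> verts H \<Longrightarrow> finite U"
  using partitioned_forestD(1) finite_subset by blast

lemma finite_ideals_in: "partitioned_forest H \<Longrightarrow> U \<subseteq> verts H \<Longrightarrow> finite (ideals_in H U)"
  by (rule finite_subset[of _ "Pow U"]) (auto simp: ideals_in_def finite_subset_verts)

lemma full_ideal: "U \<in> ideals_in H U" and empty_ideal: "{} \<in> ideals_in H U"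
  by (auto simp: ideals_in_def)

text \<open>Both legs are again subsets of the same forest, so the coproduct can be iterated without
  choosing new representatives.\<close>

lemma ptree_coprod_ptree_of:
  assumes H: "partitioned_forest H" and U: "U \<subseteq> verts H"
  shows "ptree_coprod (ptree_of H U) =
    (\<Sum>I\<in>ideals_in H U. Poly_Mapping.single (ptree_of H (U - I), ptree_of H I) (1::'k::field))"
proof -
  let ?F = "merge_roots (restrict_pforest H U)"
  have F: "partitioned_tree ?F" by (rule partitioned_tree_merge_restrict[OF H])
  then have pF: "partitioned_forest ?F" by (simp add: partitioned_tree_def)
  have v: "verts ?F = U" using U by auto
  have i: "ideals ?F = ideals_in H U" using U by (auto simp: ideals_def ideals_in_def)
  have R: "abs_ptree (R_part ?F I) = ptree_of H (U - I)" if I: "I \<in> ideals ?F" for I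
  proof -
    have "abs_ptree (R_part ?F I) = ptree_of (R_part ?F I) (verts (R_part ?F I))"
      by (rule abs_ptree_eq_ptree_of[OF partitioned_tree_R_part[OF F I]])
    also have "\<dots> = ptree_of ?F (U - I)"
      using ptree_of_restrict[OF pF, of "U - I" "U - I"] v subset_trans[OF Diff_subset U] by (simp add: R_part_def Int_absorb1)
    also have "\<dots> = ptree_of H (U - I)" by (rule ptree_of_merge_restrict[OF H _ U]) blast
    finally show ?thesis .
  qed
  have P: "abs_ptree (P_part ?F I) = ptree_of H I" if I: "I \<in> ideals ?F" for I
    using ptree_of_merge_restrict[OF H ideals_inD U] I by (simp add: P_part_def ptree_of_def[of ?F] i)
  have "ptree_coprod (ptree_of H U) =
      (\<Sum>I\<in>ideals ?F. Poly_Mapping.single (abs_ptree (R_part ?F I), abs_ptree (P_part ?F I)) (1::'k))"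
    unfolding ptree_of_def by (rule ptree_coprod.abs_eq[OF ptree_rel_merge_restrict[OF H]])
  then show ?thesis by (simp add: R P i cong: sum.cong)
qed

text \<open>The left leg is empty only for the full ideal, the right leg only for the empty
  one.\<close>

lemma ptree_counit:
  "Poly_Mapping.lookup (ptree_coprod T :: _ \<Rightarrow>\<^sub>0 'k::field) (0, U) = (if U = T then 1 else 0)"
  "Poly_Mapping.lookup (ptree_coprod T :: _ \<Rightarrow>\<^sub>0 'k::field) (U, 0) = (if U = T then 1 else 0)"
proof -
  obtain H where "partitioned_tree H" and T: "T = ptree_of H (verts H)" by (rule ptree_cases)
  then have H: "partitioned_forest H" by (simp add: partitioned_tree_def)
  note s = ptree_coprod_ptree_of[OF H subset_refl, where ?'k = 'k] finite_ideals_in[OF H subset_refl]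
    full_ideal[of "verts H" H] empty_ideal[of H "verts H"]
  have e: "ptree_of H V = 0 \<longleftrightarrow> V = {}" if "V \<subseteq> verts H" for V
    using ptree_of_eq_empty_iff[OF H that] by (simp add: zero_ptree_def)
  have "Poly_Mapping.lookup (ptree_coprod T :: _ \<Rightarrow>\<^sub>0 'k) (0, U) =
    (\<Sum>I\<in>ideals_in H (verts H). if I = verts H then (if U = T then 1 else 0) else 0)"
    unfolding T s(1) lookup_sum
    by (rule sum.cong) (auto simp: lookup_single when_def e dest: ideals_inD)
  then show "Poly_Mapping.lookup (ptree_coprod T :: _ \<Rightarrow>\<^sub>0 'k) (0, U) = (if U = T then 1 else 0)"
    using s by simp
  have "Poly_Mapping.lookup (ptree_coprod T :: _ \<Rightarrow>\<^sub>0 'k) (U, 0) =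
    (\<Sum>I\<in>ideals_in H (verts H). if I = {} then (if U = T then 1 else 0) else 0)"
    unfolding T s(1) lookup_sum
    by (rule sum.cong) (auto simp: lookup_single when_def e dest: ideals_inD)
  then show "Poly_Mapping.lookup (ptree_coprod T :: _ \<Rightarrow>\<^sub>0 'k) (U, 0) = (if U = T then 1 else 0)"
    using s by simp
qed

text \<open>Both sides sum over the cuts into three layers: an ideal I followed by an ideal K of its
  complement corresponds to the chain of ideals I \<subseteq> I \<union> K.\<close>

lemma ptree_coassoc:
  "lin_ext (\<lambda>(y, z). lin_ext (\<lambda>(a, b). Poly_Mapping.single (a, b, z) 1) (ptree_coprod y)) (ptree_coprod T) =
   lin_ext (\<lambda>(y, z). lin_ext (\<lambda>(a, b). Poly_Mapping.single (y, a, b) 1) (ptree_coprod z))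
     (ptree_coprod T :: _ \<Rightarrow>\<^sub>0 'k::field)"
proof -
  obtain H where "partitioned_tree H" and T: "T = ptree_of H (verts H)" by (rule ptree_cases)
  then have H: "partitioned_forest H" by (simp add: partitioned_tree_def)
  let ?V = "verts H"
  have D: "ptree_coprod (ptree_of H U) = (\<Sum>I\<in>ideals_in H U. Poly_Mapping.single (ptree_of H (U - I), ptree_of H I) (1::'k))"
    if "U \<subseteq> ?V" for U by (rule ptree_coprod_ptree_of[OF H that])
  have fin: "finite (ideals_in H U)" if "U \<subseteq> ?V" for U by (rule finite_ideals_in[OF H that])
  let ?f = "\<lambda>X Y Z. Poly_Mapping.single (ptree_of H X, ptree_of H Y, ptree_of H Z) (1::'k)"
  have "lin_ext (\<lambda>(y, z). lin_ext (\<lambda>(a, b). Poly_Mapping.single (a, b, z) 1) (ptree_coprod y)) (ptree_coprod T) =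
      (\<Sum>I\<in>ideals_in H ?V. \<Sum>K\<in>ideals_in H (?V - I). ?f (?V - I - K) K I)"
    by (simp add: T D lin_ext_sum)
  also have "\<dots> = (\<Sum>(I, K)\<in>Sigma (ideals_in H ?V) (\<lambda>I. ideals_in H (?V - I)). ?f (?V - I - K) K I)"
    by (rule sum.Sigma) (auto intro!: fin)
  also have "\<dots> = (\<Sum>(J, K)\<in>Sigma (ideals_in H ?V) (ideals_in H). ?f (?V - J) (J - K) K)"
  proof (rule sum.reindex_bij_witness[where i = "\<lambda>(J, K). (K, J - K)" and j = "\<lambda>(I, K). (I \<union> K, I)"])
    fix t assume "t \<in> Sigma (ideals_in H ?V) (\<lambda>I. ideals_in H (?V - I))"
    then obtain I K where t: "t = (I, K)" "I \<subseteq> ?V" "K \<subseteq> ?V - I"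
      "\<And>v w. v \<in> I \<Longrightarrow> w \<in> ?V \<Longrightarrow> (v, w) \<in> edges H \<Longrightarrow> w \<in> I"
      "\<And>v w. v \<in> K \<Longrightarrow> w \<in> ?V - I \<Longrightarrow> (v, w) \<in> edges H \<Longrightarrow> w \<in> K"
      by (auto simp: ideals_in_def)
    have m: "K \<union> I - I = K" using t(3) by blast
    have t5: "w \<in> K \<or> w \<in> I" if "v \<in> K" "w \<in> ?V" "(v, w) \<in> edges H" for v w
      using t(5)[OF that(1) _ that(3)] that(2) by blast
    show "(\<lambda>(J, K). (K, J - K)) ((\<lambda>(I, K). (I \<union> K, I)) t) = t" using m by (simp add: t Un_commute)
    show "(\<lambda>(I, K). (I \<union> K, I)) t \<in> Sigma (ideals_in H ?V) (ideals_in H)"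
      using t(2,3) by (auto simp: t(1) ideals_in_def dest: t(4) t5)
    have "?V - (I \<union> K) = ?V - I - K" by blast
    then show "(case (\<lambda>(I, K). (I \<union> K, I)) t of (J, K) \<Rightarrow> ?f (?V - J) (J - K) K) =
        (case t of (I, K) \<Rightarrow> ?f (?V - I - K) K I)"
      using m by (simp add: t(1) Un_commute)
  next
    fix t assume "t \<in> Sigma (ideals_in H ?V) (ideals_in H)"
    then obtain J K where t: "t = (J, K)" "J \<subseteq> ?V" "K \<subseteq> J"
      "\<And>v w. v \<in> J \<Longrightarrow> w \<in> ?V \<Longrightarrow> (v, w) \<in> edges H \<Longrightarrow> w \<in> J"
      "\<And>v w. v \<in> K \<Longrightarrow> w \<in> J \<Longrightarrow> (v, w) \<in> edges H \<Longrightarrow> w \<in> K"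
      by (auto simp: ideals_in_def)
    show "(\<lambda>(I, K). (I \<union> K, I)) ((\<lambda>(J, K). (K, J - K)) t) = t" using t(3) by (auto simp: t(1))
    show "(\<lambda>(J, K). (K, J - K)) t \<in> Sigma (ideals_in H ?V) (\<lambda>I. ideals_in H (?V - I))"
    proof -
      have "w \<in> K" if "v \<in> K" "w \<in> ?V" "(v, w) \<in> edges H" for v w
        using t(5)[OF that(1) t(4)[OF subsetD[OF t(3) that(1)] that(2,3)] that(3)] .
      then have "K \<in> ideals_in H ?V" using t(2,3) by (simp add: ideals_in_def)
      moreover have "J - K \<in> ideals_in H (?V - K)"
        using t(2) by (auto simp: ideals_in_def dest: t(4))
      ultimately show ?thesis by (simp add: t(1))
    qed
  qed
  also have "\<dots> = (\<Sum>J\<in>ideals_in H ?V. \<Sum>K\<in>ideals_in H J. ?f (?V - J) (J - K) K)"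
    by (rule sum.Sigma[symmetric]) (auto intro!: fin dest: ideals_inD)
  also have "\<dots> = lin_ext (\<lambda>(y, z). lin_ext (\<lambda>(a, b). Poly_Mapping.single (y, a, b) 1) (ptree_coprod z)) (ptree_coprod T)"
    by (simp add: T D lin_ext_sum ideals_inD cong: sum.cong)
  finally show ?thesis .
qed

text \<open>The closure condition of an ideal involves only edges, so it splits between
  \<open>A\<close> and \<open>B\<close>.\<close>

lemma sum_ideals_in_union:
  assumes "separated H A B"
  shows "(\<Sum>I\<in>ideals_in H (A \<union> B). f I) = (\<Sum>J\<in>ideals_in H A. \<Sum>L\<in>ideals_in H B. f (J \<union> L))"
proof -
  have AB: "A \<inter> B = {}" and no: "\<And>a b. a \<in> A \<Longrightarrow> b \<in> B \<Longrightarrow> (a, b) \<notin> edges H \<and> (b, a) \<notin> edges H"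
    using assms by (auto simp: separated_def)
  have "(\<Sum>I\<in>ideals_in H (A \<union> B). f I) = (\<Sum>(J, L)\<in>ideals_in H A \<times> ideals_in H B. f (J \<union> L))"
  proof (rule sum.reindex_bij_witness[where i = "\<lambda>(J, L). J \<union> L" and j = "\<lambda>I. (I \<inter> A, I \<inter> B)"])
    fix I assume "I \<in> ideals_in H (A \<union> B)"
    then have I: "I \<subseteq> A \<union> B" "\<And>v w. v \<in> I \<Longrightarrow> w \<in> A \<union> B \<Longrightarrow> (v, w) \<in> edges H \<Longrightarrow> w \<in> I"
      by (auto simp: ideals_in_def)
    have IAB: "I \<inter> A \<union> I \<inter> B = I" using I(1) by blast
    then show "(\<lambda>(J, L). J \<union> L) (I \<inter> A, I \<inter> B) = I" by simp
    show "(case (I \<inter> A, I \<inter> B) of (J, L) \<Rightarrow> f (J \<union> L)) = f I" using IAB by simp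
    show "(I \<inter> A, I \<inter> B) \<in> ideals_in H A \<times> ideals_in H B" using I(2) by (auto simp: ideals_in_def)
  next
    fix t assume "t \<in> ideals_in H A \<times> ideals_in H B"
    then obtain J L where t: "t = (J, L)" "J \<subseteq> A" "L \<subseteq> B"
      "\<And>v w. v \<in> J \<Longrightarrow> w \<in> A \<Longrightarrow> (v, w) \<in> edges H \<Longrightarrow> w \<in> J"
      "\<And>v w. v \<in> L \<Longrightarrow> w \<in> B \<Longrightarrow> (v, w) \<in> edges H \<Longrightarrow> w \<in> L"
      by (auto simp: ideals_in_def)
    have "(J \<union> L) \<inter> A = J" "(J \<union> L) \<inter> B = L" using t(2,3) AB by auto
    then show "((\<lambda>(J, L). J \<union> L) t \<inter> A, (\<lambda>(J, L). J \<union> L) t \<inter> B) = t" by (simp add: t(1))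
    have "w \<in> J \<union> L" if vw: "v \<in> J \<union> L" "w \<in> A \<union> B" "(v, w) \<in> edges H" for v w
    proof (cases "v \<in> J")
      case True
      then have "w \<in> A" using vw no t(2) by blast
      then show ?thesis using t(4)[OF True _ vw(3)] by simp
    next
      case False
      then have v: "v \<in> L" using vw by simp
      then have "w \<in> B" using vw no t(3) by blast
      then show ?thesis using t(5)[OF v _ vw(3)] by simp
    qed
    moreover have "J \<union> L \<subseteq> A \<union> B" using t(2,3) by blast
    ultimately have "J \<union> L \<in> ideals_in H (A \<union> B)" by (simp add: ideals_in_def)
    then show "(\<lambda>(J, L). J \<union> L) t \<in> ideals_in H (A \<union> B)" by (simp add: t(1))
  qed
  then show ?thesis by (simp add: sum.cartesian_product)
qed

lemma ptree_of_add:
  "partitioned_forest H \<Longrightarrow> separated H A B \<Longrightarrow> ptree_of H A + ptree_of H B = ptree_of H (A \<union> B)"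
  by (simp add: plus_ptree_def ptree_prod_ptree_of)

lemma ptree_coprod_add: "ptree_coprod (T + U) = ptree_coprod T * (ptree_coprod U :: _ \<Rightarrow>\<^sub>0 'k::field)"
proof -
  obtain H A B where H: "partitioned_forest H" and s: "separated H A B" and T: "T = ptree_of H A" "U = ptree_of H B"
    by (rule ex_separated)
  have AB: "A \<subseteq> verts H" "B \<subseteq> verts H" "A \<inter> B = {}" using s by (auto simp: separated_def)
  have "ptree_coprod (T + U) = (\<Sum>J\<in>ideals_in H A. \<Sum>L\<in>ideals_in H B.
      Poly_Mapping.single (ptree_of H (A \<union> B - (J \<union> L)), ptree_of H (J \<union> L)) (1::'k))"
    using AB by (simp add: T ptree_of_add[OF H s] ptree_coprod_ptree_of[OF H] sum_ideals_in_union[OF s])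
  also have "\<dots> = (\<Sum>J\<in>ideals_in H A. \<Sum>L\<in>ideals_in H B.
      Poly_Mapping.single (ptree_of H (A - J), ptree_of H J) 1 * Poly_Mapping.single (ptree_of H (B - L), ptree_of H L) 1)"
  proof (intro sum.cong refl)
    fix J L assume "J \<in> ideals_in H A" "L \<in> ideals_in H B"
    then have JL: "J \<subseteq> A" "L \<subseteq> B" by (auto dest: ideals_inD)
    have "A \<union> B - (J \<union> L) = (A - J) \<union> (B - L)" using JL AB(3) by blast
    moreover have "separated H (A - J) (B - L)" "separated H J L"
      by (rule separated_mono[OF s]; use JL in blast)+
    ultimately show "Poly_Mapping.single (ptree_of H (A \<union> B - (J \<union> L)), ptree_of H (J \<union> L)) (1::'k) =
      Poly_Mapping.single (ptree_of H (A - J), ptree_of H J) 1 * Poly_Mapping.single (ptree_of H (B - L), ptree_of H L) 1"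
      by (simp add: mult_single ptree_of_add[OF H])
  qed
  also have "\<dots> = ptree_coprod T * ptree_coprod U"
    using AB by (simp add: T ptree_coprod_ptree_of[OF H] sum_product)
  finally show ?thesis .
qed

lemma keys_ptree_coprod:
  assumes "t \<in> Poly_Mapping.keys (ptree_coprod T :: _ \<Rightarrow>\<^sub>0 'k::field)"
  shows "ptree_nodes (fst t) + ptree_nodes (snd t) = ptree_nodes T"
    "ptree_decos (fst t) \<union> ptree_decos (snd t) = ptree_decos T"
proof -
  obtain H where "partitioned_tree H" and T: "T = ptree_of H (verts H)" by (rule ptree_cases)
  then have H: "partitioned_forest H" by (simp add: partitioned_tree_def)
  have "t \<in> (\<Union>I\<in>ideals_in H (verts H). Poly_Mapping.keys (Poly_Mapping.single (ptree_of H (verts H - I), ptree_of H I) (1::'k)))"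
    using assms unfolding T ptree_coprod_ptree_of[OF H subset_refl] by (rule subsetD[OF keys_sum])
  then obtain I where I: "I \<subseteq> verts H" "t = (ptree_of H (verts H - I), ptree_of H I)"
    by (auto simp: ideals_in_def)
  have "card (verts H - I) + card I = card (verts H)"
    using card_Un_disjoint[of "verts H - I" I] finite_subset_verts[OF H] I(1) by (simp add: Un_absorb2 Int_commute)
  then show "ptree_nodes (fst t) + ptree_nodes (snd t) = ptree_nodes T"
    using I by (simp add: T ptree_nodes_ptree_of[OF H])
  have "deco H ` (verts H - I) \<union> deco H ` I = deco H ` verts H"
    using I(1) by (simp flip: image_Un add: Un_absorb2)
  then show "ptree_decos (fst t) \<union> ptree_decos (snd t) = ptree_decos T"
    using I by (simp add: T ptree_decos_ptree_of[OF H])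
qed


section \<open>Grafting of partitioned trees\<close>

text \<open>The roots of \<open>G\<close> become children of \<open>v\<close> that form a block of
  their own, apart from the children that \<open>v\<close> already has. The vertex sets are meant to
  be disjoint.\<close>

definition graft_at :: "('v, 'd) pforest \<Rightarrow> ('v, 'd) pforest \<Rightarrow> 'v \<Rightarrow> ('v, 'd) pforest" where
  "graft_at F G v =
     \<lparr>verts = verts F \<union> verts G,
      edges = edges F \<union> edges G \<union> {v} \<times> roots G,
      blocks = blocks F \<union> blocks (merge_roots G),
      deco = (\<lambda>x. if x \<in> verts F then deco F x else deco G x)\<rparr>"

lemma graft_at_simps [simp]:
  "verts (graft_at F G v) = verts F \<union> verts G"
  "edges (graft_at F G v) = edges F \<union> edges G \<union> {v} \<times> roots G"
  "deco (graft_at F G v) = (\<lambda>x. if x \<in> verts F then deco F x else deco G x)"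
  by (simp_all add: graft_at_def)

lemma same_block_graft_at:
  assumes "partitioned_forest G"
  shows "same_block (graft_at F G v) a b \<longleftrightarrow>
    same_block F a b \<or> (a \<in> roots G \<and> b \<in> roots G) \<or> same_block G a b"
proof -
  have "same_block (graft_at F G v) a b \<longleftrightarrow> same_block F a b \<or> same_block (merge_roots G) a b"
    by (auto simp: same_block_def graft_at_def)
  then show ?thesis by (simp add: same_block_merge_roots[OF assms])
qed

lemma roots_subset: "roots F \<subseteq> verts F"
  by (auto simp: roots_def)

lemma roots_no_parent: "v \<in> roots F \<Longrightarrow> (u, v) \<notin> edges F"
  by (simp add: roots_def)

lemma partition_on_disjoint_Un:
  assumes "partition_on A P" "partition_on B Q" "A \<inter> B = {}"
  shows "partition_on (A \<union> B) (P \<union> Q)"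
proof (rule partition_onI)
  have u: "\<Union>P = A" "\<Union>Q = B" "{} \<notin> P" "{} \<notin> Q" using assms by (auto simp: partition_on_def)
  show "\<Union>(P \<union> Q) = A \<union> B" using u by simp
  show "{} \<notin> P \<union> Q" using u by simp
  have c: "disjnt X Y" if "X \<in> P" "Y \<in> Q" for X Y
  proof -
    have "X \<subseteq> A" "Y \<subseteq> B" using that u by auto
    then show ?thesis using assms(3) by (auto simp: disjnt_def)
  qed
  fix X Y assume "X \<in> P \<union> Q" "Y \<in> P \<union> Q" "X \<noteq> Y"
  then consider "X \<in> P" "Y \<in> P" | "X \<in> Q" "Y \<in> Q" | "X \<in> P" "Y \<in> Q" | "X \<in> Q" "Y \<in> P" by blast
  then show "disjnt X Y"
  proof cases
    case 1
    then show ?thesis using disjointD[OF partition_onD2[OF assms(1)]] \<open>X \<noteq> Y\<close> by (simp add: disjnt_def)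
  next
    case 2
    then show ?thesis using disjointD[OF partition_onD2[OF assms(2)]] \<open>X \<noteq> Y\<close> by (simp add: disjnt_def)
  next
    case 3
    then show ?thesis by (rule c)
  next
    case 4
    then show ?thesis using c disjnt_sym by blast
  qed
qed

lemma partitioned_forest_wf: "partitioned_forest F \<Longrightarrow> wf (edges F)"
  using partitioned_forestD[of F] by (meson finite_SigmaI finite_acyclic_wf finite_subset)

lemma partitioned_forest_graft_at:
  assumes F: "partitioned_forest F" and G: "partitioned_forest G" and d: "verts F \<inter> verts G = {}"
    and v: "v \<in> verts F"
  shows "partitioned_forest (graft_at F G v)"
proof -
  let ?K = "graft_at F G v"
  have eF: "edges F \<subseteq> verts F \<times> verts F" and eG: "edges G \<subseteq> verts G \<times> verts G"
    using partitioned_forestD(2) F G by auto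
  \<comment> \<open>For finite edge relations acyclic means well-founded, and well-foundedness
    passes to this union because no edge leads from \<open>G\<close> back to
    \<open>F\<close>.\<close>
  have "wf ((edges F \<union> {v} \<times> roots G) \<union> edges G)"
  proof (rule wf_Un)
    show "wf (edges F \<union> {v} \<times> roots G)"
    proof (rule wf_Un)
      show "wf ({v} \<times> roots G)"
        by (rule wf_no_loop) (use d v roots_subset[of G] in auto)
      show "Domain (edges F) \<inter> Range ({v} \<times> roots G) = {}" using eF roots_subset[of G] d by blast
    qed (rule partitioned_forest_wf[OF F])
    show "Domain (edges F \<union> {v} \<times> roots G) \<inter> Range (edges G) = {}" using eF eG d v by blast
  qed (rule partitioned_forest_wf[OF G])
  then have "wf (edges ?K)" by (simp add: Un_ac)
  then have ac: "acyclic (edges ?K)" by (rule wf_acyclic)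
  have es: "edges ?K \<subseteq> verts ?K \<times> verts ?K" using eF eG v roots_subset[of G] by auto
  have un: "u = u'" if a: "(u, x) \<in> edges ?K" "(u', x) \<in> edges ?K" for u u' x
  proof (cases "x \<in> verts F")
    case True
    then have "(u, x) \<in> edges F" "(u', x) \<in> edges F" using a eG d roots_subset[of G] by auto
    then show ?thesis by (rule partitioned_forest_parent_unique[OF F])
  next
    case False
    then have b: "(u, x) \<in> edges G \<or> (u = v \<and> x \<in> roots G)" "(u', x) \<in> edges G \<or> (u' = v \<and> x \<in> roots G)"
      using a eF by auto
    show ?thesis
    proof (cases "x \<in> roots G")
      case True
      then show ?thesis using b roots_no_parent[of x G] by blast
    next
      case False
      then show ?thesis using b partitioned_forest_parent_unique[OF G] by blast
    qed
  qed
  have mG: "partitioned_forest (merge_roots G)"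
    using partitioned_tree_merge_roots[OF G] by (simp add: partitioned_tree_def)
  have p: "partition_on (verts ?K) (blocks ?K)"
    using partition_on_disjoint_Un[OF partitioned_forestD(4)[OF F] partitioned_forestD(4)[OF mG]] d
    by (simp add: graft_at_def merge_roots_def)
  have b: "(x \<in> roots ?K \<and> y \<in> roots ?K) \<or> (\<exists>u. (u, x) \<in> edges ?K \<and> (u, y) \<in> edges ?K)"
    if "same_block ?K x y" for x y
  proof -
    have rK: "x \<in> roots ?K" if "x \<in> roots F" for x
      using that eG d roots_subset[of G] by (auto simp: roots_def)
    have FK: "\<exists>u. (u, x) \<in> edges ?K \<and> (u, y) \<in> edges ?K" if "(w, x) \<in> edges F" "(w, y) \<in> edges F" for w
      using that by auto
    have GK: "\<exists>u. (u, x) \<in> edges ?K \<and> (u, y) \<in> edges ?K" if "(w, x) \<in> edges G" "(w, y) \<in> edges G" for w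
      using that by auto
    have RK: "\<exists>u. (u, x) \<in> edges ?K \<and> (u, y) \<in> edges ?K" if "x \<in> roots G" "y \<in> roots G"
      using that by auto
    from that consider "same_block F x y" | "x \<in> roots G" "y \<in> roots G" | "same_block G x y"
      unfolding same_block_graft_at[OF G] by blast
    then show ?thesis
    proof cases
      case 1
      from F this show ?thesis by (cases rule: same_block_cases) (use rK FK in blast)+
    next
      case 2
      then show ?thesis using RK by blast
    next
      case 3
      from G this show ?thesis by (cases rule: same_block_cases) (use RK GK in blast)+
    qed
  qed
  have fin: "finite (verts ?K)" using partitioned_forestD(1)[OF F] partitioned_forestD(1)[OF G] by simp
  have b': "\<forall>B\<in>blocks ?K. \<forall>x\<in>B. \<forall>y\<in>B.
      (x \<in> roots ?K \<and> y \<in> roots ?K) \<or> (\<exists>u. (u, x) \<in> edges ?K \<and> (u, y) \<in> edges ?K)"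
  proof (intro ballI)
    fix B x y assume "B \<in> blocks ?K" "x \<in> B" "y \<in> B"
    then have "same_block ?K x y" unfolding same_block_def by blast
    then show "(x \<in> roots ?K \<and> y \<in> roots ?K) \<or> (\<exists>u. (u, x) \<in> edges ?K \<and> (u, y) \<in> edges ?K)" by (rule b)
  qed
  have un': "\<forall>u u' x. (u, x) \<in> edges ?K \<longrightarrow> (u', x) \<in> edges ?K \<longrightarrow> u = u'" using un by blast
  show ?thesis unfolding partitioned_forest_def by (intro conjI fin es ac un' p b')
qed

text \<open>Isomorphisms f and g of the two pairs of representatives glue to one from the graft at v
  to the graft at f v. Only the sum over all v is invariant, after reindexing by f.\<close>

lemma ptree_of_graft_at_cong:
  assumes F: "partitioned_forest F" "partitioned_forest F'" and G: "partitioned_forest G" "partitioned_forest G'"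
    and d: "verts F \<inter> verts G = {}" "verts F' \<inter> verts G' = {}"
    and e: "ptree_of F (verts F) = ptree_of F' (verts F')" "ptree_of G (verts G) = ptree_of G' (verts G')"
  shows "(\<Sum>v\<in>verts F. Poly_Mapping.single (ptree_of (graft_at F G v) (verts F \<union> verts G)) (1::'k::field)) =
    (\<Sum>v\<in>verts F'. Poly_Mapping.single (ptree_of (graft_at F' G' v) (verts F' \<union> verts G')) 1)"
proof -
  obtain f where f: "bij_betw f (verts F) (verts F')"
    and "\<forall>u\<in>verts F. \<forall>v\<in>verts F. (u, v) \<in> edges F \<longleftrightarrow> (f u, f v) \<in> edges F'"
    and "\<forall>v\<in>verts F. deco F' (f v) = deco F v"
    and "\<forall>w\<in>verts F. \<forall>u\<in>verts F. \<forall>v\<in>verts F. (w, u) \<in> edges F \<longrightarrow> (w, v) \<in> edges F \<longrightarrow>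
       (same_block F u v \<longleftrightarrow> same_block F' (f u) (f v))"
    by (rule ptree_of_eqD[OF F subset_refl subset_refl e(1)])
  then have ef: "\<And>u v. u \<in> verts F \<Longrightarrow> v \<in> verts F \<Longrightarrow> (u, v) \<in> edges F \<longleftrightarrow> (f u, f v) \<in> edges F'"
    and df: "\<And>v. v \<in> verts F \<Longrightarrow> deco F' (f v) = deco F v"
    and sf: "\<And>w u v. w \<in> verts F \<Longrightarrow> u \<in> verts F \<Longrightarrow> v \<in> verts F \<Longrightarrow> (w, u) \<in> edges F \<Longrightarrow> (w, v) \<in> edges F \<Longrightarrow>
       same_block F u v \<longleftrightarrow> same_block F' (f u) (f v)"
    by simp_all
  obtain g where g: "bij_betw g (verts G) (verts G')"
    and "\<forall>u\<in>verts G. \<forall>v\<in>verts G. (u, v) \<in> edges G \<longleftrightarrow> (g u, g v) \<in> edges G'"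
    and "\<forall>v\<in>verts G. deco G' (g v) = deco G v"
    and "\<forall>w\<in>verts G. \<forall>u\<in>verts G. \<forall>v\<in>verts G. (w, u) \<in> edges G \<longrightarrow> (w, v) \<in> edges G \<longrightarrow>
       (same_block G u v \<longleftrightarrow> same_block G' (g u) (g v))"
    by (rule ptree_of_eqD[OF G subset_refl subset_refl e(2)])
  then have eg: "\<And>u v. u \<in> verts G \<Longrightarrow> v \<in> verts G \<Longrightarrow> (u, v) \<in> edges G \<longleftrightarrow> (g u, g v) \<in> edges G'"
    and dg: "\<And>v. v \<in> verts G \<Longrightarrow> deco G' (g v) = deco G v"
    and sg: "\<And>w u v. w \<in> verts G \<Longrightarrow> u \<in> verts G \<Longrightarrow> v \<in> verts G \<Longrightarrow> (w, u) \<in> edges G \<Longrightarrow> (w, v) \<in> edges G \<Longrightarrow>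
       same_block G u v \<longleftrightarrow> same_block G' (g u) (g v)"
    by simp_all
  define h where "h x = (if x \<in> verts F then f x else g x)" for x
  have hF: "h x = f x" "f x \<in> verts F'" "f x \<notin> verts G'" "x \<notin> verts G" if "x \<in> verts F" for x
    using that f d by (auto simp: h_def bij_betw_def)
  have hG: "h x = g x" "g x \<in> verts G'" "g x \<notin> verts F'" "x \<notin> verts F" if "x \<in> verts G" for x
    using that g d by (auto simp: h_def bij_betw_def)
  have bij: "bij_betw h (verts F \<union> verts G) (verts F' \<union> verts G')"
  proof (rule bij_betw_combine[OF _ _ d(2)])
    show "bij_betw h (verts F) (verts F')" using f hF(1) by (simp cong: bij_betw_cong)
    show "bij_betw h (verts G) (verts G')" using g hG(1) by (simp cong: bij_betw_cong)
  qed
  have edge: "a \<in> verts F \<and> b \<in> verts F" if "(a, b) \<in> edges F" for a b using partitioned_forest_edgeD[OF F(1) that] .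
  have edge': "a \<in> verts F' \<and> b \<in> verts F'" if "(a, b) \<in> edges F'" for a b using partitioned_forest_edgeD[OF F(2) that] .
  have edgeG: "a \<in> verts G \<and> b \<in> verts G" if "(a, b) \<in> edges G" for a b using partitioned_forest_edgeD[OF G(1) that] .
  have edgeG': "a \<in> verts G' \<and> b \<in> verts G'" if "(a, b) \<in> edges G'" for a b using partitioned_forest_edgeD[OF G(2) that] .
  have rV: "a \<in> verts G" if "a \<in> roots G" for a using that by (simp add: roots_def)
  have rV': "a \<in> verts G'" if "a \<in> roots G'" for a using that by (simp add: roots_def)
  have r: "g b \<in> roots G' \<longleftrightarrow> b \<in> roots G" if b: "b \<in> verts G" for b
  proof
    assume "g b \<in> roots G'"
    then have "(x, b) \<notin> edges G" for x using eg[of x b] b edgeG[of x b] roots_no_parent[of "g b" G'] by blast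
    then show "b \<in> roots G" using b by (simp add: roots_def)
  next
    assume rb: "b \<in> roots G"
    have "(y, g b) \<notin> edges G'" for y
    proof
      assume y: "(y, g b) \<in> edges G'"
      then obtain x where "x \<in> verts G" "y = g x" using edgeG'[OF y] g by (auto simp: bij_betw_def)
      then show False using eg[of x b] b y roots_no_parent[OF rb] by blast
    qed
    then show "g b \<in> roots G'" using hG(2)[OF b] by (simp add: roots_def)
  qed
  have "ptree_of (graft_at F G v) (verts F \<union> verts G) = ptree_of (graft_at F' G' (f v)) (verts F' \<union> verts G')"
    if v: "v \<in> verts F" for v
  proof (rule ptree_of_eqI[OF partitioned_forest_graft_at[OF F(1) G(1) d(1) v]
        partitioned_forest_graft_at[OF F(2) G(2) d(2) hF(2)[OF v]] _ _ bij])
    show "verts F \<union> verts G \<subseteq> verts (graft_at F G v)" by simp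
    show "verts F' \<union> verts G' \<subseteq> verts (graft_at F' G' (f v))" by simp
    show "deco (graft_at F' G' (f v)) (h x) = deco (graft_at F G v) x" if "x \<in> verts F \<union> verts G" for x
    proof (cases "x \<in> verts F")
      case True
      then show ?thesis using hF[OF True] df[OF True] by simp
    next
      case False
      then have x: "x \<in> verts G" using that by simp
      then show ?thesis using hG[OF x] dg[OF x] by simp
    qed
    show ed: "(x, y) \<in> edges (graft_at F G v) \<longleftrightarrow> (h x, h y) \<in> edges (graft_at F' G' (f v))"
      if xy: "x \<in> verts F \<union> verts G" "y \<in> verts F \<union> verts G" for x y
    proof -
      have inj: "f x = f v \<longleftrightarrow> x = v" if "x \<in> verts F" for x using f v that by (auto simp: bij_betw_def dest: inj_onD)
      consider "x \<in> verts F" "y \<in> verts F" | "x \<in> verts F" "y \<in> verts G" | "x \<in> verts G" "y \<in> verts F"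
        | "x \<in> verts G" "y \<in> verts G" using xy by blast
      then show ?thesis
      proof cases
        case 1
        then show ?thesis
          using hF[OF 1(1)] hF[OF 1(2)] ef[OF 1] edgeG[of x y] edgeG'[of "f x" "f y"] rV[of y] rV'[of "f y"] by auto
      next
        case 2
        then show ?thesis
          using hF[OF 2(1)] hG[OF 2(2)] inj[OF 2(1)] edge[of x y] edge'[of "f x" "g y"] edgeG[of x y] edgeG'[of "f x" "g y"]
            r[OF 2(2)] by auto
      next
        case 3
        have "x \<noteq> v" "g x \<noteq> f v" using hG[OF 3(1)] hF[OF v] by auto
        then show ?thesis
          using hG[OF 3(1)] hF[OF 3(2)] edge[of x y] edge'[of "g x" "f y"] edgeG[of x y] edgeG'[of "g x" "f y"] by auto
      next
        case 4
        have "x \<noteq> v" "g x \<noteq> f v" using hG[OF 4(1)] hF[OF v] by auto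
        then show ?thesis
          using hG[OF 4(1)] hG[OF 4(2)] edge[of x y] edge'[of "g x" "g y"] eg[OF 4] by auto
      qed
    qed
    show "same_block (graft_at F G v) x y \<longleftrightarrow> same_block (graft_at F' G' (f v)) (h x) (h y)"
      if a: "w \<in> verts F \<union> verts G" "x \<in> verts F \<union> verts G" "y \<in> verts F \<union> verts G"
        "(w, x) \<in> edges (graft_at F G v)" "(w, y) \<in> edges (graft_at F G v)" for w x y
    proof -
      note sb = same_block_graft_at[OF G(1)] same_block_graft_at[OF G(2)]
      consider "x \<in> verts F" "y \<in> verts F" | "x \<in> verts F" "y \<in> verts G" | "x \<in> verts G" "y \<in> verts F"
        | "x \<in> verts G" "y \<in> verts G" using a by blast
      then show ?thesis
      proof cases
        case 1
        then have "(w, x) \<in> edges F" "(w, y) \<in> edges F" using a(4,5) edgeG hF(4) rV by auto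
        then have "same_block F x y \<longleftrightarrow> same_block F' (f x) (f y)" using sf[of w x y] edge 1 by blast
        then show ?thesis
          unfolding sb using hF[OF 1(1)] hF[OF 1(2)] rV[of x] rV'[of "f x"]
            same_blockD[OF G(1), of x y] same_blockD[OF G(2), of "f x" "f y"] by auto
      next
        case 2
        then show ?thesis
          unfolding sb using hF[OF 2(1)] hG[OF 2(2)] rV[of x] rV'[of "f x"]
            same_blockD[OF F(1), of x y] same_blockD[OF F(2), of "f x" "g y"]
            same_blockD[OF G(1), of x y] same_blockD[OF G(2), of "f x" "g y"] by auto
      next
        case 3
        then show ?thesis
          unfolding sb using hG[OF 3(1)] hF[OF 3(2)] rV[of y] rV'[of "f y"]
            same_blockD[OF F(1), of x y] same_blockD[OF F(2), of "g x" "f y"]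
            same_blockD[OF G(1), of x y] same_blockD[OF G(2), of "g x" "f y"] by auto
      next
        case 4
        have F0: "\<not> same_block F x y" "\<not> same_block F' (g x) (g y)"
          using hG[OF 4(1)] same_blockD[OF F(1), of x y] same_blockD[OF F(2), of "g x" "g y"] by auto
        \<comment> \<open>Among the vertices of \<open>G\<close>, the roots are those whose parent
          in the graft is v; so two siblings are both roots of \<open>G\<close> or both not.\<close>
        have root_iff: "x \<in> roots G \<longleftrightarrow> y \<in> roots G"
          using a(4,5) edge hG(4)[OF 4(1)] hG(4)[OF 4(2)] edgeG[of w] hF(4)[OF v] roots_no_parent[of x G] roots_no_parent[of y G]
          by auto
        have "same_block G x y \<longleftrightarrow> same_block G' (g x) (g y)" if "x \<notin> roots G"
        proof -
          have "(w, x) \<in> edges G" "(w, y) \<in> edges G"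
            using a(4,5) edge hG(4)[OF 4(1)] hG(4)[OF 4(2)] that root_iff by auto
          then show ?thesis using sg[of w x y] edgeG 4 by blast
        qed
        then show ?thesis
          unfolding sb using F0 hG[OF 4(1)] hG[OF 4(2)] r[OF 4(1)] r[OF 4(2)] root_iff by auto
      qed
    qed
  qed
  then have "(\<Sum>v\<in>verts F. Poly_Mapping.single (ptree_of (graft_at F G v) (verts F \<union> verts G)) (1::'k)) =
    (\<Sum>v\<in>verts F. Poly_Mapping.single (ptree_of (graft_at F' G' (f v)) (verts F' \<union> verts G')) 1)"
    by (simp cong: sum.cong)
  also have "\<dots> = (\<Sum>v\<in>verts F'. Poly_Mapping.single (ptree_of (graft_at F' G' v) (verts F' \<union> verts G')) 1)"
    by (rule sum.reindex_bij_betw[OF f])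
  finally show ?thesis .
qed

section \<open>Grafting of isomorphism classes and of subsets\<close>

definition graft_data :: "'d ptree \<Rightarrow> 'd ptree \<Rightarrow> (nat, 'd) pforest \<Rightarrow> (nat, 'd) pforest \<Rightarrow> bool" where
  "graft_data T U F G \<longleftrightarrow> partitioned_forest F \<and> partitioned_forest G \<and> verts F \<inter> verts G = {} \<and>
     T = ptree_of F (verts F) \<and> U = ptree_of G (verts G)"

lemma ex_graft_data: "\<exists>F G. graft_data T U F G"
proof -
  obtain F where F: "partitioned_tree F" "T = ptree_of F (verts F)" by (rule ptree_cases)
  obtain G where G: "partitioned_tree G" "U = ptree_of G (verts G)" by (rule ptree_cases)
  have pf: "partitioned_forest F" "partitioned_forest G" using F G by (simp_all add: partitioned_tree_def)
  \<comment> \<open>Even and odd numbers make the two vertex sets disjoint.\<close>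
  let ?f = "\<lambda>n. 2 * n :: nat" and ?g = "\<lambda>n. 2 * n + 1 :: nat"
  have i: "inj ?f" "inj ?g" by (auto simp: inj_on_def)
  have "graft_data T U (relabel ?f F) (relabel ?g G)"
    unfolding graft_data_def verts_relabel
  proof (intro conjI)
    show "partitioned_forest (relabel ?f F)" "partitioned_forest (relabel ?g G)"
      by (rule partitioned_forest_relabel'[OF _ inj_on_subset[OF _ subset_UNIV]]; rule pf i)+
    show "?f ` verts F \<inter> ?g ` verts G = {}" by (auto simp: image_iff) presburger
    show "T = ptree_of (relabel ?f F) (?f ` verts F)" "U = ptree_of (relabel ?g G) (?g ` verts G)"
      using ptree_of_relabel[OF pf(1) i(1) subset_refl] ptree_of_relabel[OF pf(2) i(2) subset_refl] F(2) G(2) by simp_all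
  qed
  then show ?thesis by blast
qed

text \<open>
  By \<open>ptree_of_graft_at_cong\<close> the sum does not depend on the choice of the representatives.
\<close>

definition ptree_graft :: "'d ptree \<Rightarrow> 'd ptree \<Rightarrow> ('d ptree \<Rightarrow>\<^sub>0 'k::field)" where
  "ptree_graft T U = (SOME p. \<exists>F G. graft_data T U F G \<and>
     p = (\<Sum>v\<in>verts F. Poly_Mapping.single (ptree_of (graft_at F G v) (verts F \<union> verts G)) 1))"

lemma ptree_graft_eq:
  assumes "graft_data T U F G"
  shows "ptree_graft T U = (\<Sum>v\<in>verts F. Poly_Mapping.single (ptree_of (graft_at F G v) (verts F \<union> verts G)) (1::'k::field))"
  unfolding ptree_graft_def
proof (rule some_equality)
  fix p :: "_ \<Rightarrow>\<^sub>0 'k"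
  assume "\<exists>F G. graft_data T U F G \<and>
     p = (\<Sum>v\<in>verts F. Poly_Mapping.single (ptree_of (graft_at F G v) (verts F \<union> verts G)) 1)"
  then obtain F' G' where F': "graft_data T U F' G'"
    "p = (\<Sum>v\<in>verts F'. Poly_Mapping.single (ptree_of (graft_at F' G' v) (verts F' \<union> verts G')) 1)" by blast
  have "ptree_of F' (verts F') = ptree_of F (verts F)" "ptree_of G' (verts G') = ptree_of G (verts G)"
    using F' assms unfolding graft_data_def by simp_all
  then show "p = (\<Sum>v\<in>verts F. Poly_Mapping.single (ptree_of (graft_at F G v) (verts F \<union> verts G)) 1)"
    unfolding F'(2) using F'(1) assms unfolding graft_data_def by (intro ptree_of_graft_at_cong) simp_all
qed (use assms in blast)

text \<open>The hypothesis on roots makes the edges leaving \<open>v\<close> the same whether one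
  restricts before or after grafting. By \<open>roots_restrict_complement\<close> it holds when
  \<open>Y\<close> is the complement of an ideal.\<close>

lemma ptree_of_graft_at_restrict:
  assumes F: "partitioned_forest F" and G: "partitioned_forest G" and d: "verts F \<inter> verts G = {}"
    and v: "v \<in> X" and X: "X \<subseteq> verts F" and Y: "Y \<subseteq> verts G"
    and rY: "roots (restrict_pforest G Y) = roots G \<inter> Y"
  shows "ptree_of (graft_at (restrict_pforest F X) (restrict_pforest G Y) v) (X \<union> Y) = ptree_of (graft_at F G v) (X \<union> Y)"
proof (rule ptree_of_eqI[where f = id])
  let ?K = "graft_at F G v" and ?K' = "graft_at (restrict_pforest F X) (restrict_pforest G Y) v"
  have vX: "verts F \<inter> X = X" "verts G \<inter> Y = Y" using X Y by auto
  show "partitioned_forest ?K'"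
    by (rule partitioned_forest_graft_at) (use d v X in \<open>auto intro: partitioned_forest_restrict F G\<close>)
  show "partitioned_forest ?K"
    by (rule partitioned_forest_graft_at[OF F G d]) (use v X in auto)
  show "X \<union> Y \<subseteq> verts ?K'" "X \<union> Y \<subseteq> verts ?K" using X Y by auto
  have eF: "a \<in> verts F \<and> b \<in> verts F" if "(a, b) \<in> edges F" for a b using partitioned_forest_edgeD[OF F that] .
  have eG: "a \<in> verts G \<and> b \<in> verts G" if "(a, b) \<in> edges G" for a b using partitioned_forest_edgeD[OF G that] .
  have nX: "a \<in> X" if "a \<in> X \<union> Y" "a \<in> verts F" for a using that Y d by blast
  have nY: "a \<in> Y" if "a \<in> X \<union> Y" "a \<in> verts G" for a using that X d by blast
  show "(a, b) \<in> edges ?K' \<longleftrightarrow> (id a, id b) \<in> edges ?K" if "a \<in> X \<union> Y" "b \<in> X \<union> Y" for a b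
    using eF[of a b] eG[of a b] nX[OF that(1)] nX[OF that(2)] nY[OF that(1)] nY[OF that(2)] rY roots_subset[of G]
    by (auto simp: vX)
  show "deco ?K (id a) = deco ?K' a" if "a \<in> X \<union> Y" for a
    using nX[OF that] X by (auto simp: vX)
  show "same_block ?K' a b \<longleftrightarrow> same_block ?K (id a) (id b)" if "a \<in> X \<union> Y" "b \<in> X \<union> Y" for a b
    unfolding same_block_graft_at[OF G] same_block_graft_at[OF partitioned_forest_restrict[OF G]] rY
    using same_blockD[OF F, of a b] same_blockD[OF G, of a b] roots_subset[of G]
      nX[OF that(1)] nX[OF that(2)] nY[OF that(1)] nY[OF that(2)] by auto
qed simp

lemma ptree_graft_ptree_of:
  assumes F: "partitioned_forest F" and G: "partitioned_forest G" and d: "verts F \<inter> verts G = {}"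
    and X: "X \<subseteq> verts F" and Y: "Y \<subseteq> verts G" and rY: "roots (restrict_pforest G Y) = roots G \<inter> Y"
  shows "ptree_graft (ptree_of F X) (ptree_of G Y) =
    (\<Sum>v\<in>X. Poly_Mapping.single (ptree_of (graft_at F G v) (X \<union> Y)) (1::'k::field))"
proof -
  have v: "verts (restrict_pforest F X) = X" "verts (restrict_pforest G Y) = Y" using X Y by auto
  have "graft_data (ptree_of F X) (ptree_of G Y) (restrict_pforest F X) (restrict_pforest G Y)"
    unfolding graft_data_def v
    using partitioned_forest_restrict F G ptree_of_restrict[OF F subset_refl X] ptree_of_restrict[OF G subset_refl Y] d X Y
    by auto
  from ptree_graft_eq[OF this] show ?thesis
    by (simp only: v ptree_of_graft_at_restrict[OF F G d _ X Y rY] cong: sum.cong)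
qed

lemma ptree_of_graft_at_left:
  assumes F: "partitioned_forest F" and G: "partitioned_forest G" and d: "verts F \<inter> verts G = {}"
    and v: "v \<in> verts F" and X: "X \<subseteq> verts F"
  shows "ptree_of (graft_at F G v) X = ptree_of F X"
proof (rule ptree_of_eqI[where f = id])
  show "partitioned_forest (graft_at F G v)" by (rule partitioned_forest_graft_at[OF F G d v])
  have n: "a \<notin> verts G" if "a \<in> X" for a using that X d by blast
  show "(a, b) \<in> edges (graft_at F G v) \<longleftrightarrow> (id a, id b) \<in> edges F" if "a \<in> X" "b \<in> X" for a b
    using n[OF that(2)] partitioned_forest_edgeD[OF G, of a b] roots_subset[of G] by auto
  show "same_block (graft_at F G v) a b \<longleftrightarrow> same_block F (id a) (id b)" if "a \<in> X" "b \<in> X" for a b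
    unfolding same_block_graft_at[OF G]
    using n[OF that(2)] same_blockD[OF G, of a b] roots_subset[of G] by auto
qed (use X F in auto)

text \<open>A root of \<open>G\<close> has no parent inside \<open>Y\<close>, so the block that
  grafting makes of these roots is never compared; \<open>ptree_of\<close> merges them in any
  case.\<close>

lemma ptree_of_graft_at_right:
  assumes F: "partitioned_forest F" and G: "partitioned_forest G" and d: "verts F \<inter> verts G = {}"
    and v: "v \<in> verts F" and Y: "Y \<subseteq> verts G"
  shows "ptree_of (graft_at F G v) Y = ptree_of G Y"
proof (rule ptree_of_eqI[where f = id])
  show "partitioned_forest (graft_at F G v)" by (rule partitioned_forest_graft_at[OF F G d v])
  have n: "a \<notin> verts F" "a \<noteq> v" if "a \<in> Y" for a using that Y d v by auto
  show e: "(a, b) \<in> edges (graft_at F G v) \<longleftrightarrow> (id a, id b) \<in> edges G" if "a \<in> Y" "b \<in> Y" for a b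
    using n[OF that(1)] partitioned_forest_edgeD[OF F, of a b] by auto
  show "same_block (graft_at F G v) a b \<longleftrightarrow> same_block G (id a) (id b)"
    if "w \<in> Y" "a \<in> Y" "b \<in> Y" "(w, a) \<in> edges (graft_at F G v)" "(w, b) \<in> edges (graft_at F G v)" for w a b
    unfolding same_block_graft_at[OF G]
    using e[OF that(1,2)] that(4) n[OF that(2)] same_blockD[OF F, of a b] roots_no_parent[of a G w] by auto
  show "deco G (id a) = deco (graft_at F G v) a" if "a \<in> Y" for a using n[OF that] by simp
qed (use Y G in auto)

section \<open>Ideals of a grafted forest and the coproduct of a graft\<close>

lemma separated_graft_at:
  assumes F: "partitioned_forest F" and G: "partitioned_forest G" and d: "verts F \<inter> verts G = {}"
    and J: "J \<subseteq> verts F" "v \<notin> J" and L: "L \<subseteq> verts G"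
  shows "separated (graft_at F G v) J L"
proof -
  have "(a, b) \<notin> edges (graft_at F G v) \<and> (b, a) \<notin> edges (graft_at F G v)" if "a \<in> J" "b \<in> L" for a b
  proof -
    have "a \<in> verts F" "b \<in> verts G" "a \<notin> verts G" "b \<notin> verts F" "a \<noteq> v" using that J L d by auto
    then show ?thesis
      using partitioned_forest_edgeD[OF F, of a b] partitioned_forest_edgeD[OF F, of b a]
        partitioned_forest_edgeD[OF G, of a b] partitioned_forest_edgeD[OF G, of b a] roots_subset[of G] by auto
  qed
  then show ?thesis using J L d unfolding separated_def graft_at_simps by blast
qed

text \<open>If the complement of an ideal is nonempty it has a root. A parent of that root could lie
  neither in the complement nor in the ideal, so it would be a root of \<open>G\<close> outside
  \<open>I\<close>.\<close>

lemma ideal_containing_roots: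
  assumes G: "partitioned_forest G" and I: "I \<in> ideals_in G (verts G)" and r: "roots G \<subseteq> I"
  shows "I = verts G"
proof (rule ccontr)
  assume "I \<noteq> verts G"
  then have "verts (restrict_pforest G (verts G - I)) \<noteq> {}" using ideals_inD[OF I] by auto
  from acyclic_has_root[OF partitioned_forest_restrict[OF G] this]
  obtain x where x: "x \<in> verts G" "x \<notin> I" "\<And>u. u \<in> verts G - I \<Longrightarrow> (u, x) \<notin> edges G"
    unfolding restrict_roots[OF partitioned_forestD(2)[OF G]] by blast
  have "(u, x) \<notin> edges G" for u
  proof
    assume u: "(u, x) \<in> edges G"
    then have "u \<in> I" using x(3) partitioned_forest_edgeD[OF G u] by blast
    then have "x \<in> I" using I u x(1) unfolding ideals_in_def by blast
    with x(2) show False ..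
  qed
  then have "x \<in> roots G" using x(1) by (simp add: roots_def)
  with r x(2) show False by blast
qed

text \<open>The complement of an ideal contains the parents of its vertices, so restriction to it
  creates no new roots.\<close>

lemma roots_restrict_complement:
  assumes G: "partitioned_forest G" and I: "I \<in> ideals_in G (verts G)"
  shows "roots (restrict_pforest G (verts G - I)) = roots G \<inter> (verts G - I)"
proof -
  have "(u, x) \<notin> edges G" if "x \<in> verts G - I" "\<forall>u\<in>verts G - I. (u, x) \<notin> edges G" for u x
  proof
    assume u: "(u, x) \<in> edges G"
    then have "u \<in> I" using that partitioned_forest_edgeD[OF G u] by blast
    then have "x \<in> I" using I u that(1) unfolding ideals_in_def by blast
    with that(1) show False by blast
  qed
  moreover have "roots G = {x \<in> verts G. \<forall>u. (u, x) \<notin> edges G}" by (simp add: roots_def)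
  ultimately show ?thesis unfolding restrict_roots[OF partitioned_forestD(2)[OF G]] by blast
qed

text \<open>An ideal that contains \<open>v\<close> contains the roots of \<open>G\<close> and hence
  all of \<open>G\<close>. If it does not contain \<open>v\<close>, its parts in \<open>F\<close>
  and in \<open>G\<close> are independent ideals.\<close>

lemma sum_ideals_in_graft_at:
  assumes F: "partitioned_forest F" and G: "partitioned_forest G" and d: "verts F \<inter> verts G = {}"
    and v: "v \<in> verts F"
  shows "(\<Sum>I\<in>ideals_in (graft_at F G v) (verts F \<union> verts G). f I) =
    (\<Sum>J | J \<in> ideals_in F (verts F) \<and> v \<in> J. f (J \<union> verts G)) +
    (\<Sum>J | J \<in> ideals_in F (verts F) \<and> v \<notin> J. \<Sum>L\<in>ideals_in G (verts G). f (J \<union> L))"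
proof -
  let ?K = "graft_at F G v" and ?V = "verts F" and ?W = "verts G"
  have pK: "partitioned_forest ?K" by (rule partitioned_forest_graft_at[OF F G d v])
  have finK: "finite (ideals_in ?K (?V \<union> ?W))" by (rule finite_ideals_in[OF pK]) simp
  have eF: "a \<in> ?V \<and> b \<in> ?V" if "(a, b) \<in> edges F" for a b using partitioned_forest_edgeD[OF F that] .
  have eG: "a \<in> ?W \<and> b \<in> ?W" if "(a, b) \<in> edges G" for a b using partitioned_forest_edgeD[OF G that] .
  have closed: "b \<in> I" if "I \<in> ideals_in ?K (?V \<union> ?W)" "a \<in> I" "(a, b) \<in> edges ?K" for I a b
  proof -
    have "b \<in> ?V \<union> ?W" using partitioned_forest_edgeD[OF pK that(3)] by simp
    then show ?thesis using that unfolding ideals_in_def by blast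
  qed
  have IF: "I \<inter> ?V \<in> ideals_in F ?V" and IG: "I \<inter> ?W \<in> ideals_in G ?W"
    if I: "I \<in> ideals_in ?K (?V \<union> ?W)" for I
    unfolding ideals_in_def by (auto intro: closed[OF I])
  have sub: "I \<subseteq> ?V \<union> ?W" if "I \<in> ideals_in ?K (?V \<union> ?W)" for I by (rule ideals_inD[OF that])
  have full: "?W \<subseteq> I" if I: "I \<in> ideals_in ?K (?V \<union> ?W)" and vI: "v \<in> I" for I
  proof -
    have "roots G \<subseteq> I \<inter> ?W" using closed[OF I vI] roots_subset[of G] by auto
    from ideal_containing_roots[OF G IG[OF I] this] show ?thesis by blast
  qed
  have ideal: "J \<union> L \<in> ideals_in ?K (?V \<union> ?W)"
    if J: "J \<in> ideals_in F ?V" and L: "L \<in> ideals_in G ?W" and "v \<in> J \<Longrightarrow> L = ?W" for J L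
  proof -
    have "b \<in> J \<union> L" if ab: "a \<in> J \<union> L" "(a, b) \<in> edges ?K" for a b
    proof -
      have aW: "a \<in> L" if "a \<in> ?W" using that ab(1) ideals_inD[OF J] d by blast
      have aV: "a \<in> J" if "a \<in> ?V" using that ab(1) ideals_inD[OF L] d by blast
      from ab(2) consider "(a, b) \<in> edges F" | "(a, b) \<in> edges G" | "a = v" "b \<in> roots G" by auto
      then show ?thesis
      proof cases
        case 1
        then show ?thesis using eF[OF 1] aV J unfolding ideals_in_def by blast
      next
        case 2
        then show ?thesis using eG[OF 2] aW L unfolding ideals_in_def by blast
      next
        case 3
        then show ?thesis using aV v \<open>v \<in> J \<Longrightarrow> L = ?W\<close> roots_subset[of G] by blast
      qed
    qed
    then show ?thesis using ideals_inD[OF J] ideals_inD[OF L] unfolding ideals_in_def by blast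
  qed
  have "(\<Sum>I\<in>ideals_in ?K (?V \<union> ?W). f I) =
      (\<Sum>I | I \<in> ideals_in ?K (?V \<union> ?W) \<and> v \<in> I. f I) + (\<Sum>I | I \<in> ideals_in ?K (?V \<union> ?W) \<and> v \<notin> I. f I)"
    by (subst sum.union_disjoint[symmetric]) (auto simp: finK intro!: sum.cong)
  also have "(\<Sum>I | I \<in> ideals_in ?K (?V \<union> ?W) \<and> v \<in> I. f I) =
      (\<Sum>J | J \<in> ideals_in F ?V \<and> v \<in> J. f (J \<union> ?W))"
  proof (rule sum.reindex_bij_witness[where i = "\<lambda>J. J \<union> ?W" and j = "\<lambda>I. I \<inter> ?V"])
    fix I assume "I \<in> {I. I \<in> ideals_in ?K (?V \<union> ?W) \<and> v \<in> I}"
    then have I: "I \<in> ideals_in ?K (?V \<union> ?W)" "v \<in> I" by auto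
    show e: "I \<inter> ?V \<union> ?W = I" using sub[OF I(1)] full[OF I] by blast
    show "I \<inter> ?V \<in> {J. J \<in> ideals_in F ?V \<and> v \<in> J}" using IF[OF I(1)] I(2) v by blast
    show "f (I \<inter> ?V \<union> ?W) = f I" using e by simp
  next
    fix J assume J: "J \<in> {J. J \<in> ideals_in F ?V \<and> v \<in> J}"
    then show "(J \<union> ?W) \<inter> ?V = J" using d ideals_inD[of J F ?V] by blast
    show "J \<union> ?W \<in> {I. I \<in> ideals_in ?K (?V \<union> ?W) \<and> v \<in> I}" using ideal[OF _ full_ideal] J by blast
  qed
  also have "(\<Sum>I | I \<in> ideals_in ?K (?V \<union> ?W) \<and> v \<notin> I. f I) =
      (\<Sum>(J, L)\<in>{J. J \<in> ideals_in F ?V \<and> v \<notin> J} \<times> ideals_in G ?W. f (J \<union> L))"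
  proof (rule sum.reindex_bij_witness[where i = "\<lambda>(J, L). J \<union> L" and j = "\<lambda>I. (I \<inter> ?V, I \<inter> ?W)"])
    fix I assume "I \<in> {I. I \<in> ideals_in ?K (?V \<union> ?W) \<and> v \<notin> I}"
    then have I: "I \<in> ideals_in ?K (?V \<union> ?W)" "v \<notin> I" by auto
    have e: "I \<inter> ?V \<union> I \<inter> ?W = I" using sub[OF I(1)] by blast
    then show "(\<lambda>(J, L). J \<union> L) (I \<inter> ?V, I \<inter> ?W) = I" "(case (I \<inter> ?V, I \<inter> ?W) of (J, L) \<Rightarrow> f (J \<union> L)) = f I" by simp_all
    show "(I \<inter> ?V, I \<inter> ?W) \<in> {J. J \<in> ideals_in F ?V \<and> v \<notin> J} \<times> ideals_in G ?W" using IF[OF I(1)] IG[OF I(1)] I(2) by blast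
  next
    fix t assume "t \<in> {J. J \<in> ideals_in F ?V \<and> v \<notin> J} \<times> ideals_in G ?W"
    then obtain J L where t: "t = (J, L)" "J \<in> ideals_in F ?V" "v \<notin> J" "L \<in> ideals_in G ?W" by blast
    have JL: "J \<subseteq> ?V" "L \<subseteq> ?W" using t by (auto dest: ideals_inD)
    have "(J \<union> L) \<inter> ?V = J" "(J \<union> L) \<inter> ?W = L" using JL d by auto
    then show "((\<lambda>(J, L). J \<union> L) t \<inter> ?V, (\<lambda>(J, L). J \<union> L) t \<inter> ?W) = t" by (simp add: t(1))
    have "v \<notin> L" using JL v d by blast
    then show "(\<lambda>(J, L). J \<union> L) t \<in> {I. I \<in> ideals_in ?K (?V \<union> ?W) \<and> v \<notin> I}"
      using ideal[OF t(2,4)] t(3) by (simp add: t(1))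
  qed
  finally show ?thesis by (simp add: sum.cartesian_product)
qed

text \<open>If the grafting vertex lies in the ideal, all of \<open>U\<close> stays attached to it
  in the right leg: the first sum. Otherwise the cut also divides \<open>U\<close>; its upper part
  is grafted in the left leg and its lower part becomes a factor of the right leg: the second
  sum.\<close>

lemma ptree_coprod_graft:
  "lin_ext ptree_coprod (ptree_graft T U) =
     lin_ext (\<lambda>(a, b). tensor (Poly_Mapping.single a 1) (ptree_graft b U)) (ptree_coprod T) +
     lin_ext (\<lambda>(a, b). lin_ext (\<lambda>(c, d). tensor (ptree_graft a c) (Poly_Mapping.single (b + d) 1)) (ptree_coprod U))
       (ptree_coprod T :: _ \<Rightarrow>\<^sub>0 'k::field)"
proof -
  obtain F G where "graft_data T U F G" using ex_graft_data by blast
  then have F: "partitioned_forest F" and G: "partitioned_forest G" and d: "verts F \<inter> verts G = {}"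
    and T: "T = ptree_of F (verts F)" and U: "U = ptree_of G (verts G)" by (auto simp: graft_data_def)
  let ?V = "verts F" and ?W = "verts G" and ?K = "graft_at F G"
  let ?s = "\<lambda>x. Poly_Mapping.single x (1::'k)"
  let ?IF = "ideals_in F ?V" and ?IG = "ideals_in G ?W"
  have K: "partitioned_forest (?K v)" if "v \<in> ?V" for v by (rule partitioned_forest_graft_at[OF F G d that])
  have finV: "finite ?V" "finite ?IF" by (rule partitioned_forestD(1)[OF F] finite_ideals_in[OF F subset_refl])+
  have graftW: "ptree_graft (ptree_of F J) U = (\<Sum>v\<in>J. ?s (ptree_of (?K v) (J \<union> ?W)))" if "J \<subseteq> ?V" for J
    unfolding U using roots_subset[of G]
    by (intro ptree_graft_ptree_of[OF F G d that]) (auto simp: restrict_roots[OF partitioned_forestD(2)[OF G]] roots_def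
        dest: partitioned_forest_edgeD[OF G])
  have single_L: "?s (ptree_of (?K v) (?V \<union> ?W - (J \<union> L)), ptree_of (?K v) (J \<union> L)) =
      ?s (ptree_of (?K v) ((?V - J) \<union> (?W - L)), ptree_of F J + ptree_of G L)"
    if "v \<in> ?V" "J \<in> ?IF" "v \<notin> J" "L \<in> ?IG" for v J L
  proof -
    have JL: "J \<subseteq> ?V" "L \<subseteq> ?W" using that by (auto dest: ideals_inD)
    have "?V \<union> ?W - (J \<union> L) = (?V - J) \<union> (?W - L)" using JL d by blast
    moreover have "ptree_of (?K v) (J \<union> L) = ptree_of F J + ptree_of G L"
      using ptree_of_add[OF K[OF that(1)] separated_graft_at[OF F G d JL(1) that(3) JL(2)]]
        ptree_of_graft_at_left[OF F G d that(1) JL(1)] ptree_of_graft_at_right[OF F G d that(1) JL(2)] by simp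
    ultimately show ?thesis by simp
  qed
  have single_W: "?s (ptree_of (?K v) (?V \<union> ?W - (J \<union> ?W)), ptree_of (?K v) (J \<union> ?W)) =
      ?s (ptree_of F (?V - J), ptree_of (?K v) (J \<union> ?W))"
    if "v \<in> ?V" "J \<in> ?IF" for v J
  proof -
    have "?V \<union> ?W - (J \<union> ?W) = ?V - J" using d by blast
    then show ?thesis using ptree_of_graft_at_left[OF F G d that(1), of "?V - J"] by auto
  qed
  have "lin_ext ptree_coprod (ptree_graft T U :: _ \<Rightarrow>\<^sub>0 'k) = (\<Sum>v\<in>?V. ptree_coprod (ptree_of (?K v) (?V \<union> ?W)))"
    using graftW[OF subset_refl] by (simp add: T lin_ext_sum)
  also have "\<dots> = (\<Sum>v\<in>?V.
      (\<Sum>J | J \<in> ?IF \<and> v \<in> J. ?s (ptree_of F (?V - J), ptree_of (?K v) (J \<union> ?W))) +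
      (\<Sum>J | J \<in> ?IF \<and> v \<notin> J. \<Sum>L\<in>?IG. ?s (ptree_of (?K v) ((?V - J) \<union> (?W - L)), ptree_of F J + ptree_of G L)))"
  proof (rule sum.cong[OF refl])
    fix v assume v: "v \<in> ?V"
    have "ptree_coprod (ptree_of (?K v) (?V \<union> ?W)) =
        (\<Sum>I\<in>ideals_in (?K v) (?V \<union> ?W). ?s (ptree_of (?K v) (?V \<union> ?W - I), ptree_of (?K v) I))"
      by (rule ptree_coprod_ptree_of[OF K[OF v]]) simp
    also have "\<dots> = (\<Sum>J | J \<in> ?IF \<and> v \<in> J. ?s (ptree_of (?K v) (?V \<union> ?W - (J \<union> ?W)), ptree_of (?K v) (J \<union> ?W))) +
        (\<Sum>J | J \<in> ?IF \<and> v \<notin> J. \<Sum>L\<in>?IG. ?s (ptree_of (?K v) (?V \<union> ?W - (J \<union> L)), ptree_of (?K v) (J \<union> L)))"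
      by (rule sum_ideals_in_graft_at[OF F G d v])
    also have "\<dots> = (\<Sum>J | J \<in> ?IF \<and> v \<in> J. ?s (ptree_of F (?V - J), ptree_of (?K v) (J \<union> ?W))) +
        (\<Sum>J | J \<in> ?IF \<and> v \<notin> J. \<Sum>L\<in>?IG. ?s (ptree_of (?K v) ((?V - J) \<union> (?W - L)), ptree_of F J + ptree_of G L))"
      by (intro arg_cong2[of _ _ _ _ "(+)"] sum.cong[OF refl]) (auto intro!: single_W single_L v simp del: inj_single)
    finally show "ptree_coprod (ptree_of (?K v) (?V \<union> ?W)) = \<dots>" .
  qed
  \<comment> \<open>The sums are exchanged: for a fixed ideal J of \<open>F\<close>, the grafting
    vertices inside J and outside J are collected.\<close>
  also have "\<dots> = (\<Sum>J\<in>?IF. \<Sum>v\<in>J. ?s (ptree_of F (?V - J), ptree_of (?K v) (J \<union> ?W))) +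
      (\<Sum>J\<in>?IF. \<Sum>v\<in>?V - J. \<Sum>L\<in>?IG. ?s (ptree_of (?K v) ((?V - J) \<union> (?W - L)), ptree_of F J + ptree_of G L))"
  proof -
    have "{v \<in> ?V. v \<in> J} = J" if "J \<in> ?IF" for J using ideals_inD[OF that] by blast
    moreover have "{v \<in> ?V. v \<notin> J} = ?V - J" for J by blast
    ultimately show ?thesis
      unfolding sum.distrib by (simp add: sum.swap_restrict[OF finV] cong: sum.cong)
  qed
  also have "(\<Sum>J\<in>?IF. \<Sum>v\<in>J. ?s (ptree_of F (?V - J), ptree_of (?K v) (J \<union> ?W))) =
      lin_ext (\<lambda>(a, b). tensor (?s a) (ptree_graft b U)) (ptree_coprod T)"
    by (simp add: T ptree_coprod_ptree_of[OF F] lin_ext_sum graftW ideals_inD lin_sum[OF lin_tensor_right] cong: sum.cong)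
  also have "(\<Sum>J\<in>?IF. \<Sum>v\<in>?V - J. \<Sum>L\<in>?IG. ?s (ptree_of (?K v) ((?V - J) \<union> (?W - L)), ptree_of F J + ptree_of G L)) =
      lin_ext (\<lambda>(a, b). lin_ext (\<lambda>(c, d). tensor (ptree_graft a c) (?s (b + d))) (ptree_coprod U)) (ptree_coprod T)"
  proof -
    have "ptree_graft (ptree_of F (?V - J)) (ptree_of G (?W - L)) =
        (\<Sum>v\<in>?V - J. ?s (ptree_of (?K v) ((?V - J) \<union> (?W - L))))" if "L \<in> ?IG" for J L
      by (rule ptree_graft_ptree_of[OF F G d _ _ roots_restrict_complement[OF G that]]) auto
    then show ?thesis
      by (subst sum.swap)
        (simp add: T U ptree_coprod_ptree_of[OF F] ptree_coprod_ptree_of[OF G] lin_ext_sum lin_sum[OF lin_tensor_left] cong: sum.cong)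
  qed
  finally show ?thesis .
qed

lemma keys_ptree_graft:
  assumes "V \<in> Poly_Mapping.keys (ptree_graft T U :: _ \<Rightarrow>\<^sub>0 'k::field)"
  shows "ptree_nodes V = ptree_nodes T + ptree_nodes U" "ptree_decos V = ptree_decos T \<union> ptree_decos U"
proof -
  obtain F G where FG: "graft_data T U F G" using ex_graft_data by blast
  then have F: "partitioned_forest F" and G: "partitioned_forest G" and d: "verts F \<inter> verts G = {}"
    and T: "T = ptree_of F (verts F)" and U: "U = ptree_of G (verts G)" by (auto simp: graft_data_def)
  have "V \<in> (\<Union>v\<in>verts F. Poly_Mapping.keys (Poly_Mapping.single (ptree_of (graft_at F G v) (verts F \<union> verts G)) (1::'k)))"
    using assms unfolding ptree_graft_eq[OF FG] by (rule subsetD[OF keys_sum])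
  then obtain v where v: "v \<in> verts F" "V = ptree_of (graft_at F G v) (verts F \<union> verts G)" by auto
  note K = partitioned_forest_graft_at[OF F G d v(1)]
  show "ptree_nodes V = ptree_nodes T + ptree_nodes U"
    using card_Un_disjoint[OF partitioned_forestD(1)[OF F] partitioned_forestD(1)[OF G] d]
    by (simp add: v(2) T U ptree_nodes_ptree_of F G K)
  have "deco (graft_at F G v) ` verts F = deco F ` verts F" "deco (graft_at F G v) ` verts G = deco G ` verts G"
    using d by (auto intro!: image_cong)
  then show "ptree_decos V = ptree_decos T \<union> ptree_decos U"
    by (simp add: v(2) T U ptree_decos_ptree_of F G K image_Un del: graft_at_simps(3))
qed

lemma ptree_nodes_eq_0_iff: "ptree_nodes T = 0 \<longleftrightarrow> T = 0"
proof -
  obtain F where "partitioned_tree F" and T: "T = ptree_of F (verts F)" by (rule ptree_cases)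
  then have F: "partitioned_forest F" by (simp add: partitioned_tree_def)
  show ?thesis
    using ptree_of_eq_empty_iff[OF F subset_refl] partitioned_forestD(1)[OF F]
    by (simp add: T zero_ptree_def ptree_nodes_ptree_of[OF F])
qed

lemma ptree_nodes_add: "ptree_nodes (T + U) = ptree_nodes T + ptree_nodes U"
proof -
  obtain H A B where H: "partitioned_forest H" and s: "separated H A B" and T: "T = ptree_of H A" "U = ptree_of H B"
    by (rule ex_separated)
  then have "A \<subseteq> verts H" "B \<subseteq> verts H" "A \<inter> B = {}" by (auto simp: separated_def)
  then show ?thesis
    using card_Un_disjoint[of A B] finite_subset_verts[OF H]
    by (simp add: T ptree_of_add[OF H s] ptree_nodes_ptree_of[OF H])
qed

lemma ptree_graft_zero:
  fixes T U :: "'d ptree"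
  shows "ptree_graft 0 U = (0 :: _ \<Rightarrow>\<^sub>0 'k::field)"
  "ptree_graft T 0 = Poly_Mapping.single T (of_nat (ptree_nodes T) :: 'k::field)"
proof -
  obtain F G where FG: "graft_data T U F G" using ex_graft_data by blast
  then have F: "partitioned_forest F" and G: "partitioned_forest G" and d: "verts F \<inter> verts G = {}"
    and T: "T = ptree_of F (verts F)" and U: "U = ptree_of G (verts G)" by (auto simp: graft_data_def)
  have r: "roots (restrict_pforest G (verts G)) = roots G \<inter> verts G"
    using roots_restrict_complement[OF G empty_ideal] by simp
  show "ptree_graft 0 U = (0 :: _ \<Rightarrow>\<^sub>0 'k)"
    using ptree_graft_ptree_of[OF F G d empty_subsetI subset_refl r, where ?'k = 'k]
    by (simp add: U ptree_of_empty[OF F] zero_ptree_def)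
  have "roots (restrict_pforest G {}) = roots G \<inter> {}" by (auto simp: roots_def)
  from ptree_graft_ptree_of[OF F G d subset_refl empty_subsetI this, where ?'k = 'k]
  have "ptree_graft T 0 = (\<Sum>v\<in>verts F. Poly_Mapping.single (ptree_of (graft_at F G v) (verts F)) (1::'k))"
    by (simp add: T ptree_of_empty[OF G] zero_ptree_def)
  also have "\<dots> = (\<Sum>v\<in>verts F. Poly_Mapping.single T 1)"
    by (rule sum.cong) (simp_all add: T ptree_of_graft_at_left[OF F G d])
  also have "\<dots> = Poly_Mapping.single T (of_nat (card (verts F)))"
    by (simp add: mult_single flip: single_of_nat)
  finally show "ptree_graft T 0 = Poly_Mapping.single T (of_nat (ptree_nodes T) :: 'k)"
    by (simp add: T ptree_nodes_ptree_of[OF F])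
qed

section \<open>The algebra of partitioned trees as an instance, and the conclusion\<close>

lemma grafting_bialgebra_CP:
  "grafting_bialgebra (ptree_coprod :: _ \<Rightarrow> _ \<Rightarrow>\<^sub>0 'k::field_char_0) ptree_nodes ptree_graft {T. ptree_decos T \<subseteq> D}"
proof
  show "ptree_nodes y + ptree_nodes z = ptree_nodes x"
    if "(y, z) \<in> Poly_Mapping.keys (ptree_coprod x :: _ \<Rightarrow>\<^sub>0 'k)" for x y z :: "'a ptree"
    using keys_ptree_coprod(1)[OF that] by simp
  show "y \<in> {T. ptree_decos T \<subseteq> D} \<and> z \<in> {T. ptree_decos T \<subseteq> D}"
    if "x \<in> {T. ptree_decos T \<subseteq> D}" "(y, z) \<in> Poly_Mapping.keys (ptree_coprod x :: _ \<Rightarrow>\<^sub>0 'k)" for x y z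
    using keys_ptree_coprod(2)[OF that(2)] that(1) by auto
  show "z \<in> {T. ptree_decos T \<subseteq> D}"
    if "x \<in> {T. ptree_decos T \<subseteq> D}" "y \<in> {T. ptree_decos T \<subseteq> D}"
      "z \<in> Poly_Mapping.keys (ptree_graft x y :: _ \<Rightarrow>\<^sub>0 'k)" for x y z
    using keys_ptree_graft(2)[OF that(3)] that(1,2) by auto
  \<comment> \<open>Any representative will do, as only its empty subset is considered.\<close>
  obtain H :: "(nat, 'a) pforest" where "partitioned_tree H" using partitioned_tree_empty by blast
  then have H: "partitioned_forest H" by (simp add: partitioned_tree_def)
  show "0 \<in> {T. ptree_decos T \<subseteq> D}"
    using ptree_decos_ptree_of[OF H, of "{}"] by (simp add: zero_ptree_def ptree_of_empty[OF H])
  show "ptree_nodes z = ptree_nodes x + ptree_nodes y"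
    if "z \<in> Poly_Mapping.keys (ptree_graft x y :: _ \<Rightarrow>\<^sub>0 'k)" for x y z :: "'a ptree"
    by (rule keys_ptree_graft(1)[OF that])
qed (fact ptree_nodes_add ptree_nodes_eq_0_iff ptree_coprod_add ptree_counit ptree_coassoc ptree_graft_zero ptree_coprod_graft)+

lemma CP_hopf_isomorphic:
  "\<exists>V :: ('d ptree \<Rightarrow>\<^sub>0 'k::field_char_0) set. module.subspace pm_scale V \<and>
     hopf_isomorphic (CP_algebra D :: ('d ptree, 'k) bialg) (shuffle_algebra V)"
proof -
  interpret grafting_bialgebra "ptree_coprod :: 'd ptree \<Rightarrow> _ \<Rightarrow>\<^sub>0 'k" ptree_nodes ptree_graft "{T. ptree_decos T \<subseteq> D}"
    by (rule grafting_bialgebra_CP)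
  have "hopf_isomorphic (CP_algebra D :: ('d ptree, 'k) bialg) (shuffle_algebra prim)"
  proof (rule hopf_isomorphic_shuffle_algebra)
    show "hmult (CP_algebra D :: ('d ptree, 'k) bialg) = (*)"
      by (intro ext) (simp add: CP_algebra_def mult_eq_bilin_ext plus_ptree_def)
  qed (auto simp: CP_algebra_def zero_ptree_def simp flip: single_one)
  with subspace_prim show ?thesis by blast
qed

theorem corollary4p9:
  fixes D :: "'d set"
  shows "(\<exists>V :: ('d ptree \<Rightarrow>\<^sub>0 'k::field_char_0) set. module.subspace pm_scale V \<and>
            hopf_isomorphic (CP_algebra D :: ('d ptree, 'k) bialg) (shuffle_algebra V)) \<and>
         (\<exists>W :: ('d rforest \<Rightarrow>\<^sub>0 'k) set. module.subspace pm_scale W \<and>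
            hopf_isomorphic (CK_algebra D :: ('d rforest, 'k) bialg) (shuffle_algebra W))"
  using CP_hopf_isomorphic CK_hopf_isomorphic by blast

end
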